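(* Let $\alpha$ be a strictly positive finite measure on $\mathbb{X}$ with total mass $a>0$, let $n\ge1$ be a fixed integer, and let $\{P_m^{(n)},m\ge0\}$ be the measure-valued Markov chain defined by $$P_m^{(n)}=\theta_m\sum_{i=1}^n q_{m,i}^{(n)}\,\delta_{Y_{m,i}}+(1-\theta_m)\,P_{m-1}^{(n)},\qquad m\ge1.$$ Let $g:\mathbb{X}\to\mathbb{R}$ be any measurable function and let $G_m^{(n)}=\int_{\mathbb{X}}g(x)\,P_m^{(n)}(\mathrm{d}x)$, $m\ge0$. If $$\int_{\mathbb{X}}\log\bigl(1+|g(x)|\bigr)\,\alpha(\mathrm{d}x)<+\infty,$$ then the Markov chain $\{G_m^{(n)},m\ge0\}$ is Harris ergodic with unique invariant measure $\Pi_g$, which is the law of the random Dirichlet mean $\int_{\mathbb{X}}g(x)\,P(\mathrm{d}x)$, where $P$ is a Dirichlet process on $\mathbb{X}$ with parameter $\alpha$.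
   Context: $\mathbb{X}$ is a Polish space with Borel $\sigma$-field $\mathscr{X}$, and $\mathcal{P}_{\mathbb{X}}$ is the space of probability measures on $\mathbb{X}$; $P_0^{(n)}\in\mathcal{P}_{\mathbb{X}}$ is arbitrary. $\{\theta_m,m\ge1\}$ is a sequence of independent random variables with Beta distribution with parameter $(n,a)$; $\{(q_{m,1}^{(n)},\ldots,q_{m,n}^{(n)}),m\ge1\}$ is a sequence of independent random vectors identically distributed according to the Dirichlet distribution with parameter $(1,\ldots,1)$ (so $\sum_{i=1}^n q_{m,i}^{(n)}=1$); $\{(Y_{m,1},\ldots,Y_{m,n}),m\ge1\}$ is a sequence of independent random vectors, each distributed as the first $n$ terms of a P\'olya sequence with parameter $\alpha$. These three sequences are mutually independent. A P\'olya sequence with parameter $\alpha$ is a sequence $\{Y_j,j\ge1\}$ of $\mathbb{X}$-valued random variables with $\mathbb{P}(Y_1\in A)=\alpha(A)/a$ and $\mathbb{P}(Y_{j+1}\in A\mid Y_1,\ldots,Y_j)=\frac{1}{a+j}\alpha(A)+\frac{1}{a+j}\sum_{i=1}^j\delta_{Y_i}(A)$ for $j\ge1$, $A\in\mathscr{X}$. The functional chain is a Markov chain on $\mathbb{R}$ satisfying $G_m^{(n)}=\theta_m\sum_{i=1}^n q_{m,i}^{(n)}g(Y_{m,i})+(1-\theta_m)G_{m-1}^{(n)}$. A Dirichlet process on $\mathbb{X}$ with parameter $\alpha$ is a random probability measure $P$ such that, for every finite measurable partition $B_1,\ldots,B_k$ of $\mathbb{X}$, $(P(B_1),\ldots,P(B_k))$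 has Dirichlet distribution with parameter $(\alpha(B_1),\ldots,\alpha(B_k))$. Harris ergodic means positive Harris recurrent and aperiodic.
   Formalization: Harris ergodicity is claimed only when g is not α-almost everywhere constant (otherwise the chain on ℝ is not irreducible and the claim fails); g is assumed integrable under the initial measure P_0, so that G_0 is defined. Uniqueness is among probability measures. *)

theory Defs
  imports "HOL-Probability.Probability"
begin

definition generated_by ::
  "'w measure \<Rightarrow> 'b measure \<Rightarrow> 'i set \<Rightarrow> ('i \<Rightarrow> 'w \<Rightarrow> 'b) \<Rightarrow> 'w measure" where
  "generated_by \<Omega> N I X =
     vimage_algebra (space \<Omega>) (\<lambda>\<omega>. \<lambda>i\<in>I. X i \<omega>) (PiM I (\<lambda>_. N))"

definition markov_chain ::
  "'w measure \<Rightarrow> 'a measure \<Rightarrow> ('a \<Rightarrow> 'a measure) \<Rightarrow> (nat \<Rightarrow> 'w \<Rightarrow> 'a) \<Rightarrow> bool" where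
  "markov_chain \<Omega> M K X \<longleftrightarrow>
     K \<in> measurable M (prob_algebra M) \<and>
     (\<forall>m. X m \<in> measurable \<Omega> M) \<and>
     (\<forall>m. \<forall>A\<in>sets M. AE \<omega> in \<Omega>.
        real_cond_exp \<Omega> (generated_by \<Omega> M {0..m} X)
          (indicator (X (Suc m) -` A \<inter> space \<Omega>)) \<omega> = measure (K (X m \<omega>)) A)"

text \<open>The law, on the space of trajectories, of the chain with transition kernel \<open>K\<close> started
  at \<open>x\<close>: the projective limit given by the Ionescu-Tulcea theorem.\<close>

definition path_step ::
  "'a measure \<Rightarrow> ('a \<Rightarrow> 'a measure) \<Rightarrow> 'a \<Rightarrow> nat \<Rightarrow> (nat \<Rightarrow> 'a) \<Rightarrow> 'a measure" where
  "path_step M K x i \<omega> = (case i of 0 \<Rightarrow> return M x | Suc j \<Rightarrow> K (\<omega> j))"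

definition path_law ::
  "'a measure \<Rightarrow> ('a \<Rightarrow> 'a measure) \<Rightarrow> 'a \<Rightarrow> (nat \<Rightarrow> 'a) measure" where
  "path_law M K x =
     projective_family.lim UNIV (Ionescu_Tulcea.CI (path_step M K x) (\<lambda>_. M)) (\<lambda>_. M)"

lemma Ionescu_Tulcea_path_step:
  assumes K: "K \<in> measurable M (prob_algebra M)" and x: "x \<in> space M"
  shows "Ionescu_Tulcea (path_step M K x) (\<lambda>_. M)"
proof (rule Ionescu_Tulcea.intro)
  have K': "K \<in> measurable M (subprob_algebra M)"
    using K by (rule measurable_prob_algebraD)
  show "path_step M K x i \<in> measurable (PiM {0..<i} (\<lambda>_. M)) (subprob_algebra M)" for i
  proof (cases i)
    case 0
    have "(\<lambda>\<omega>. return M x) \<in> measurable (PiM {0..<i} (\<lambda>_. M)) (subprob_algebra M)"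
      using x by (intro measurable_const)
        (simp add: space_subprob_algebra prob_space_return prob_space_imp_subprob_space)
    then show ?thesis by (simp add: path_step_def[abs_def] 0)
  next
    case (Suc j)
    have "(\<lambda>\<omega>. K (\<omega> j)) \<in> measurable (PiM {0..<i} (\<lambda>_. M)) (subprob_algebra M)"
      by (rule measurable_compose[OF _ K'], rule measurable_component_singleton) (simp add: Suc)
    then show ?thesis by (simp add: path_step_def[abs_def] Suc)
  qed
  show "prob_space (path_step M K x i \<omega>)"
    if \<omega>: "\<omega> \<in> space (PiM {0..<i} (\<lambda>_. M))" for i \<omega>
  proof (cases i)
    case 0
    then show ?thesis using x by (simp add: path_step_def prob_space_return)
  next
    case (Suc j)
    then have "\<omega> j \<in> space M" using \<omega> by (auto simp: space_PiM PiE_iff)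
    then have "K (\<omega> j) \<in> space (prob_algebra M)" by (rule measurable_space[OF K])
    then show ?thesis by (simp add: path_step_def Suc space_prob_algebra)
  qed
qed

definition irreducibility_measure ::
  "'a measure \<Rightarrow> ('a \<Rightarrow> 'a measure) \<Rightarrow> 'a measure \<Rightarrow> bool" where
  "irreducibility_measure M K \<phi> \<longleftrightarrow>
     sigma_finite_measure \<phi> \<and> sets \<phi> = sets M \<and> emeasure \<phi> (space M) > 0 \<and>
     (\<forall>A\<in>sets M. emeasure \<phi> A > 0 \<longrightarrow>
        (\<forall>x\<in>space M. measure (path_law M K x)
           {\<omega> \<in> space (path_law M K x). \<exists>m\<ge>1. \<omega> m \<in> A} > 0))"

definition maximal_irreducibility_measure ::
  "'a measure \<Rightarrow> ('a \<Rightarrow> 'a measure) \<Rightarrow> 'a measure \<Rightarrow> bool" where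
  "maximal_irreducibility_measure M K \<psi> \<longleftrightarrow>
     irreducibility_measure M K \<psi> \<and>
     (\<forall>\<phi>. irreducibility_measure M K \<phi> \<longrightarrow> absolutely_continuous \<psi> \<phi>)"

definition harris_recurrent :: "'a measure \<Rightarrow> ('a \<Rightarrow> 'a measure) \<Rightarrow> bool" where
  "harris_recurrent M K \<longleftrightarrow>
     (\<exists>\<psi>. maximal_irreducibility_measure M K \<psi> \<and>
        (\<forall>A\<in>sets M. emeasure \<psi> A > 0 \<longrightarrow>
           (\<forall>x\<in>space M. AE \<omega> in path_law M K x. \<exists>\<^sub>\<infinity>m. \<omega> m \<in> A)))"

definition invariant_probability ::
  "'a measure \<Rightarrow> ('a \<Rightarrow> 'a measure) \<Rightarrow> 'a measure \<Rightarrow> bool" where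
  "invariant_probability M K \<pi> \<longleftrightarrow>
     prob_space \<pi> \<and> sets \<pi> = sets M \<and> \<pi> \<bind> K = \<pi>"

definition cycle ::
  "'a measure \<Rightarrow> ('a \<Rightarrow> 'a measure) \<Rightarrow> 'a measure \<Rightarrow> nat \<Rightarrow> (nat \<Rightarrow> 'a set) \<Rightarrow> bool" where
  "cycle M K \<psi> d D \<longleftrightarrow>
     (\<forall>i<d. D i \<in> sets M) \<and> disjoint_family_on D {..<d} \<and>
     (\<forall>i<d. \<forall>x\<in>D i. measure (K x) (D (Suc i mod d)) = 1) \<and>
     emeasure \<psi> (space M - (\<Union>i<d. D i)) = 0"

text \<open>The period is the largest \<open>d\<close> for which a \<open>d\<close>-cycle exists, see Meyn and Tweedie,
  Markov Chains and Stochastic Stability, Section 5.4.\<close>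

definition aperiodic :: "'a measure \<Rightarrow> ('a \<Rightarrow> 'a measure) \<Rightarrow> bool" where
  "aperiodic M K \<longleftrightarrow>
     (\<exists>\<psi>. maximal_irreducibility_measure M K \<psi> \<and> \<not> (\<exists>d\<ge>2. \<exists>D. cycle M K \<psi> d D))"

definition harris_ergodic :: "'a measure \<Rightarrow> ('a \<Rightarrow> 'a measure) \<Rightarrow> bool" where
  "harris_ergodic M K \<longleftrightarrow>
     K \<in> measurable M (prob_algebra M) \<and>
     harris_recurrent M K \<and> (\<exists>\<pi>. invariant_probability M K \<pi>) \<and> aperiodic M K"


definition beta_measure :: "real \<Rightarrow> real \<Rightarrow> real measure" where
  "beta_measure b c = density lborel (\<lambda>x. ennreal
     (indicator {0<..<1} x * (x powr (b - 1) * (1 - x) powr (c - 1) / Beta b c)))"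

text \<open>Gamma distribution with shape \<open>b\<close> and rate 1, degenerate at 0 for shape 0.\<close>

definition gamma_measure :: "real \<Rightarrow> real measure" where
  "gamma_measure b = (if b = 0 then return borel 0 else density lborel (\<lambda>x. ennreal
     (indicator {0<..} x * (x powr (b - 1) * exp (- x) / Gamma b))))"

text \<open>Ferguson's definition: independent Gamma variables divided by their sum. The parameters
  \<open>b i\<close> are nonnegative and not all zero; coordinates with \<open>b i = 0\<close> vanish. This generality is
  needed because a partition of the space may contain sets of measure zero.\<close>

definition dirichlet_measure :: "'i set \<Rightarrow> ('i \<Rightarrow> real) \<Rightarrow> ('i \<Rightarrow> real) measure" where
  "dirichlet_measure I b =
     distr (PiM I (\<lambda>i. gamma_measure (b i))) (PiM I (\<lambda>_. borel))
       (\<lambda>z. \<lambda>i\<in>I. z i / (\<Sum>j\<in>I. z j))"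

text \<open>Sequences \<open>Z\<close> are indexed from 1; \<open>Z 0\<close> is irrelevant.\<close>

definition polya_sequence ::
  "'w measure \<Rightarrow> 'x::topological_space measure \<Rightarrow> (nat \<Rightarrow> 'w \<Rightarrow> 'x) \<Rightarrow> bool" where
  "polya_sequence \<Omega> \<alpha> Z \<longleftrightarrow>
     prob_space \<Omega> \<and>
     (\<forall>j\<ge>1. Z j \<in> measurable \<Omega> borel) \<and>
     (\<forall>A\<in>sets borel. measure \<Omega> (Z 1 -` A \<inter> space \<Omega>) = measure \<alpha> A / measure \<alpha> UNIV) \<and>
     (\<forall>j\<ge>1. \<forall>A\<in>sets borel. AE \<omega> in \<Omega>.
        real_cond_exp \<Omega> (generated_by \<Omega> borel {1..j} Z)
          (indicator (Z (Suc j) -` A \<inter> space \<Omega>)) \<omega> =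
        1 / (measure \<alpha> UNIV + real j) * measure \<alpha> A +
        1 / (measure \<alpha> UNIV + real j) * (\<Sum>i=1..j. measure (return borel (Z i \<omega>)) A))"

definition dirichlet_process ::
  "'w measure \<Rightarrow> 'x::topological_space measure \<Rightarrow> ('w \<Rightarrow> 'x measure) \<Rightarrow> bool" where
  "dirichlet_process \<Omega> \<alpha> P \<longleftrightarrow>
     prob_space \<Omega> \<and> P \<in> measurable \<Omega> (prob_algebra borel) \<and>
     (\<forall>k B. (\<forall>i\<in>{1..k}. B i \<in> sets borel) \<and> disjoint_family_on B {1..k} \<and>
            (\<Union>i\<in>{1..k::nat}. B i) = UNIV \<longrightarrow>
        distr \<Omega> (PiM {1..k} (\<lambda>_. borel)) (\<lambda>\<omega>. \<lambda>i\<in>{1..k}. measure (P \<omega>) (B i)) =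
        dirichlet_measure {1..k} (\<lambda>i. measure \<alpha> (B i)))"


text \<open>Random vectors of length \<open>n\<close> are random elements of a product over \<open>{1..n}\<close>. The values
  of the variables at time 0 are irrelevant.\<close>

primrec measure_chain ::
  "nat \<Rightarrow> (nat \<Rightarrow> 'w \<Rightarrow> real) \<Rightarrow> (nat \<Rightarrow> 'w \<Rightarrow> nat \<Rightarrow> real) \<Rightarrow>
   (nat \<Rightarrow> 'w \<Rightarrow> nat \<Rightarrow> 'x::topological_space) \<Rightarrow> 'x measure \<Rightarrow> nat \<Rightarrow> 'w \<Rightarrow> 'x measure" where
  "measure_chain n \<theta> q Y P0 0 \<omega> = P0"
| "measure_chain n \<theta> q Y P0 (Suc m) \<omega> = measure_of UNIV (sets borel) (\<lambda>A.
     ennreal (\<theta> (Suc m) \<omega>) *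
       (\<Sum>i=1..n. ennreal (q (Suc m) \<omega> i) * emeasure (return borel (Y (Suc m) \<omega> i)) A) +
     ennreal (1 - \<theta> (Suc m) \<omega>) * emeasure (measure_chain n \<theta> q Y P0 m \<omega>) A)"

lemma sets_measure_chain:
  "sets P0 = sets borel \<Longrightarrow> sets (measure_chain n \<theta> q Y P0 m \<omega>) = sets borel"
  using sets.sigma_sets_eq[of "borel :: 'a::topological_space measure"] by (cases m) auto

lemma emeasure_measure_chain_Suc:
  fixes P0 :: "'x::topological_space measure"
  assumes P0: "sets P0 = sets borel" and A: "A \<in> sets borel"
  shows "emeasure (measure_chain n \<theta> q Y P0 (Suc m) \<omega>) A =
     ennreal (\<theta> (Suc m) \<omega>) *
       (\<Sum>i=1..n. ennreal (q (Suc m) \<omega> i) * emeasure (return borel (Y (Suc m) \<omega> i)) A) +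
     ennreal (1 - \<theta> (Suc m) \<omega>) * emeasure (measure_chain n \<theta> q Y P0 m \<omega>) A"
    (is "_ = ?f A")
proof (rule emeasure_measure_of)
  show "measure_chain n \<theta> q Y P0 (Suc m) \<omega> = measure_of UNIV (sets borel) ?f"
    by simp
  show "sets borel \<subseteq> Pow (UNIV :: 'x set)" by simp
  show "A \<in> sets (measure_chain n \<theta> q Y P0 (Suc m) \<omega>)"
    unfolding sets_measure_chain[OF P0] by (rule A)
  show "positive (sets (measure_chain n \<theta> q Y P0 (Suc m) \<omega>)) ?f"
    by (simp add: positive_def)
  show "countably_additive (sets (measure_chain n \<theta> q Y P0 (Suc m) \<omega>)) ?f"
  proof (rule countably_additiveI)
    fix B :: "nat \<Rightarrow> 'x set"
    assume B: "range B \<subseteq> sets (measure_chain n \<theta> q Y P0 (Suc m) \<omega>)" and d: "disjoint_family B"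
    have B': "range B \<subseteq> sets (borel :: 'x measure)"
      using B unfolding sets_measure_chain[OF P0] .
    have 1: "(\<Sum>j. emeasure (return borel y) (B j)) = emeasure (return borel y) (\<Union>j. B j)" for y
      by (rule suminf_emeasure) (use B' d in auto)
    have 2: "(\<Sum>j. emeasure (measure_chain n \<theta> q Y P0 m \<omega>) (B j)) =
        emeasure (measure_chain n \<theta> q Y P0 m \<omega>) (\<Union>j. B j)"
      by (rule suminf_emeasure) (unfold sets_measure_chain[OF P0], rule B', rule d)
    have 3: "(\<Sum>j. \<Sum>i=1..n. c i * h i j) = (\<Sum>i=1..n. c i * (\<Sum>j. h i j))"
      for c :: "nat \<Rightarrow> ennreal" and h :: "nat \<Rightarrow> nat \<Rightarrow> ennreal"
      by (simp add: suminf_sum)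
    have 4: "(\<Sum>j. s * u j + t * v j) = s * (\<Sum>j. u j) + t * (\<Sum>j. v j)"
      for s t :: ennreal and u v :: "nat \<Rightarrow> ennreal"
      by (subst suminf_add[symmetric]) auto
    show "(\<Sum>j. ?f (B j)) = ?f (\<Union>j. B j)"
      unfolding 4 3 1 2 ..
  qed
qed

text \<open>The transition kernel of the recursion
  \<open>G\<^sub>m = \<theta>\<^sub>m (\<Sum>i. q\<^sub>m\<^sub>,\<^sub>i g (Y\<^sub>m\<^sub>,\<^sub>i)) + (1 - \<theta>\<^sub>m) G\<^sub>m\<^sub>-\<^sub>1\<close>
  on the real line. As the innovations are identically distributed, those of time 1 serve for
  every step.\<close>

definition functional_kernel ::
  "'w measure \<Rightarrow> nat \<Rightarrow> (nat \<Rightarrow> 'w \<Rightarrow> real) \<Rightarrow> (nat \<Rightarrow> 'w \<Rightarrow> nat \<Rightarrow> real) \<Rightarrow>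
   (nat \<Rightarrow> 'w \<Rightarrow> nat \<Rightarrow> 'x) \<Rightarrow> ('x \<Rightarrow> real) \<Rightarrow> real \<Rightarrow> real measure" where
  "functional_kernel \<Omega> n \<theta> q Y g x = distr \<Omega> borel
     (\<lambda>\<omega>. \<theta> 1 \<omega> * (\<Sum>i=1..n. q 1 \<omega> i * g (Y 1 \<omega> i)) + (1 - \<theta> 1 \<omega>) * x)"

end

theory Submission
  imports Defs
begin

text \<open>The functional chain is an affine recursion: its kernel sends \<open>x\<close> to the law of
  \<open>\<theta> V + (1 - \<theta>) x\<close>. It contracts Lipschitz functions by the factor \<open>E (1 - \<theta>) < 1\<close>, so the iterated
  kernels converge weakly to any invariant law, which is therefore unique. If \<open>V\<close> is not degenerate,
  the invariant law \<open>\<pi>\<close> has no atoms, and as \<open>\<theta>\<close> has a density the kernel maps bounded measurable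
  functions to functions that are continuous off the countably many atoms of \<open>V\<close>. Hence the iterates
  converge setwise to \<open>\<pi>\<close>, and Harris recurrence (with \<open>\<pi>\<close> as maximal irreducibility measure) and
  aperiodicity follow from setwise convergence alone.

  For \<open>g\<close> with finitely many values the mean of a Dirichlet vector is invariant, by the Gamma
  representation of Dirichlet and Beta laws and the Dirichlet posterior mixture along the Polya
  sequence. The Laplace transform \<open>exp (- \<integral> ln (1 + s \<bar>g\<bar>) d\<alpha>)\<close> gives tail bounds for these means that
  are uniform over the approximations of a general \<open>g\<close>, and invariance passes to weak limits.\<close>

section \<open>Harris ergodicity from setwise convergence\<close>

text \<open>Weak convergence is all that the contraction can give: two chains driven by the same
  innovations approach each other by the factors \<open>1 - \<theta>\<close> but do not meet. The
  density of \<theta> closes this gap, and no drift function or small set is constructed.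
  Nondegeneracy of \<open>V\<close> is forced: if \<open>g = c\<close> off an \<alpha>-null set, the
  invariant law is the point mass at \<open>c\<close>, while a chain started elsewhere almost surely
  keeps a nonzero distance from \<open>c\<close>, because \<open>\<theta> < 1\<close>; it never hits
  \<open>c\<close>. The coordinates of a Dirichlet vector are dependent, so the law of a mixture of
  two such vectors is awkward to compute directly; an independent Gamma total makes the coordinates
  independent and turns mixing into addition. A Dirichlet process is available only as a premise of
  the last claim, hence existence of an invariant law is derived from tightness of the finite-valued
  case.\<close>

definition trans_op :: "('a \<Rightarrow> 'a measure) \<Rightarrow> ('a \<Rightarrow> ennreal) \<Rightarrow> 'a \<Rightarrow> ennreal" where
  "trans_op K f x = (\<integral>\<^sup>+y. f y \<partial>K x)"

context
  fixes M :: "'a measure" and K :: "'a \<Rightarrow> 'a measure"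
  assumes K[measurable]: "K \<in> measurable M (prob_algebra M)"
begin

lemma kernel_space: "x \<in> space M \<Longrightarrow> prob_space (K x) \<and> sets (K x) = sets M \<and> space (K x) = space M"
  using measurable_space[OF K, of x] sets_eq_imp_space_eq[of "K x" M] by (simp add: space_prob_algebra)

lemma measurable_trans_op[measurable]:
  assumes [measurable]: "f \<in> borel_measurable M"
  shows "trans_op K f \<in> borel_measurable M"
  unfolding trans_op_def[abs_def]
  by (rule nn_integral_measurable_subprob_algebra2[where N = M])
    (use measurable_prob_algebraD[OF K] in measurable)

lemma measurable_trans_op_power[measurable]:
  assumes "f \<in> borel_measurable M"
  shows "(trans_op K ^^ k) f \<in> borel_measurable M"
  by (induction k) (use assms in auto)

lemma trans_op_mono:
  assumes "x \<in> space M" and "\<And>y. y \<in> space M \<Longrightarrow> f y \<le> h y"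
  shows "trans_op K f x \<le> trans_op K h x"
  unfolding trans_op_def using kernel_space[OF assms(1)] assms(2)
  by (intro nn_integral_mono) auto

lemma trans_op_const: "x \<in> space M \<Longrightarrow> trans_op K (\<lambda>_. c) x = c"
  unfolding trans_op_def using kernel_space[of x] prob_space.emeasure_space_1[of "K x"] by auto

lemma trans_op_power_mono:
  assumes "x \<in> space M" and "\<And>y. y \<in> space M \<Longrightarrow> f y \<le> h y"
  shows "(trans_op K ^^ k) f x \<le> (trans_op K ^^ k) h x"
  using assms(1)
proof (induction k arbitrary: x)
  case (Suc k)
  then show ?case by (auto intro!: trans_op_mono)
qed (use assms(2) in auto)

lemma trans_op_power_cong:
  assumes "x \<in> space M" and "\<And>y. y \<in> space M \<Longrightarrow> f y = h y"
  shows "(trans_op K ^^ k) f x = (trans_op K ^^ k) h x"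
  by (intro antisym trans_op_power_mono) (use assms in auto)

lemma nn_integral_trans_op_invariant:
  assumes \<pi>: "invariant_probability M K \<pi>" and [measurable]: "f \<in> borel_measurable M"
  shows "(\<integral>\<^sup>+x. trans_op K f x \<partial>\<pi>) = (\<integral>\<^sup>+x. f x \<partial>\<pi>)"
proof -
  have s[measurable_cong]: "sets \<pi> = sets M" and b: "\<pi> \<bind> K = \<pi>"
    using \<pi> by (auto simp: invariant_probability_def)
  have "(\<integral>\<^sup>+x. f x \<partial>\<pi>) = (\<integral>\<^sup>+x. f x \<partial>(\<pi> \<bind> K))" unfolding b ..
  also have "\<dots> = (\<integral>\<^sup>+x. trans_op K f x \<partial>\<pi>)"
    unfolding trans_op_def
    by (rule nn_integral_bind[where B = M])
       (use measurable_prob_algebraD[OF K] in measurable)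
  finally show ?thesis ..
qed

lemma nn_integral_trans_op_power_invariant:
  assumes \<pi>: "invariant_probability M K \<pi>" and f: "f \<in> borel_measurable M"
  shows "(\<integral>\<^sup>+x. (trans_op K ^^ k) f x \<partial>\<pi>) = (\<integral>\<^sup>+x. f x \<partial>\<pi>)"
proof (induction k)
  case (Suc k)
  then show ?case
    using nn_integral_trans_op_invariant[OF \<pi> measurable_trans_op_power[OF f]] by simp
qed simp

section \<open>The law of the trajectories of a kernel\<close>

context
  fixes x :: 'a
  assumes x: "x \<in> space M"
begin

interpretation IT: Ionescu_Tulcea "path_step M K x" "\<lambda>_. M"
  by (rule Ionescu_Tulcea_path_step[OF K x])

lemma path_law_eq: "path_law M K x = IT.PF.lim"
  unfolding path_law_def ..

lemma sets_path_law[measurable_cong]: "sets (path_law M K x) = sets (PiM UNIV (\<lambda>_. M))"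
  by (simp add: path_law_eq)

text \<open>The projective limit is specified through its values on cylinders. With index set
  \<open>{0..<n}\<close> the embedding \<open>prod_emb\<close> is the identity on measurable sets,
  so the marginal is the finite Ionescu-Tulcea measure itself and path integrals reduce to iterated
  kernels.\<close>

lemma distr_path_law:
  "distr (path_law M K x) (PiM {0..<n} (\<lambda>_. M)) (\<lambda>\<omega>. restrict \<omega> {0..<n}) = IT.C 0 n (\<lambda>_. undefined)"
proof (rule measure_eqI)
  fix X assume "X \<in> sets (distr (path_law M K x) (PiM {0..<n} (\<lambda>_. M)) (\<lambda>\<omega>. restrict \<omega> {0..<n}))"
  then have X: "X \<in> sets (PiM {0..<n} (\<lambda>_. M))" by simp
  have e: "prod_emb {0..<n} (\<lambda>_. M) {0..<n} X = X"
    using sets.sets_into_space[OF X] by (intro prod_emb_id) (auto simp: space_PiM)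
  have "emeasure (distr (path_law M K x) (PiM {0..<n} (\<lambda>_. M)) (\<lambda>\<omega>. restrict \<omega> {0..<n})) X =
      emeasure IT.PF.lim (prod_emb UNIV (\<lambda>_. M) {0..<n} X)"
    unfolding path_law_eq using X by (intro emeasure_distr_restrict) auto
  also have "\<dots> = emeasure (IT.C 0 n (\<lambda>_. undefined)) X"
    using IT.lim[of "{0..<n}" X] IT.emeasure_CI[of "{0..<n}" n X] X e by simp
  finally show "emeasure (distr (path_law M K x) (PiM {0..<n} (\<lambda>_. M)) (\<lambda>\<omega>. restrict \<omega> {0..<n})) X =
    emeasure (IT.C 0 n (\<lambda>_. undefined)) X" .
qed (simp add: IT.sets_C)

lemma nn_integral_path_law_restrict:
  assumes f[measurable]: "f \<in> borel_measurable (PiM {0..<n} (\<lambda>_. M))"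
  shows "(\<integral>\<^sup>+\<omega>. f (restrict \<omega> {0..<n}) \<partial>path_law M K x) = (\<integral>\<^sup>+\<omega>. f \<omega> \<partial>IT.C 0 n (\<lambda>_. undefined))"
  unfolding distr_path_law[symmetric]
  by (subst nn_integral_distr) (auto intro!: measurable_restrict_subset simp: measurable_cong_sets[OF sets_path_law refl])

lemma prob_space_path_law: "prob_space (path_law M K x)"
proof
  have "emeasure (path_law M K x) (space (path_law M K x)) = (\<integral>\<^sup>+\<omega>. 1 \<partial>path_law M K x)"
    by simp
  also have "\<dots> = (\<integral>\<^sup>+\<omega>. 1 \<partial>IT.C 0 0 (\<lambda>_. undefined))"
    using nn_integral_path_law_restrict[of "\<lambda>_. 1" 0] by simp
  also have "\<dots> = 1" using prob_space.emeasure_space_1[OF prob_space_return[of "\<lambda>_. undefined" "PiM {} (\<lambda>_. M)"]] by (simp add: space_PiM)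
  finally show "emeasure (path_law M K x) (space (path_law M K x)) = 1" .
qed

lemma nn_integral_path_law_0:
  assumes [measurable]: "f \<in> borel_measurable M"
  shows "(\<integral>\<^sup>+\<omega>. f (\<omega> 0) \<partial>path_law M K x) = f x"
proof -
  have "(\<integral>\<^sup>+\<omega>. f (\<omega> 0) \<partial>path_law M K x) = (\<integral>\<^sup>+\<omega>. f (\<omega> 0) \<partial>IT.C 0 (Suc 0) (\<lambda>_. undefined))"
    using nn_integral_path_law_restrict[of "\<lambda>\<omega>. f (\<omega> 0)" "Suc 0"] by simp
  also have "\<dots> = (\<integral>\<^sup>+\<omega>. f (\<omega> 0) \<partial>IT.eP 0 (\<lambda>_. undefined))"
    using IT.measurable_eP[of 0]
    by (simp, subst bind_return[where N = "PiM {0..<Suc 0} (\<lambda>_. M)"]) (auto simp: space_PiM)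
  also have "\<dots> = f x"
    by (subst IT.nn_integral_eP) (use x in \<open>auto simp: space_PiM path_step_def nn_integral_return\<close>)
  finally show ?thesis .
qed

text \<open>This is the Markov property in integrated form. The kernel \<open>eP (Suc n)\<close>
  draws coordinate \<open>Suc n\<close> from \<open>K (\<omega> n)\<close> and keeps the earlier
  coordinates, so \<open>F\<close> leaves the inner integral as a constant factor.\<close>

lemma nn_integral_path_law_Suc:
  assumes F[measurable]: "F \<in> borel_measurable (PiM {0..<Suc n} (\<lambda>_. M))"
    and f[measurable]: "f \<in> borel_measurable M"
  shows "(\<integral>\<^sup>+\<omega>. F (restrict \<omega> {0..<Suc n}) * f (\<omega> (Suc n)) \<partial>path_law M K x) =
    (\<integral>\<^sup>+\<omega>. F (restrict \<omega> {0..<Suc n}) * trans_op K f (\<omega> n) \<partial>path_law M K x)"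
proof -
  let ?C = "IT.C 0 (Suc n) (\<lambda>_. undefined)"
  let ?N = "PiM {0..<Suc n} (\<lambda>_. M)" and ?N' = "PiM {0..<Suc (Suc n)} (\<lambda>_. M)"
  have sC: "space ?C = space ?N" using IT.space_C[of "\<lambda>_. undefined" 0 "Suc n"] by (simp add: space_PiM del: IT.C.simps)
  have seC: "sets ?C = sets ?N" using IT.sets_C[of "\<lambda>_. undefined" 0 "Suc n"] by (simp add: space_PiM del: IT.C.simps)
  have R[measurable]: "(\<lambda>\<omega>. restrict \<omega> {0..<Suc n}) \<in> measurable ?N' ?N"
    by (intro measurable_restrict_subset) auto
  have G: "(\<lambda>\<omega>. F (restrict \<omega> {0..<Suc n}) * f (\<omega> (Suc n))) \<in> borel_measurable ?N'"
    by measurable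
  have "(\<integral>\<^sup>+\<omega>. F (restrict \<omega> {0..<Suc n}) * f (\<omega> (Suc n)) \<partial>path_law M K x) =
      (\<integral>\<^sup>+\<omega>. F (restrict \<omega> {0..<Suc n}) * f (\<omega> (Suc n)) \<partial>IT.C 0 (Suc (Suc n)) (\<lambda>_. undefined))"
    using nn_integral_path_law_restrict[OF G] by (simp add: Int_absorb1 atLeast0_lessThan_Suc del: IT.C.simps)
  also have "\<dots> = (\<integral>\<^sup>+\<omega>. (\<integral>\<^sup>+\<omega>'. F (restrict \<omega>' {0..<Suc n}) * f (\<omega>' (Suc n)) \<partial>IT.eP (Suc n) \<omega>) \<partial>?C)"
    unfolding IT.C.simps(2)[of 0 "Suc n"] using IT.measurable_eP[of "Suc n"]
    by (subst nn_integral_bind[where B = "?N'"])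
       (simp_all add: measurable_cong_sets[OF seC refl] del: IT.C.simps)
  also have "\<dots> = (\<integral>\<^sup>+\<omega>. F \<omega> * trans_op K f (\<omega> n) \<partial>?C)"
  proof (rule nn_integral_cong)
    fix \<omega> assume "\<omega> \<in> space ?C"
    then have \<omega>: "\<omega> \<in> space ?N" unfolding sC .
    then have n: "\<omega> n \<in> space M" by (auto simp: space_PiM PiE_iff)
    have [measurable_cong]: "sets (K (\<omega> n)) = sets M" using kernel_space[OF n] by auto
    have "(\<integral>\<^sup>+\<omega>'. F (restrict \<omega>' {0..<Suc n}) * f (\<omega>' (Suc n)) \<partial>IT.eP (Suc n) \<omega>) =
      (\<integral>\<^sup>+y. F (restrict (fun_upd \<omega> (Suc n) y) {0..<Suc n}) * f y \<partial>K (\<omega> n))"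
      by (subst IT.nn_integral_eP[OF _ G]) (use \<omega> in \<open>auto simp: path_step_def\<close>)
    also have "\<dots> = (\<integral>\<^sup>+y. F \<omega> * f y \<partial>K (\<omega> n))"
    proof (rule nn_integral_cong)
      fix y
      have "restrict (fun_upd \<omega> (Suc n) y) {0..<Suc n} = \<omega>"
        using \<omega> by (auto simp: space_PiM PiE_iff fun_eq_iff restrict_def extensional_def)
      then show "F (restrict (fun_upd \<omega> (Suc n) y) {0..<Suc n}) * f y = F \<omega> * f y" by simp
    qed
    also have "\<dots> = F \<omega> * trans_op K f (\<omega> n)"
      unfolding trans_op_def by (rule nn_integral_cmult) measurable
    finally show "(\<integral>\<^sup>+\<omega>'. F (restrict \<omega>' {0..<Suc n}) * f (\<omega>' (Suc n)) \<partial>IT.eP (Suc n) \<omega>) =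
      F \<omega> * trans_op K f (\<omega> n)" .
  qed
  also have "\<dots> = (\<integral>\<^sup>+\<omega>. F (restrict \<omega> {0..<Suc n}) * trans_op K f (\<omega> n) \<partial>path_law M K x)"
    using nn_integral_path_law_restrict[of "\<lambda>\<omega>. F \<omega> * trans_op K f (\<omega> n)" "Suc n"]
    by (simp del: IT.C.simps)
  finally show ?thesis .
qed

lemma nn_integral_path_law_power:
  assumes "f \<in> borel_measurable M"
  shows "(\<integral>\<^sup>+\<omega>. f (\<omega> k) \<partial>path_law M K x) = (trans_op K ^^ k) f x"
  using assms
proof (induction k arbitrary: f)
  case 0
  then show ?case by (simp add: nn_integral_path_law_0)
next
  case (Suc k)
  then show ?case
    using nn_integral_path_law_Suc[of "\<lambda>_. 1" k f] Suc.IH[OF measurable_trans_op[OF Suc.prems]]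
    by (simp add: funpow_swap1)
qed

text \<open>The Markov property peels off the last coordinate: its indicator is absorbed into
  \<open>f\<close>, which is why \<open>f\<close> is arbitrary in the induction. The window starts
  after time \<open>k\<close> so that visits later than any given time can be controlled.\<close>

lemma nn_integral_path_law_avoid:
  assumes A[measurable]: "A \<in> sets M" and "f \<in> borel_measurable M"
  shows "(\<integral>\<^sup>+\<omega>. (\<Prod>i\<in>{k<..k+N}. indicator (- A) (\<omega> i)) * f (\<omega> (k + N)) \<partial>path_law M K x) =
    (trans_op K ^^ k) (((\<lambda>f. trans_op K (\<lambda>y. indicator (- A) y * f y)) ^^ N) f) x"
  using assms(2)
proof (induction N arbitrary: f)
  case 0
  then show ?case by (simp add: nn_integral_path_law_power)
next
  case (Suc N)
  note [measurable] = Suc.prems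
  let ?S = "\<lambda>f. trans_op K (\<lambda>y. indicator (- A) y * f y)"
  have mA[measurable]: "(indicator (- A) :: 'a \<Rightarrow> ennreal) \<in> borel_measurable M"
    by (subst borel_measurable_indicator_iff) (simp add: Diff_eq[symmetric] Int_commute inf_compl_bot)
  have F: "(\<lambda>\<omega>. \<Prod>i\<in>{k<..k+N}. indicator (- A) (\<omega> i) :: ennreal) \<in> borel_measurable (PiM {0..<Suc (k + N)} (\<lambda>_. M))"
    by (intro borel_measurable_prod_ennreal measurable_compose[OF _ mA] measurable_component_singleton) auto
  have e: "(\<Prod>i\<in>{k<..k+N}. indicator (- A) (restrict \<omega> {0..<Suc (k + N)} i)) =
      (\<Prod>i\<in>{k<..k+N}. indicator (- A) (\<omega> i) :: ennreal)" for \<omega>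
    by (intro prod.cong) auto
  have "{k<..k + Suc N} = insert (Suc (k + N)) {k<..k+N}" by auto
  then have "(\<integral>\<^sup>+\<omega>. (\<Prod>i\<in>{k<..k+Suc N}. indicator (- A) (\<omega> i)) * f (\<omega> (k + Suc N)) \<partial>path_law M K x) =
    (\<integral>\<^sup>+\<omega>. (\<Prod>i\<in>{k<..k+N}. indicator (- A) (\<omega> i)) *
      (indicator (- A) (\<omega> (Suc (k + N))) * f (\<omega> (Suc (k + N)))) \<partial>path_law M K x)"
    by (simp add: ac_simps)
  also have "\<dots> = (\<integral>\<^sup>+\<omega>. (\<Prod>i\<in>{k<..k+N}. indicator (- A) (\<omega> i)) * ?S f (\<omega> (k + N)) \<partial>path_law M K x)"
    using nn_integral_path_law_Suc[OF F, of "\<lambda>y. indicator (- A) y * f y"] unfolding e by simp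
  also have "\<dots> = (trans_op K ^^ k) ((?S ^^ N) (?S f)) x"
    by (rule Suc.IH) measurable
  also have "(?S ^^ N) (?S f) = (?S ^^ Suc N) f" by (simp only: funpow_Suc_right comp_apply)
  finally show ?case .
qed

end

text \<open>Monotone convergence for decreasing sequences needs a finite integral to start from; the
  bound 1 and the total mass of \<open>K x\<close> supply it.\<close>

lemma trans_op_INF:
  assumes x: "x \<in> space M"
    and [measurable]: "\<And>N. f N \<in> borel_measurable M"
    and dec: "\<And>N y. y \<in> space M \<Longrightarrow> f (Suc N) y \<le> f N y"
    and le: "\<And>N y. y \<in> space M \<Longrightarrow> f N y \<le> 1"
  shows "trans_op K (\<lambda>y. INF N. f N y) x = (INF N. trans_op K (f N) x)"
proof -
  note Kx = kernel_space[OF x]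
  have [measurable_cong]: "sets (K x) = sets M" using Kx by auto
  have "(\<integral>\<^sup>+y. f 0 y \<partial>K x) \<le> 1"
    using trans_op_mono[OF x le[of _ 0]] trans_op_const[OF x, of 1] by (simp add: trans_op_def)
  then have fin: "(\<integral>\<^sup>+y. f 0 y \<partial>K x) < \<infinity>" by (auto intro: order_le_less_trans)
  show ?thesis unfolding trans_op_def
    by (rule nn_integral_monotone_convergence_INF_AE') (use dec Kx fin in auto)
qed

lemma trans_op_power_le_1:
  assumes "x \<in> space M" and "\<And>y. y \<in> space M \<Longrightarrow> f y \<le> 1"
  shows "(trans_op K ^^ k) f x \<le> 1"
proof -
  have "(trans_op K ^^ k) (\<lambda>_. 1) x = 1" using assms(1)
  proof (induction k arbitrary: x)
    case (Suc k)
    have "trans_op K ((trans_op K ^^ k) (\<lambda>_. 1)) x = trans_op K (\<lambda>_. 1) x"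
      by (intro antisym trans_op_mono Suc.prems) (simp_all add: Suc.IH)
    then show ?case using trans_op_const[OF Suc.prems, of 1] by simp
  qed simp
  then show ?thesis using trans_op_power_mono[of x f "\<lambda>_. 1" k] assms by simp
qed

lemma trans_op_power_INF:
  assumes x: "x \<in> space M"
    and m: "\<And>N. f N \<in> borel_measurable M"
    and dec: "\<And>N y. y \<in> space M \<Longrightarrow> f (Suc N) y \<le> f N y"
    and le: "\<And>N y. y \<in> space M \<Longrightarrow> f N y \<le> 1"
  shows "(trans_op K ^^ k) (\<lambda>y. INF N. f N y) x = (INF N. (trans_op K ^^ k) (f N) x)"
  using x
proof (induction k arbitrary: x)
  case (Suc k)
  have "(trans_op K ^^ Suc k) (\<lambda>y. INF N. f N y) x = trans_op K (\<lambda>y. INF N. (trans_op K ^^ k) (f N) y) x"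
    by (simp, intro antisym trans_op_mono Suc.prems) (simp_all add: Suc.IH)
  also have "\<dots> = (INF N. trans_op K ((trans_op K ^^ k) (f N)) x)"
    using m dec le by (intro trans_op_INF Suc.prems measurable_trans_op_power trans_op_power_mono trans_op_power_le_1)
  finally show ?case by simp
qed simp

text \<open>The probability that the chain started at the argument stays outside \<open>A\<close> at
  times 1 to \<open>N\<close>. The starting point itself is not tested, since every indicator sits
  inside a \<open>trans_op\<close>.\<close>

definition avoid_op :: "'a set \<Rightarrow> nat \<Rightarrow> 'a \<Rightarrow> ennreal" where
  "avoid_op A N = ((\<lambda>f. trans_op K (\<lambda>y. indicator (- A) y * f y)) ^^ N) (\<lambda>_. 1)"

context
  fixes A :: "'a set"
  assumes A[measurable]: "A \<in> sets M"
begin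

lemma avoid_op_0: "avoid_op A 0 = (\<lambda>_. 1)"
  and avoid_op_Suc: "avoid_op A (Suc N) = trans_op K (\<lambda>y. indicator (- A) y * avoid_op A N y)"
  by (simp_all add: avoid_op_def)

lemma measurable_indicator_Compl: "(indicator (- A) :: 'a \<Rightarrow> ennreal) \<in> borel_measurable M"
  by (subst borel_measurable_indicator_iff) (simp add: Diff_eq[symmetric] Int_commute inf_compl_bot)

lemma measurable_avoid_op[measurable]: "avoid_op A N \<in> borel_measurable M"
  by (induction N) (simp_all add: avoid_op_0 avoid_op_Suc)

lemma avoid_op_le_1: "y \<in> space M \<Longrightarrow> avoid_op A N y \<le> 1"
proof (induction N arbitrary: y)
  case (Suc N)
  have "avoid_op A (Suc N) y \<le> trans_op K (\<lambda>_. 1) y"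
    unfolding avoid_op_Suc
    by (intro trans_op_mono Suc.prems) (auto simp: Suc.IH split: split_indicator)
  then show ?case using trans_op_const[OF Suc.prems, of 1] by simp
qed (simp add: avoid_op_0)

lemma avoid_op_Suc_le: "y \<in> space M \<Longrightarrow> avoid_op A (Suc N) y \<le> avoid_op A N y"
proof (induction N arbitrary: y)
  case 0
  then show ?case using avoid_op_le_1[OF 0, of 1] by (simp add: avoid_op_0)
next
  case (Suc N)
  show ?case
    unfolding avoid_op_Suc[of "Suc N"] avoid_op_Suc[of N]
    by (intro trans_op_mono Suc.prems mult_left_mono) (use Suc.IH in \<open>auto simp: avoid_op_Suc\<close>)
qed

end

section \<open>Consequences of setwise convergence\<close>

context
  fixes \<pi> :: "'a measure"
  assumes inv: "invariant_probability M K \<pi>"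
    and conv: "\<And>f x. f \<in> borel_measurable M \<Longrightarrow> (\<And>y. y \<in> space M \<Longrightarrow> f y \<le> 1) \<Longrightarrow> x \<in> space M \<Longrightarrow>
      (\<lambda>k. (trans_op K ^^ k) f x) \<longlonglongrightarrow> (\<integral>\<^sup>+y. f y \<partial>\<pi>)"
begin

interpretation \<pi>: prob_space \<pi> using inv by (simp add: invariant_probability_def)

lemma sets_inv: "sets \<pi> = sets M" using inv by (simp add: invariant_probability_def)

lemma space_inv: "space \<pi> = space M" using sets_inv by (rule sets_eq_imp_space_eq)

text \<open>The probability \<open>v\<close> of never visiting \<open>A\<close> satisfies \<open>v \<le> T v\<close>, hence \<open>v \<le> \<integral>v d\<pi>\<close> pointwise;
  on the other hand \<open>\<integral>v d\<pi> \<le> (1 - \<pi> A) sup v\<close> by invariance.\<close>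

lemma avoid_probability_eq_0:
  assumes A[measurable]: "A \<in> sets M" and pos: "emeasure \<pi> A > 0" and x: "x \<in> space M"
  shows "(INF N. avoid_op A N x) = 0"
proof -
  let ?S = "\<lambda>f. trans_op K (\<lambda>y. indicator (- A) y * f y)"
  note [measurable] = measurable_indicator_Compl[OF A] measurable_avoid_op[OF A]
  note [measurable_cong] = sets_inv
  note u_Suc = avoid_op_Suc[OF A] and le1 = avoid_op_le_1[OF A] and dec = avoid_op_Suc_le[OF A]
  let ?u = "avoid_op A"
  define v where "v y = (INF N. ?u N y)" for y
  have mv[measurable]: "v \<in> borel_measurable M"
    unfolding v_def by measurable
  have vS: "v y = ?S v y" if y: "y \<in> space M" for y
  proof -
    have "v y = (INF N. ?u (Suc N) y)"
      unfolding v_def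
      by (intro antisym INF_greatest INF_lower) (auto intro!: INF_lower2 dec[OF y])
    also have "\<dots> = trans_op K (\<lambda>z. INF N. indicator (- A) z * ?u N z) y"
      unfolding u_Suc
      by (intro trans_op_INF[symmetric] y) (auto simp: le1 dec split: split_indicator)
    also have "(\<lambda>z. INF N. indicator (- A) z * ?u N z) = (\<lambda>z. indicator (- A) z * v z)"
      by (auto simp: v_def fun_eq_iff split: split_indicator)
    finally show ?thesis .
  qed
  have v1: "v y \<le> 1" if "y \<in> space M" for y
    unfolding v_def using le1[OF that] by (auto intro: INF_lower2)
  have vT: "v y \<le> (trans_op K ^^ k) v y" if "y \<in> space M" for k y
    using that
  proof (induction k arbitrary: y)
    case (Suc k)
    have "v y \<le> trans_op K v y"
      unfolding vS[OF Suc.prems]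
      by (intro trans_op_mono Suc.prems) (auto split: split_indicator)
    also have "\<dots> \<le> trans_op K ((trans_op K ^^ k) v) y"
      by (intro trans_op_mono Suc)
    finally show ?case by simp
  qed simp
  define s where "s = (\<integral>\<^sup>+y. v y \<partial>\<pi>)"
  have vs: "v y \<le> s" if "y \<in> space M" for y
    unfolding s_def by (rule LIMSEQ_le_const[OF conv[OF mv v1 that]]) (auto intro: vT that)
  have "s \<le> (\<integral>\<^sup>+y. 1 \<partial>\<pi>)" unfolding s_def by (intro nn_integral_mono) (use v1 space_inv in auto)
  then have s1: "s \<le> 1" by (simp add: \<pi>.emeasure_space_1)
  have "s = (\<integral>\<^sup>+y. ?S v y \<partial>\<pi>)"
    unfolding s_def by (intro nn_integral_cong) (use vS space_inv in auto)
  also have "\<dots> = (\<integral>\<^sup>+y. indicator (- A) y * v y \<partial>\<pi>)"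
    by (rule nn_integral_trans_op_invariant[OF inv]) measurable
  also have "\<dots> \<le> (\<integral>\<^sup>+y. s * indicator (space \<pi> - A) y \<partial>\<pi>)"
    by (intro nn_integral_mono) (use vs space_inv in \<open>auto split: split_indicator\<close>)
  also have "\<dots> = s * emeasure \<pi> (space \<pi> - A)"
    by (subst nn_integral_cmult_indicator) auto
  also have "\<dots> = s * ennreal (1 - measure \<pi> A)"
    using \<pi>.prob_compl[of A] by (simp add: \<pi>.emeasure_eq_measure)
  finally have ss: "s \<le> s * ennreal (1 - measure \<pi> A)" .
  have p: "measure \<pi> A > 0" using pos by (simp add: \<pi>.emeasure_eq_measure)
  \<comment> \<open>Cancelling \<open>s\<close> in the last inequality is legitimate only for finite
    \<open>s\<close>; finiteness comes from \<open>s \<le> 1\<close>.\<close>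
  obtain r where r: "s = ennreal r" "r \<ge> 0" using s1 by (cases s) (auto simp: top_unique)
  have "r \<le> r * (1 - measure \<pi> A)"
    using ss r by (simp add: ennreal_mult[symmetric] ennreal_le_iff)
  then have "r * measure \<pi> A \<le> 0" by (simp add: algebra_simps)
  then have "r = 0" using p r by (simp add: mult_le_0_iff)
  then have "v x = 0" using vs[OF x] r by simp
  then show ?thesis by (simp add: v_def)
qed

text \<open>After \<open>k\<close> steps the chain is at a random point from which avoiding
  \<open>A\<close> forever has probability 0; \<open>trans_op_power_INF\<close> lets the infimum
  over the horizon pass through those \<open>k\<close> steps. The almost sure events for all
  \<open>k\<close> are then intersected.\<close>

lemma AE_path_law_infinitely_often:
  assumes A[measurable]: "A \<in> sets M" and pos: "emeasure \<pi> A > 0" and x: "x \<in> space M"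
  shows "AE \<omega> in path_law M K x. \<exists>\<^sub>\<infinity>m. \<omega> m \<in> A"
proof -
  let ?Q = "path_law M K x"
  note [measurable_cong] = sets_path_law[OF x]
  have "AE \<omega> in ?Q. \<exists>m>k. \<omega> m \<in> A" for k
  proof -
    let ?E = "{\<omega> \<in> space ?Q. \<not> (\<exists>m>k. \<omega> m \<in> A)}"
    have E: "?E \<in> sets ?Q"
      by measurable
    have "emeasure ?Q ?E \<le> (INF N. (trans_op K ^^ k) (avoid_op A N) x)"
    proof (rule INF_greatest)
      fix N
      have "emeasure ?Q ?E = (\<integral>\<^sup>+\<omega>. indicator ?E \<omega> \<partial>?Q)" using E by simp
      also have "\<dots> \<le> (\<integral>\<^sup>+\<omega>. (\<Prod>i\<in>{k<..k+N}. indicator (- A) (\<omega> i)) \<partial>?Q)"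
        by (intro nn_integral_mono) (auto split: split_indicator intro!: prod.neutral[symmetric])
      finally show "emeasure ?Q ?E \<le> (trans_op K ^^ k) (avoid_op A N) x"
        using nn_integral_path_law_avoid[OF x A, of "\<lambda>_. 1" k N] by (simp add: avoid_op_def)
    qed
    also have "\<dots> = (trans_op K ^^ k) (\<lambda>y. INF N. avoid_op A N y) x"
      by (intro trans_op_power_INF[symmetric] x measurable_avoid_op avoid_op_Suc_le avoid_op_le_1 A)
    also have "\<dots> = (trans_op K ^^ k) (\<lambda>y. 0) x"
      by (rule trans_op_power_cong[OF x avoid_probability_eq_0[OF A pos]])
    also have "\<dots> = 0"
      using x
    proof (induction k arbitrary: x)
      case (Suc k)
      have "trans_op K ((trans_op K ^^ k) (\<lambda>_. 0)) x = trans_op K (\<lambda>_. 0) x"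
        by (intro antisym trans_op_mono Suc.prems) (simp_all add: Suc.IH)
      then show ?case using trans_op_const[OF Suc.prems, of 0] by simp
    qed simp
    finally have "emeasure ?Q ?E = 0" by simp
    then show ?thesis using AE_iff_measurable[OF E, of "\<lambda>\<omega>. \<exists>m>k. \<omega> m \<in> A"] by auto
  qed
  then have "AE \<omega> in ?Q. \<forall>k. \<exists>m>k. \<omega> m \<in> A" by (simp add: AE_all_countable)
  then show ?thesis by (simp add: INFM_nat)
qed

text \<open>For maximality, let \<open>A\<close> be \<pi>-null. By invariance every
  \<open>(trans_op K ^^ k) (indicator A)\<close> has \<pi>-integral 0, so from some starting point
  the path almost surely never visits \<open>A\<close>. Irreducibility with respect to \<phi> then
  forces \<open>A\<close> to be \<phi>-null.\<close>

lemma maximal_irreducibility_measure_invariant: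
  "maximal_irreducibility_measure M K \<pi>"
  unfolding maximal_irreducibility_measure_def
proof safe
  show "irreducibility_measure M K \<pi>"
    unfolding irreducibility_measure_def
  proof (intro conjI ballI impI)
    show "sigma_finite_measure \<pi>" ..
    show "sets \<pi> = sets M" by (rule sets_inv)
    show "0 < emeasure \<pi> (space M)" using \<pi>.emeasure_space_1 space_inv by simp
    fix A x assume A[measurable]: "A \<in> sets M" and pos: "0 < emeasure \<pi> A" and x: "x \<in> space M"
    interpret Q: prob_space "path_law M K x" by (rule prob_space_path_law[OF x])
    note [measurable_cong] = sets_path_law[OF x]
    have "AE \<omega> in path_law M K x. \<exists>m\<ge>1. \<omega> m \<in> A"
      using AE_path_law_infinitely_often[OF A pos x]
      by eventually_elim (auto simp: INFM_nat_le)
    then have "Q.prob {\<omega> \<in> space (path_law M K x). \<exists>m\<ge>1. \<omega> m \<in> A} = 1"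
      by (subst Q.prob_Collect_eq_1) measurable
    then show "0 < Q.prob {\<omega> \<in> space (path_law M K x). \<exists>m\<ge>1. \<omega> m \<in> A}" by simp
  qed
  note [measurable_cong] = sets_inv
  fix \<phi> assume \<phi>: "irreducibility_measure M K \<phi>"
  show "absolutely_continuous \<pi> \<phi>"
    unfolding absolutely_continuous_def
  proof
    fix A assume A: "A \<in> null_sets \<pi>"
    then have A'[measurable]: "A \<in> sets M" using sets_inv by auto
    have "AE x in \<pi>. (trans_op K ^^ k) (indicator A) x = 0" for k
    proof -
      have "(\<integral>\<^sup>+x. (trans_op K ^^ k) (indicator A) x \<partial>\<pi>) = 0"
        using nn_integral_trans_op_power_invariant[OF inv, of "indicator A" k] A by auto
      then show ?thesis
        by (subst (asm) nn_integral_0_iff_AE) (auto simp: measurable_cong_sets[OF sets_inv refl])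
    qed
    then have "AE x in \<pi>. \<forall>k. (trans_op K ^^ k) (indicator A) x = 0" by (simp add: AE_all_countable)
    \<comment> \<open>The inner existential statement does not depend on the variable bound by
      \<open>AE\<close>; as \<pi> is a probability measure, it holds outright, and one point serves
      all \<open>k\<close>.\<close>
    then have "AE x in \<pi>. \<exists>x\<in>space M. \<forall>k. (trans_op K ^^ k) (indicator A) x = 0"
      using AE_space by eventually_elim (auto simp: space_inv)
    then obtain x where x: "x \<in> space M" and z: "\<And>k. (trans_op K ^^ k) (indicator A) x = 0"
      by (auto simp: \<pi>.AE_const)
    note [measurable_cong] = sets_path_law[OF x]
    interpret Q: prob_space "path_law M K x" by (rule prob_space_path_law[OF x])
    have "AE \<omega> in path_law M K x. \<omega> k \<notin> A" for k
    proof -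
      have "(\<integral>\<^sup>+\<omega>. indicator A (\<omega> k) \<partial>path_law M K x) = 0"
        using nn_integral_path_law_power[OF x, of "indicator A" k] z by simp
      then show ?thesis
        by (subst (asm) nn_integral_0_iff_AE) (auto elim!: eventually_mono split: split_indicator_asm)
    qed
    then have "AE \<omega> in path_law M K x. \<forall>k. \<omega> k \<notin> A" by (simp add: AE_all_countable)
    then have "AE \<omega> in path_law M K x. \<not> (\<exists>m\<ge>1. \<omega> m \<in> A)" by eventually_elim auto
    then have "Q.prob {\<omega> \<in> space (path_law M K x). \<exists>m\<ge>1. \<omega> m \<in> A} = 0"
      by (subst Q.prob_Collect_eq_0) measurable
    then have "\<not> emeasure \<phi> A > 0"
      using \<phi> x A' unfolding irreducibility_measure_def by fastforce
    then show "A \<in> null_sets \<phi>"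
      using \<phi> A' by (auto simp: irreducibility_measure_def null_sets_def)
  qed
qed

text \<open>Along a cycle the position is deterministic modulo \<open>d\<close>, so
  \<open>(trans_op K ^^ k) (indicator (D 0))\<close> at a point of the cycle is a 0-1 sequence of
  period \<open>d\<close>. With \<open>d \<ge> 2\<close> it takes both values infinitely often and
  cannot converge.\<close>

lemma no_cycle:
  assumes d: "d \<ge> 2" and D: "cycle M K \<pi> d D"
  shows False
proof -
  have D_sets: "D i \<in> sets M" if "i < d" for i using D that by (auto simp: cycle_def)
  have disj: "disjoint_family_on D {..<d}" using D by (auto simp: cycle_def)
  have step: "measure (K x) (D (Suc i mod d)) = 1" if "i < d" "x \<in> D i" for i x
    using D that by (auto simp: cycle_def)
  have "\<exists>i<d. D i \<noteq> {}"
  proof (rule ccontr)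
    assume "\<not> (\<exists>i<d. D i \<noteq> {})"
    then have "emeasure \<pi> (space M) = 0" using D by (auto simp: cycle_def)
    then show False using \<pi>.emeasure_space_1 space_inv by simp
  qed
  then obtain i x where i: "i < d" and x: "x \<in> D i" by auto
  then have xM: "x \<in> space M" using sets.sets_into_space[OF D_sets[OF i]] by auto
  have d0: "d > 0" using d by simp
  have pow: "(trans_op K ^^ k) (indicator (D 0)) y = (if (j + k) mod d = 0 then 1 else 0)"
    if "j < d" "y \<in> D j" for j k y
    using that
  proof (induction k arbitrary: j y)
    case 0
    then have "y \<in> D 0 \<longleftrightarrow> j = 0"
      using disj d0 unfolding disjoint_family_on_def by (metis IntI emptyE lessThan_iff)
    then show ?case using 0 by (auto split: split_indicator)
  next
    case (Suc k)
    have y: "y \<in> space M" using sets.sets_into_space[OF D_sets] Suc.prems by auto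
    interpret Ky: prob_space "K y" using kernel_space[OF y] by simp
    have j': "Suc j mod d < d" using d0 by simp
    have "AE z in K y. z \<in> D (Suc j mod d)"
      using step[OF Suc.prems] D_sets[OF j'] kernel_space[OF y] Ky.prob_eq_1 by blast
    then have "AE z in K y. (trans_op K ^^ k) (indicator (D 0)) z = (if (Suc j mod d + k) mod d = 0 then 1 else 0)"
      by eventually_elim (rule Suc.IH[OF j'])
    then have "trans_op K ((trans_op K ^^ k) (indicator (D 0))) y =
        (\<integral>\<^sup>+z. (if (Suc j mod d + k) mod d = 0 then 1 else 0) \<partial>K y)"
      unfolding trans_op_def by (rule nn_integral_cong_AE)
    also have "\<dots> = (if (j + Suc k) mod d = 0 then 1 else 0)"
      by (simp add: mod_add_left_eq Ky.emeasure_space_1)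
    finally show ?case by simp
  qed
  define s where "s k = (trans_op K ^^ k) (indicator (D 0)) x" for k
  have lim: "s \<longlonglongrightarrow> (\<integral>\<^sup>+y. indicator (D 0) y \<partial>\<pi>)"
    unfolding s_def using D_sets[OF d0] by (intro conv xM) (auto split: split_indicator)
  have sk: "s k = (if (i + k) mod d = 0 then 1 else 0)" for k
    unfolding s_def by (rule pow[OF i x])
  \<comment> \<open>From \<open>D i\<close> the cycle reaches \<open>D 0\<close> after
    \<open>d - i\<close> steps and again after every further \<open>d\<close> steps; one step later
    it is in \<open>D 1\<close>, which is disjoint from \<open>D 0\<close> as
    \<open>d \<ge> 2\<close>.\<close>
  have "s (d * m + (d - i)) = 1" and "s (d * m + (d - i) + 1) = 0" for m
  proof -
    have e: "i + (d * m + (d - i)) = d * Suc m" "i + (d * m + (d - i) + 1) = 1 + d * Suc m"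
      using i by auto
    show "s (d * m + (d - i)) = 1" "s (d * m + (d - i) + 1) = 0"
      unfolding sk e mod_mult_self2_is_0 mod_mult_self2 using d by auto
  qed
  moreover have "strict_mono (\<lambda>m. d * m + (d - i))" "strict_mono (\<lambda>m. d * m + (d - i) + 1)"
    using d0 by (auto simp: strict_mono_def)
  ultimately have "(\<lambda>m::nat. 1) \<longlonglongrightarrow> (\<integral>\<^sup>+y. indicator (D 0) y \<partial>\<pi>)" "(\<lambda>m::nat. 0) \<longlonglongrightarrow> (\<integral>\<^sup>+y. indicator (D 0) y \<partial>\<pi>)"
    using LIMSEQ_subseq_LIMSEQ[OF lim] by (force simp: comp_def)+
  then have "(1::ennreal) = 0" by (metis LIMSEQ_const_iff)
  then show False by simp
qed

theorem harris_ergodic_if_convergent: "harris_ergodic M K"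
  unfolding harris_ergodic_def harris_recurrent_def aperiodic_def
  using K inv maximal_irreducibility_measure_invariant AE_path_law_infinitely_often no_cycle by blast

end

end

section \<open>Affine recursions\<close>

text \<open>The characters are bounded, Lipschitz and determine the law, so they are the test
  functions to which the contraction is applied.\<close>

lemma norm_iexp_diff_le: "norm (iexp (t * y) - iexp (t * z)) \<le> \<bar>t\<bar> * \<bar>y - z\<bar>"
proof -
  have "iexp (t * y) - iexp (t * z) = iexp (t * z) * (iexp (t * (y - z)) - 1)"
    by (simp add: algebra_simps exp_add[symmetric])
  then have "norm (iexp (t * y) - iexp (t * z)) = norm (iexp (t * (y - z)) - 1)"
    by (simp add: norm_mult)
  also have "\<dots> \<le> \<bar>t * (y - z)\<bar>" using iexp_approx1[of "t * (y - z)" 0] by simp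
  finally show ?thesis by (simp add: abs_mult)
qed

text \<open>Contraction, weak convergence and uniqueness live at this level. Independence of
  \<theta> and \<open>V\<close> and a density for \<theta> enter in
  \<open>affine_recursion_density\<close>.\<close>

locale affine_recursion = prob_space \<Omega> for \<Omega> :: "'w measure" +
  fixes \<theta> V :: "'w \<Rightarrow> real"
  assumes \<theta>[measurable]: "\<theta> \<in> borel_measurable \<Omega>" and V[measurable]: "V \<in> borel_measurable \<Omega>"
    and \<theta>_pos: "AE \<omega> in \<Omega>. 0 < \<theta> \<omega>" and \<theta>_le_1: "AE \<omega> in \<Omega>. \<theta> \<omega> \<le> 1"
begin

definition kern :: "real \<Rightarrow> real measure" where
  "kern x = distr \<Omega> borel (\<lambda>\<omega>. \<theta> \<omega> * V \<omega> + (1 - \<theta> \<omega>) * x)"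

lemma prob_space_kern: "prob_space (kern x)"
  unfolding kern_def by (intro prob_space_distr) measurable

lemma sets_kern[measurable_cong]: "sets (kern x) = sets borel" by (simp add: kern_def)

lemma measurable_kern[measurable]: "kern \<in> measurable borel (prob_algebra borel)"
proof (rule measurable_prob_algebraI)
  show "prob_space (kern x)" for x by (rule prob_space_kern)
  show "kern \<in> measurable borel (subprob_algebra borel)"
  proof (rule measurable_subprob_algebra)
    show "subprob_space (kern x)" for x by (intro prob_space_imp_subprob_space prob_space_kern)
    show "sets (kern x) = sets borel" for x by (rule sets_kern)
    fix A :: "real set" assume A[measurable]: "A \<in> sets borel"
    have "emeasure (kern x) A = (\<integral>\<^sup>+\<omega>. indicator A (\<theta> \<omega> * V \<omega> + (1 - \<theta> \<omega>) * x) \<partial>\<Omega>)" for x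
      unfolding kern_def by (subst nn_integral_indicator[symmetric], simp, subst nn_integral_distr) auto
    moreover have "(\<lambda>x. \<integral>\<^sup>+\<omega>. indicator A (\<theta> \<omega> * V \<omega> + (1 - \<theta> \<omega>) * x) \<partial>\<Omega>) \<in> borel_measurable borel"
      by measurable
    ultimately show "(\<lambda>x. emeasure (kern x) A) \<in> borel_measurable borel" by simp
  qed
qed

lemma measurable_kern_subprob: "sets \<mu> = sets borel \<Longrightarrow> kern \<in> measurable \<mu> (subprob_algebra borel)"
  using measurable_prob_algebraD[OF measurable_kern] measurable_cong_sets[of \<mu> borel, OF _ refl] by blast

text \<open>The kernel is written as an integral over \<Omega> rather than over
  \<open>kern x\<close>, so that different starting points, and later different \<open>V\<close>,
  are coupled by the same \<omega>.\<close>

definition step_op :: "(real \<Rightarrow> complex) \<Rightarrow> real \<Rightarrow> complex" where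
  "step_op f x = (\<integral>\<omega>. f (\<theta> \<omega> * V \<omega> + (1 - \<theta> \<omega>) * x) \<partial>\<Omega>)"

lemma measurable_step_op[measurable]:
  assumes [measurable]: "f \<in> borel_measurable borel"
  shows "step_op f \<in> borel_measurable borel"
  unfolding step_op_def[abs_def] by measurable

lemma step_op_kern:
  assumes [measurable]: "f \<in> borel_measurable borel"
  shows "step_op f x = (\<integral>y. f y \<partial>kern x)"
  unfolding step_op_def kern_def by (rule integral_distr[symmetric]) measurable

lemma norm_step_op_le:
  assumes [measurable]: "f \<in> borel_measurable borel" and b: "\<And>y. norm (f y) \<le> B"
  shows "norm (step_op f x) \<le> B"
proof -
  have "norm (step_op f x) \<le> (\<integral>\<omega>. norm (f (\<theta> \<omega> * V \<omega> + (1 - \<theta> \<omega>) * x)) \<partial>\<Omega>)"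
    unfolding step_op_def by (rule integral_norm_bound)
  also have "\<dots> \<le> (\<integral>\<omega>. B \<partial>\<Omega>)"
    by (intro integral_mono integrable_norm integrable_const_bound[where B = B])
       (use b order_trans[OF norm_ge_zero b] in auto)
  finally show ?thesis by (simp add: prob_space)
qed

definition contraction_rate :: real where "contraction_rate = (\<integral>\<omega>. 1 - \<theta> \<omega> \<partial>\<Omega>)"

lemma integrable_\<theta>: "integrable \<Omega> \<theta>"
proof (rule integrable_const_bound[where B = 1])
  show "AE \<omega> in \<Omega>. norm (\<theta> \<omega>) \<le> 1"
    using \<theta>_pos \<theta>_le_1 by eventually_elim auto
qed simp

lemma contraction_rate: "0 \<le> contraction_rate" "contraction_rate < 1"
proof -
  show "0 \<le> contraction_rate"
    unfolding contraction_rate_def using \<theta>_le_1 by (intro integral_nonneg_AE) auto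
  have "(\<integral>\<omega>. 0 \<partial>\<Omega>) < (\<integral>\<omega>. \<theta> \<omega> \<partial>\<Omega>)"
    by (rule integral_less_AE_space) (use \<theta>_pos integrable_\<theta> emeasure_space_1 in auto)
  then have "0 < (\<integral>\<omega>. \<theta> \<omega> \<partial>\<Omega>)" by simp
  then show "contraction_rate < 1"
    unfolding contraction_rate_def using integrable_\<theta> by (simp add: prob_space)
qed

text \<open>In the coupling \<open>V\<close> cancels and the two images differ by exactly
  \<open>(1 - \<theta> \<omega>) * (x - y)\<close>; integrating gives the factor
  \<open>contraction_rate\<close>.\<close>

lemma step_op_lipschitz:
  assumes [measurable]: "f \<in> borel_measurable borel" and b: "\<And>y. norm (f y) \<le> 1"
    and L: "\<And>y z. norm (f y - f z) \<le> L * \<bar>y - z\<bar>" "0 \<le> L"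
  shows "norm (step_op f x - step_op f y) \<le> (contraction_rate * L) * \<bar>x - y\<bar>"
proof -
  let ?X = "\<lambda>x \<omega>. \<theta> \<omega> * V \<omega> + (1 - \<theta> \<omega>) * x"
  have i: "integrable \<Omega> (\<lambda>\<omega>. f (?X x \<omega>))" for x
    by (intro integrable_const_bound[where B = 1]) (use b in auto)
  have "norm (step_op f x - step_op f y) = norm (\<integral>\<omega>. f (?X x \<omega>) - f (?X y \<omega>) \<partial>\<Omega>)"
    unfolding step_op_def using i by simp
  also have "\<dots> \<le> (\<integral>\<omega>. norm (f (?X x \<omega>) - f (?X y \<omega>)) \<partial>\<Omega>)"
    by (rule integral_norm_bound)
  also have "\<dots> \<le> (\<integral>\<omega>. (1 - \<theta> \<omega>) * (L * \<bar>x - y\<bar>) \<partial>\<Omega>)"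
  proof (rule integral_mono_AE)
    show "integrable \<Omega> (\<lambda>\<omega>. norm (f (?X x \<omega>) - f (?X y \<omega>)))" using i by auto
    show "integrable \<Omega> (\<lambda>\<omega>. (1 - \<theta> \<omega>) * (L * \<bar>x - y\<bar>))" using integrable_\<theta> by auto
    show "AE \<omega> in \<Omega>. norm (f (?X x \<omega>) - f (?X y \<omega>)) \<le> (1 - \<theta> \<omega>) * (L * \<bar>x - y\<bar>)"
      using \<theta>_le_1
    proof eventually_elim
      case (elim \<omega>)
      have "norm (f (?X x \<omega>) - f (?X y \<omega>)) \<le> L * \<bar>?X x \<omega> - ?X y \<omega>\<bar>" by (rule L)
      also have "?X x \<omega> - ?X y \<omega> = (1 - \<theta> \<omega>) * (x - y)" by (simp add: algebra_simps)
      finally show ?case using elim by (simp add: abs_mult ac_simps)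
    qed
  qed
  also have "\<dots> = (contraction_rate * L) * \<bar>x - y\<bar>"
    unfolding contraction_rate_def by simp
  finally show ?thesis .
qed

text \<open>The \<open>k\<close>-step law as a measure on the line, the form required by weak
  convergence and characteristic functions; \<open>trans_op\<close> and \<open>step_op\<close>
  describe the same iteration on functions.\<close>

definition kern_power :: "nat \<Rightarrow> real \<Rightarrow> real measure" where
  "kern_power k x = ((\<lambda>\<mu>. \<mu> \<bind> kern) ^^ k) (return borel x)"

lemma kern_power_0: "kern_power 0 x = return borel x"
  and kern_power_Suc: "kern_power (Suc k) x = kern_power k x \<bind> kern"
  by (simp_all add: kern_power_def)

lemma real_distribution_bind_kern:
  assumes "real_distribution \<mu>" shows "real_distribution (\<mu> \<bind> kern)"
proof -
  interpret \<mu>: real_distribution \<mu> by fact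
  have "prob_space (\<mu> \<bind> kern)"
    by (rule \<mu>.prob_space_bind[OF AE_I2[OF prob_space_kern] measurable_kern_subprob]) simp
  moreover have "sets (\<mu> \<bind> kern) = sets borel"
    by (rule sets_bind) (simp_all add: sets_kern \<mu>.not_empty)
  ultimately show ?thesis by (simp add: real_distribution_def real_distribution_axioms_def)
qed

lemma real_distribution_kern_power: "real_distribution (kern_power k x)"
proof (induction k)
  case 0
  then show ?case
    by (simp add: kern_power_0 real_distribution_def real_distribution_axioms_def prob_space_return)
qed (simp add: kern_power_Suc real_distribution_bind_kern)

lemma integral_bind_kern:
  assumes "real_distribution \<mu>" and f[measurable]: "f \<in> borel_measurable borel" and b: "\<And>y. norm (f y) \<le> B"
  shows "(\<integral>y. f y \<partial>(\<mu> \<bind> kern)) = (\<integral>y. step_op f y \<partial>\<mu>)"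
proof -
  interpret \<mu>: real_distribution \<mu> by fact
  have r: "(\<integral>y. r y \<partial>(\<mu> \<bind> kern)) = (\<integral>y. (\<integral>z. r z \<partial>kern y) \<partial>\<mu>)"
    if [measurable]: "r \<in> borel_measurable borel" and "\<And>y. \<bar>r y\<bar> \<le> B" for r :: "real \<Rightarrow> real"
    by (rule integral_bind[where K = borel and B = B and B' = 1])
       (simp_all add: that prob_space.emeasure_space_1[OF prob_space_kern] \<mu>.finite_measure_axioms measurable_kern_subprob)
  have i: "integrable \<rho> f" if "real_distribution \<rho>" for \<rho>
  proof -
    interpret \<rho>: real_distribution \<rho> by fact
    show ?thesis by (intro \<rho>.integrable_const_bound[where B = B]) (use b in auto)
  qed
  have k: "real_distribution (kern y)" for y
    by (simp add: real_distribution_def real_distribution_axioms_def prob_space_kern sets_kern)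
  have "(\<integral>y. f y \<partial>(\<mu> \<bind> kern)) = (\<integral>y. (\<integral>z. f z \<partial>kern y) \<partial>\<mu>)"
  proof (rule complex_eqI)
    have m: "(\<lambda>y. \<integral>z. f z \<partial>kern y) \<in> borel_measurable borel" "norm (\<integral>z. f z \<partial>kern y) \<le> B" for y
      using measurable_step_op[OF f] norm_step_op_le[OF f b] by (simp_all add: step_op_kern[OF f, symmetric])
    have i': "integrable \<mu> (\<lambda>y. \<integral>z. f z \<partial>kern y)"
    proof (rule \<mu>.integrable_const_bound[where B = B])
      show "(\<lambda>y. \<integral>z. f z \<partial>kern y) \<in> borel_measurable \<mu>"
        by (subst measurable_cong_sets[OF \<mu>.events_eq_borel refl]) (rule m(1))
    qed (rule AE_I2, rule m(2))
    show "Re (\<integral>y. f y \<partial>(\<mu> \<bind> kern)) = Re (\<integral>y. (\<integral>z. f z \<partial>kern y) \<partial>\<mu>)"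
      using r[of "\<lambda>y. Re (f y)"] b order_trans[OF abs_Re_le_cmod b]
      by (simp add: integral_Re[OF i[OF real_distribution_bind_kern[OF assms(1)]], symmetric]
        integral_Re[OF i', symmetric] integral_Re[OF i[OF k], symmetric])
    show "Im (\<integral>y. f y \<partial>(\<mu> \<bind> kern)) = Im (\<integral>y. (\<integral>z. f z \<partial>kern y) \<partial>\<mu>)"
      using r[of "\<lambda>y. Im (f y)"] b order_trans[OF abs_Im_le_cmod b]
      by (simp add: integral_Im[OF i[OF real_distribution_bind_kern[OF assms(1)]], symmetric]
        integral_Im[OF i', symmetric] integral_Im[OF i[OF k], symmetric])
  qed
  then show ?thesis by (simp add: step_op_kern)
qed

text \<open>The three claims are proved by one induction, since each application of
  \<open>step_op_lipschitz\<close> needs measurability and the bound for the previous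
  iterate.\<close>

lemma step_op_power:
  assumes f: "f \<in> borel_measurable borel" and b: "\<And>y. norm (f y) \<le> 1"
    and L: "\<And>y z. norm (f y - f z) \<le> L * \<bar>y - z\<bar>" "0 \<le> L"
  shows "(step_op ^^ k) f \<in> borel_measurable borel"
    and "norm ((step_op ^^ k) f y) \<le> 1"
    and "norm ((step_op ^^ k) f y - (step_op ^^ k) f z) \<le> contraction_rate ^ k * L * \<bar>y - z\<bar>"
proof -
  have "(step_op ^^ k) f \<in> borel_measurable borel \<and> (\<forall>y. norm ((step_op ^^ k) f y) \<le> 1) \<and>
    (\<forall>y z. norm ((step_op ^^ k) f y - (step_op ^^ k) f z) \<le> contraction_rate ^ k * L * \<bar>y - z\<bar>)"
  proof (induction k)
    case 0
    show ?case
      unfolding funpow_0 power_0 mult_1 using f b L(1) by blast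
  next
    case (Suc k)
    then have IH: "(step_op ^^ k) f \<in> borel_measurable borel" "\<And>y. norm ((step_op ^^ k) f y) \<le> 1"
      "\<And>y z. norm ((step_op ^^ k) f y - (step_op ^^ k) f z) \<le> contraction_rate ^ k * L * \<bar>y - z\<bar>"
      by blast+
    have "0 \<le> contraction_rate ^ k * L" using contraction_rate(1) L(2) by simp
    then have "norm (step_op ((step_op ^^ k) f) y - step_op ((step_op ^^ k) f) z) \<le>
        contraction_rate ^ Suc k * L * \<bar>y - z\<bar>" for y z
      using step_op_lipschitz[OF IH, of y z] by (simp only: power_Suc mult.assoc)
    then show ?case
      unfolding funpow.simps comp_apply
      using measurable_step_op[OF IH(1)] norm_step_op_le[OF IH(1,2)] by blast
  qed
  then show "(step_op ^^ k) f \<in> borel_measurable borel"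
    and "norm ((step_op ^^ k) f y) \<le> 1"
    and "norm ((step_op ^^ k) f y - (step_op ^^ k) f z) \<le> contraction_rate ^ k * L * \<bar>y - z\<bar>"
    by blast+
qed

lemma integral_kern_power:
  assumes "f \<in> borel_measurable borel" and "\<And>y. norm (f y) \<le> B"
  shows "(\<integral>y. f y \<partial>kern_power k x) = (step_op ^^ k) f x"
  using assms
proof (induction k arbitrary: f)
  case 0
  then show ?case
    unfolding kern_power_0 funpow_0 by (intro integral_return) (simp only: space_borel UNIV_I)
next
  case (Suc k)
  have "(\<integral>y. f y \<partial>kern_power (Suc k) x) = (\<integral>y. step_op f y \<partial>kern_power k x)"
    unfolding kern_power_Suc
    by (rule integral_bind_kern[OF real_distribution_kern_power Suc.prems])
  also have "\<dots> = (step_op ^^ k) (step_op f) x"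
    by (rule Suc.IH[OF measurable_step_op[OF Suc.prems(1)] norm_step_op_le[OF Suc.prems]])
  finally show ?case by (simp only: funpow_Suc_right comp_apply)
qed

lemma real_distribution_invariant: "invariant_probability borel kern \<pi> \<Longrightarrow> real_distribution \<pi>"
  by (auto simp: invariant_probability_def real_distribution_def real_distribution_axioms_def)

text \<open>By invariance \<open>(step_op ^^ k) f\<close> has the same \<pi>-integral for all
  \<open>k\<close>, while its values at \<open>x\<close> and at any \<open>y\<close> differ by at
  most \<open>contraction_rate ^ k\<close> times a constant depending on \<open>y\<close>.
  Integrating this difference over \<open>y\<close> identifies the limit. The dominating constant 2
  comes from boundedness of \<open>f\<close>, so \<pi> may have infinite mean.\<close>

lemma char_kern_power_tendsto:
  assumes inv: "invariant_probability borel kern \<pi>"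
  shows "(\<lambda>k. char (kern_power k x) t) \<longlonglongrightarrow> char \<pi> t"
proof -
  interpret \<pi>: real_distribution \<pi> by (rule real_distribution_invariant[OF inv])
  have b: "\<pi> \<bind> kern = \<pi>" using inv by (simp add: invariant_probability_def)
  define f :: "real \<Rightarrow> complex" where "f y = iexp (t * y)" for y
  have f[measurable]: "f \<in> borel_measurable borel" unfolding f_def by measurable
  have f1: "norm (f y) \<le> 1" for y by (simp add: f_def)
  have fL: "norm (f y - f z) \<le> \<bar>t\<bar> * \<bar>y - z\<bar>" for y z
    unfolding f_def by (rule norm_iexp_diff_le)
  note sp = step_op_power[OF f f1 fL abs_ge_zero]
  note [measurable] = sp(1)
  have step_inv: "(\<integral>y. (step_op ^^ k) f y \<partial>\<pi>) = (\<integral>y. f y \<partial>\<pi>)" for k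
  proof (induction k)
    case (Suc k)
    have "(\<integral>y. (step_op ^^ Suc k) f y \<partial>\<pi>) = (\<integral>y. (step_op ^^ k) f y \<partial>(\<pi> \<bind> kern))"
      by (subst integral_bind_kern[OF \<pi>.real_distribution_axioms sp(1,2)]) simp
    then show ?case using Suc b by simp
  qed simp
  have "(\<lambda>k. \<integral>y. (step_op ^^ k) f x - (step_op ^^ k) f y \<partial>\<pi>) \<longlonglongrightarrow> (\<integral>y. 0 \<partial>\<pi>)"
  proof (rule integral_dominated_convergence[where w = "\<lambda>_. 2"])
    show "AE y in \<pi>. (\<lambda>k. (step_op ^^ k) f x - (step_op ^^ k) f y) \<longlonglongrightarrow> 0"
    proof (rule AE_I2)
      fix y
      have "(\<lambda>k. contraction_rate ^ k * \<bar>t\<bar> * \<bar>x - y\<bar>) \<longlonglongrightarrow> 0 * \<bar>t\<bar> * \<bar>x - y\<bar>"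
        using contraction_rate by (intro tendsto_mult LIMSEQ_power_zero tendsto_const) auto
      then have "(\<lambda>k. contraction_rate ^ k * \<bar>t\<bar> * \<bar>x - y\<bar>) \<longlonglongrightarrow> 0" by simp
      then show "(\<lambda>k. (step_op ^^ k) f x - (step_op ^^ k) f y) \<longlonglongrightarrow> 0"
        by (rule Lim_null_comparison[OF always_eventually, rotated]) (intro allI sp(3))
    qed
    show "AE y in \<pi>. norm ((step_op ^^ k) f x - (step_op ^^ k) f y) \<le> 2" for k
    proof (rule AE_I2)
      fix y show "norm ((step_op ^^ k) f x - (step_op ^^ k) f y) \<le> 2"
        using norm_triangle_ineq4[of "(step_op ^^ k) f x" "(step_op ^^ k) f y"] sp(2)[of k x] sp(2)[of k y] by linarith
    qed
  qed auto
  moreover have "(\<integral>y. (step_op ^^ k) f x - (step_op ^^ k) f y \<partial>\<pi>) = (step_op ^^ k) f x - (\<integral>y. f y \<partial>\<pi>)" for k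
  proof -
    have "integrable \<pi> ((step_op ^^ k) f)"
      by (intro \<pi>.integrable_const_bound[where B = 1]) (use sp(2) in auto)
    then show ?thesis using step_inv[of k] \<pi>.prob_space by simp
  qed
  ultimately have "(\<lambda>k. (step_op ^^ k) f x) \<longlonglongrightarrow> (\<integral>y. f y \<partial>\<pi>)" by (simp add: LIM_zero_iff)
  moreover have "char (kern_power k x) t = (step_op ^^ k) f x" for k
    using integral_kern_power[OF f f1, of k x] unfolding char_def f_def[symmetric] f_def[abs_def, symmetric] .
  moreover have "char \<pi> t = (\<integral>y. f y \<partial>\<pi>)" by (simp add: char_def f_def)
  ultimately show ?thesis by (simp only:)
qed

lemma weak_conv_kern_power:
  assumes "invariant_probability borel kern \<pi>"
  shows "weak_conv_m (\<lambda>k. kern_power k x) \<pi>"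
  using assms
  by (intro levy_continuity real_distribution_kern_power real_distribution_invariant char_kern_power_tendsto)

text \<open>The laws \<open>kern_power k 0\<close> converge to both candidates; the start 0 is
  arbitrary.\<close>

lemma invariant_probability_unique:
  assumes "invariant_probability borel kern \<pi>" "invariant_probability borel kern \<pi>'"
  shows "\<pi> = \<pi>'"
proof (rule Levy_uniqueness)
  show "char \<pi> = char \<pi>'"
    using char_kern_power_tendsto[OF assms(1), of 0] char_kern_power_tendsto[OF assms(2), of 0]
    by (intro ext) (rule LIMSEQ_unique)
qed (use assms real_distribution_invariant in auto)

lemma nn_integral_kern_power:
  assumes "f \<in> borel_measurable borel"
  shows "(\<integral>\<^sup>+y. f y \<partial>kern_power k x) = (trans_op kern ^^ k) f x"
  using assms
proof (induction k arbitrary: f)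
  case 0
  then show ?case
    unfolding kern_power_0 funpow_0 by (intro nn_integral_return) (simp only: space_borel UNIV_I)
next
  case (Suc k)
  interpret kp: real_distribution "kern_power k x" by (rule real_distribution_kern_power)
  note [measurable] = Suc.prems
  have "(\<integral>\<^sup>+y. f y \<partial>kern_power (Suc k) x) = (\<integral>\<^sup>+y. trans_op kern f y \<partial>kern_power k x)"
    unfolding kern_power_Suc trans_op_def by (rule nn_integral_bind[OF Suc.prems measurable_kern_subprob]) simp
  also have "\<dots> = (trans_op kern ^^ k) (trans_op kern f) x"
    by (rule Suc.IH[OF measurable_trans_op[OF measurable_kern Suc.prems]])
  finally show ?case by (simp only: funpow_Suc_right comp_apply)
qed

end

section \<open>Smoothing by a density of \<theta>\<close>

lemma tendsto_integral_affine_density: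
  fixes f p :: "real \<Rightarrow> real"
  assumes [measurable]: "f \<in> borel_measurable borel" "p \<in> borel_measurable borel"
    and f: "\<And>x. \<bar>f x\<bar> \<le> 1" and p: "integrable lborel p" "\<And>x. 0 \<le> p x"
    and Z: "countable Z" "\<And>x. x \<notin> Z \<Longrightarrow> isCont p x"
    and s: "s \<longlonglongrightarrow> s'" and c: "c \<longlonglongrightarrow> c'" "c' \<noteq> 0"
  shows "(\<lambda>k. \<integral>t. p t * f (s k + c k * t) \<partial>lborel) \<longlonglongrightarrow> (\<integral>t. p t * f (s' + c' * t) \<partial>lborel)"
proof -
  \<comment> \<open>\<open>F a b\<close> is the density of \<open>a + b * t\<close> when
    \<open>t\<close> has density \<open>p\<close>. As \<open>f\<close> is merely measurable, the
    dependence on \<open>s k\<close> and \<open>c k\<close> has to be moved from its argument into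
    this density.\<close>
  define F where "F a b y = p ((y - a) / b) / \<bar>b\<bar>" for a b y :: real
  have F[measurable]: "F a b \<in> borel_measurable borel" for a b unfolding F_def[abs_def] by measurable
  have nF: "(\<integral>\<^sup>+y. norm (F a b y) \<partial>lborel) = (\<integral>\<^sup>+t. p t \<partial>lborel)" if "b \<noteq> 0" for a b
    using that p(2)
    by (subst nn_integral_real_affine[where c = b and t = a])
       (auto simp: F_def nn_integral_cmult[symmetric] ennreal_mult[symmetric] intro!: nn_integral_cong)
  have iF: "integrable lborel (F a b)" if "b \<noteq> 0" for a b
    unfolding integrable_iff_bounded nF[OF that] using p by (auto simp: integrable_iff_bounded)
  have eF: "(\<integral>t. p t * f (a + b * t) \<partial>lborel) = (\<integral>y. F a b y * f y \<partial>lborel)" if "b \<noteq> 0" for a b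
    using that by (subst lborel_integral_real_affine[where c = b and t = a])
       (auto simp: F_def intro!: Bochner_Integration.integral_cong)
  have iFf: "integrable lborel (\<lambda>y. F a b y * f y)" if "b \<noteq> 0" for a b
    using iF[OF that, of a] by (rule Bochner_Integration.integrable_bound)
      (use f in \<open>auto simp: abs_mult intro!: mult_left_le\<close>)
  have ev: "eventually (\<lambda>k. c k \<noteq> 0) sequentially"
    using tendsto_imp_eventually_ne[OF c(1,2)] .
  then obtain k0 where k0: "\<And>k. k \<ge> k0 \<Longrightarrow> c k \<noteq> 0" by (auto simp: eventually_sequentially)
  \<comment> \<open>All these densities have the same total mass, so by Scheffe almost everywhere
    convergence implies convergence in L1. The shift by \<open>k0\<close> skips an initial segment
    on which \<open>c k\<close> may vanish.\<close>
  have "(\<lambda>k. \<integral>\<^sup>+y. norm (F (s (k + k0)) (c (k + k0)) y - F s' c' y) \<partial>lborel) \<longlonglongrightarrow> 0"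
  proof (rule Scheffe_lemma2)
    show "integrable lborel (F s' c')" using c by (intro iF)
    show "(\<integral>\<^sup>+y. norm (F (s (k + k0)) (c (k + k0)) y) \<partial>lborel) \<le> (\<integral>\<^sup>+y. norm (F s' c' y) \<partial>lborel)" for k
      unfolding nF[OF c(2)] by (subst nF) (simp_all add: k0)
    have "countable ((\<lambda>z. s' + c' * z) ` Z)" using Z by simp
    then have "AE y in lborel. y \<notin> (\<lambda>z. s' + c' * z) ` Z"
      by (intro AE_not_in countable_imp_null_set_lborel)
    then show "AE y in lborel. (\<lambda>k. F (s (k + k0)) (c (k + k0)) y) \<longlonglongrightarrow> F s' c' y"
    proof eventually_elim
      case (elim y)
      have "(y - s') / c' \<notin> Z" using elim c(2) by (auto simp: image_iff field_simps)
      then have "isCont p ((y - s') / c')" by (rule Z)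
      moreover have "(\<lambda>k. (y - s k) / c k) \<longlonglongrightarrow> (y - s') / c'"
        by (intro tendsto_intros s c)
      ultimately have "(\<lambda>k. p ((y - s k) / c k)) \<longlonglongrightarrow> p ((y - s') / c')"
        by (rule isCont_tendsto_compose)
      then have "(\<lambda>k. F (s k) (c k) y) \<longlonglongrightarrow> F s' c' y"
        unfolding F_def by (rule tendsto_divide) (use c in \<open>auto intro: tendsto_rabs\<close>)
      then show ?case by (rule LIMSEQ_ignore_initial_segment)
    qed
  qed auto
  then have "(\<lambda>k. enn2real (\<integral>\<^sup>+y. norm (F (s (k + k0)) (c (k + k0)) y - F s' c' y) \<partial>lborel)) \<longlonglongrightarrow> 0"
    by (intro tendsto_enn2real) (simp_all only: ennreal_0 order_refl)
  then have "(\<lambda>k. (\<integral>t. p t * f (s (k + k0) + c (k + k0) * t) \<partial>lborel) - (\<integral>t. p t * f (s' + c' * t) \<partial>lborel)) \<longlonglongrightarrow> 0"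
  proof (rule Lim_null_comparison[OF always_eventually, rotated], intro allI)
    fix k
    let ?D = "\<lambda>y. F (s (k + k0)) (c (k + k0)) y - F s' c' y"
    have ck: "c (k + k0) \<noteq> 0" using k0 by simp
    have iD: "integrable lborel ?D" using iF[OF ck] iF[OF c(2)] by auto
    have "norm ((\<integral>t. p t * f (s (k + k0) + c (k + k0) * t) \<partial>lborel) - (\<integral>t. p t * f (s' + c' * t) \<partial>lborel))
      = norm (\<integral>y. ?D y * f y \<partial>lborel)"
      unfolding eF[OF ck] eF[OF c(2)] left_diff_distrib using iFf[OF ck] iFf[OF c(2)] by simp
    also have "\<dots> \<le> (\<integral>y. norm (?D y * f y) \<partial>lborel)" by (rule integral_norm_bound)
    also have "\<dots> \<le> (\<integral>y. norm (?D y) \<partial>lborel)"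
      by (rule integral_mono') (use iD f in \<open>auto simp: abs_mult intro!: mult_left_le\<close>)
    also have "\<dots> = enn2real (\<integral>\<^sup>+y. norm (?D y) \<partial>lborel)"
      by (rule integral_eq_nn_integral) auto
    finally show "norm ((\<integral>t. p t * f (s (k + k0) + c (k + k0) * t) \<partial>lborel) - (\<integral>t. p t * f (s' + c' * t) \<partial>lborel))
      \<le> enn2real (\<integral>\<^sup>+y. norm (?D y) \<partial>lborel)" .
  qed
  then show ?thesis by (simp add: LIM_zero_iff LIMSEQ_offset[where k = k0])
qed

text \<open>\<open>joint\<close> states at once that \<theta> has density \<open>p\<close> and that
  \<theta> and \<open>V\<close> are independent. The countable set \<open>Z\<close> allows for
  discontinuities of a Beta density at 0 and 1, and \<open>nondeg\<close> is what keeps the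
  invariant law free of atoms.\<close>

locale affine_recursion_density = affine_recursion +
  fixes p :: "real \<Rightarrow> real" and Z :: "real set"
  assumes p[measurable]: "p \<in> borel_measurable borel" and p_nonneg: "\<And>t. 0 \<le> p t"
    and Z: "countable Z" "\<And>t. t \<notin> Z \<Longrightarrow> isCont p t"
    and joint: "distr \<Omega> (borel \<Otimes>\<^sub>M borel) (\<lambda>\<omega>. (\<theta> \<omega>, V \<omega>)) = density lborel p \<Otimes>\<^sub>M distr \<Omega> borel V"
    and nondeg: "\<And>c. \<not> (AE \<omega> in \<Omega>. V \<omega> = c)"
begin

lemma distr_\<theta>: "distr \<Omega> borel \<theta> = density lborel p"
proof -
  interpret V: prob_space "distr \<Omega> borel V" by (intro prob_space_distr) measurable
  have "distr \<Omega> borel \<theta> = distr (distr \<Omega> (borel \<Otimes>\<^sub>M borel) (\<lambda>\<omega>. (\<theta> \<omega>, V \<omega>))) borel fst"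
    by (simp add: distr_distr comp_def)
  also have "\<dots> = distr (density lborel p \<Otimes>\<^sub>M distr \<Omega> borel V) (density lborel p) fst"
    unfolding joint by (intro distr_cong) auto
  also have "\<dots> = density lborel p" by (rule V.distr_pair_fst)
  finally show ?thesis .
qed

lemma prob_space_p: "prob_space (density lborel p)"
  unfolding distr_\<theta>[symmetric] by (intro prob_space_distr) measurable

lemma integrable_p: "integrable lborel p"
proof -
  interpret P: prob_space "density lborel p" by (rule prob_space_p)
  have "(\<integral>\<^sup>+t. p t \<partial>lborel) = 1"
    using P.emeasure_space_1 by (simp add: emeasure_density)
  then show ?thesis by (simp add: integrable_iff_bounded p_nonneg)
qed

lemma pair_prob_space_density: "pair_prob_space (density lborel p) (distr \<Omega> borel V)"
  unfolding pair_prob_space_def pair_sigma_finite_def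
  by (intro conjI prob_space_imp_sigma_finite prob_space_p prob_space_distr[OF V])

text \<open>Freeze \<open>V = v\<close>. For \<open>v \<noteq> x\<close> the next state
  \<open>x + (v - x) * t\<close> has a density that varies continuously in L1 with \<open>x\<close>,
  and the exceptional value \<open>v = x\<close> has probability 0 by assumption.\<close>

lemma isCont_kernel_integral:
  fixes f :: "real \<Rightarrow> real"
  assumes [measurable]: "f \<in> borel_measurable borel" and f: "\<And>x. \<bar>f x\<bar> \<le> 1"
    and x: "measure (distr \<Omega> borel V) {x} = 0"
  shows "isCont (\<lambda>x. \<integral>\<omega>. f (\<theta> \<omega> * V \<omega> + (1 - \<theta> \<omega>) * x) \<partial>\<Omega>) x"
proof -
  let ?\<nu> = "distr \<Omega> borel V"
  interpret pair: pair_prob_space "density lborel p" ?\<nu> by (rule pair_prob_space_density)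
  define \<phi> where "\<phi> y v = (\<integral>t. p t * f (y + (v - y) * t) \<partial>lborel)" for y v
  have m\<phi>[measurable]: "\<phi> y \<in> borel_measurable borel" for y
    unfolding \<phi>_def[abs_def] by measurable
  have eq: "(\<integral>\<omega>. f (\<theta> \<omega> * V \<omega> + (1 - \<theta> \<omega>) * y) \<partial>\<Omega>) = (\<integral>v. \<phi> y v \<partial>?\<nu>)" for y
  proof -
    have "(\<integral>\<omega>. f (\<theta> \<omega> * V \<omega> + (1 - \<theta> \<omega>) * y) \<partial>\<Omega>) =
      (\<integral>z. f (fst z * snd z + (1 - fst z) * y) \<partial>distr \<Omega> (borel \<Otimes>\<^sub>M borel) (\<lambda>\<omega>. (\<theta> \<omega>, V \<omega>)))"
      by (subst integral_distr) auto
    also have "\<dots> = (\<integral>v. (\<integral>t. f (t * v + (1 - t) * y) \<partial>density lborel p) \<partial>?\<nu>)"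
    proof -
      have "integrable (density lborel p \<Otimes>\<^sub>M ?\<nu>) (\<lambda>(t, v). f (t * v + (1 - t) * y))"
        by (rule pair.integrable_const_bound[where B = 1]) (auto simp: f)
      from pair.integral_snd[OF this] show ?thesis
        unfolding joint split_beta' by (rule sym)
    qed
    also have "\<dots> = (\<integral>v. \<phi> y v \<partial>?\<nu>)"
      unfolding \<phi>_def
      by (subst integral_density) (auto simp: p_nonneg algebra_simps)
    finally show ?thesis .
  qed
  have b\<phi>: "\<bar>\<phi> y v\<bar> \<le> 1" for y v
  proof -
    have "\<phi> y v = (\<integral>t. f (y + (v - y) * t) \<partial>density lborel p)"
      unfolding \<phi>_def by (subst integral_density) (auto simp: p_nonneg)
    also have "\<bar>\<dots>\<bar> \<le> (\<integral>t. \<bar>f (y + (v - y) * t)\<bar> \<partial>density lborel p)" by (rule integral_abs_bound)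
    also have "\<dots> \<le> (\<integral>t. 1 \<partial>density lborel p)"
      by (intro integral_mono pair.M1.integrable_const_bound[where B = 1]) (use f in auto)
    finally show ?thesis using pair.M1.prob_space by simp
  qed
  have "{x} \<in> null_sets ?\<nu>"
    using x by (simp add: null_sets_def pair.M2.emeasure_eq_measure)
  then have AEx: "AE v in ?\<nu>. v \<noteq> x" using AE_not_in by fastforce
  show ?thesis
    unfolding eq continuous_at_sequentially comp_def
  proof (intro allI impI)
    fix y assume y: "y \<longlonglongrightarrow> x"
    show "(\<lambda>k. \<integral>v. \<phi> (y k) v \<partial>?\<nu>) \<longlonglongrightarrow> (\<integral>v. \<phi> x v \<partial>?\<nu>)"
    proof (rule integral_dominated_convergence[where w = "\<lambda>_. 1"])
      show "AE v in ?\<nu>. (\<lambda>k. \<phi> (y k) v) \<longlonglongrightarrow> \<phi> x v"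
        using AEx unfolding \<phi>_def
        by eventually_elim (intro tendsto_integral_affine_density[OF _ p f integrable_p p_nonneg Z] y tendsto_intros; simp)
    qed (use b\<phi> in auto)
  qed
qed

lemma prob_V_eq_less_1: "measure (distr \<Omega> borel V) {x} < 1"
proof -
  have "measure (distr \<Omega> borel V) {x} = prob {\<omega> \<in> space \<Omega>. V \<omega> = x}"
    by (subst measure_distr) (auto intro!: arg_cong[where f = prob])
  moreover have "prob {\<omega> \<in> space \<Omega>. V \<omega> = x} \<noteq> 1"
    using nondeg[of x] by (subst prob_Collect_eq_1) auto
  ultimately show ?thesis using prob_le_1[of "{\<omega> \<in> space \<Omega>. V \<omega> = x}"] by linarith
qed

text \<open>From \<open>y = x\<close> the chain stays at \<open>x\<close> exactly when
  \<open>V = x\<close>, as \<theta> is positive. From \<open>y \<noteq> x\<close> and for given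
  \<open>v\<close>, at most one value of \<theta> leads to \<open>x\<close>, and \<theta> has a
  density.\<close>

lemma emeasure_kern_singleton:
  "emeasure (kern y) {x} = (if y = x then measure (distr \<Omega> borel V) {x} else 0)"
proof -
  have k: "emeasure (kern y) {x} = emeasure \<Omega> {\<omega> \<in> space \<Omega>. \<theta> \<omega> * V \<omega> + (1 - \<theta> \<omega>) * y = x}"
    unfolding kern_def by (subst emeasure_distr) (auto intro!: arg_cong[where f = "emeasure \<Omega>"])
  show ?thesis
  proof (cases "y = x")
    case True
    have "emeasure \<Omega> {\<omega> \<in> space \<Omega>. \<theta> \<omega> * V \<omega> + (1 - \<theta> \<omega>) * y = x} = emeasure \<Omega> {\<omega> \<in> space \<Omega>. V \<omega> = x}"
    proof (rule emeasure_eq_AE)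
      show "AE \<omega> in \<Omega>. (\<omega> \<in> {\<omega> \<in> space \<Omega>. \<theta> \<omega> * V \<omega> + (1 - \<theta> \<omega>) * y = x}) = (\<omega> \<in> {\<omega> \<in> space \<Omega>. V \<omega> = x})"
        using \<theta>_pos
      proof eventually_elim
        case (elim \<omega>)
        have "\<theta> \<omega> * V \<omega> + (1 - \<theta> \<omega>) * x = x \<longleftrightarrow> \<theta> \<omega> * (V \<omega> - x) = 0" by (auto simp: algebra_simps)
        then show ?case using elim True by auto
      qed
    qed auto
    also have "\<dots> = measure (distr \<Omega> borel V) {x}"
      by (subst measure_distr) (auto simp: emeasure_eq_measure intro!: arg_cong[where f = prob])
    finally show ?thesis using k True by simp
  next
    case False
    interpret pair: pair_prob_space "density lborel p" "distr \<Omega> borel V" by (rule pair_prob_space_density)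
    let ?A = "{z. fst z * snd z + (1 - fst z) * y = x} :: (real \<times> real) set"
    have A[measurable]: "?A \<in> sets (borel \<Otimes>\<^sub>M borel)"
      using borel_measurable_eq[of "\<lambda>z. fst z * snd z + (1 - fst z) * y" "borel \<Otimes>\<^sub>M borel" "\<lambda>_. x"] by (auto simp: space_pair_measure)
    have "emeasure \<Omega> {\<omega> \<in> space \<Omega>. \<theta> \<omega> * V \<omega> + (1 - \<theta> \<omega>) * y = x} =
        emeasure (distr \<Omega> (borel \<Otimes>\<^sub>M borel) (\<lambda>\<omega>. (\<theta> \<omega>, V \<omega>))) ?A"
      by (subst emeasure_distr) (auto intro!: arg_cong[where f = "emeasure \<Omega>"])
    also have "\<dots> = (\<integral>\<^sup>+v. emeasure (density lborel p) ((\<lambda>t. (t, v)) -` ?A) \<partial>distr \<Omega> borel V)"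
      unfolding joint by (rule pair.emeasure_pair_measure_alt2) (use A in auto)
    also have "\<dots> = (\<integral>\<^sup>+v. 0 \<partial>distr \<Omega> borel V)"
    proof (rule nn_integral_cong)
      fix v
      have "(\<lambda>t. (t, v)) -` ?A \<subseteq> {(x - y) / (v - y)}"
      proof
        fix t assume "t \<in> (\<lambda>t. (t, v)) -` ?A"
        then have t: "t * (v - y) = x - y" by (simp add: algebra_simps)
        then have "v \<noteq> y" using False by auto
        then show "t \<in> {(x - y) / (v - y)}" using t by (simp add: field_simps)
      qed
      then have fin: "countable ((\<lambda>t. (t, v)) -` ?A)" by (meson countable_finite finite.emptyI finite.insertI finite_subset)
      then have "(\<lambda>t. (t, v)) -` ?A \<in> null_sets lborel" by (rule countable_imp_null_set_lborel)
      then show "emeasure (density lborel p) ((\<lambda>t. (t, v)) -` ?A) = 0"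
        using absolutely_continuousI_density[of p lborel] by (auto simp: absolutely_continuous_def)
    qed
    finally show ?thesis using False k by simp
  qed
qed

text \<open>An atom at \<open>x\<close> can be fed only from \<open>x\<close> itself, and only with
  a probability \<open>r < 1\<close>; invariance then makes the mass at \<open>x\<close> equal to
  \<open>r\<close> times itself.\<close>

lemma emeasure_invariant_singleton:
  assumes inv: "invariant_probability borel kern \<pi>"
  shows "emeasure \<pi> {x} = 0"
proof -
  interpret \<pi>: real_distribution \<pi> by (rule real_distribution_invariant[OF inv])
  define r where "r = measure (distr \<Omega> borel V) {x}"
  have r: "r < 1" "0 \<le> r" unfolding r_def using prob_V_eq_less_1 by auto
  have b: "\<pi> \<bind> kern = \<pi>" using inv by (simp add: invariant_probability_def)
  have "emeasure \<pi> {x} = emeasure (\<pi> \<bind> kern) {x}" unfolding b ..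
  also have "\<dots> = (\<integral>\<^sup>+y. emeasure (kern y) {x} \<partial>\<pi>)"
    by (rule emeasure_bind[OF _ measurable_kern_subprob]) (simp_all add: \<pi>.not_empty)
  also have "\<dots> = (\<integral>\<^sup>+y. ennreal r * indicator {x} y \<partial>\<pi>)"
    unfolding emeasure_kern_singleton r_def by (intro nn_integral_cong) (auto split: split_indicator)
  also have "\<dots> = ennreal r * emeasure \<pi> {x}"
    by (subst nn_integral_cmult_indicator) auto
  finally have "\<pi>.prob {x} = r * \<pi>.prob {x}"
    using r by (simp add: \<pi>.emeasure_eq_measure ennreal_mult[symmetric])
  then have "\<pi>.prob {x} = 0" using r by (simp add: mult_cancel_right2 flip: mult.commute)
  then show ?thesis by (simp add: \<pi>.emeasure_eq_measure)
qed

text \<open>The kernel is not strong Feller at the atoms of \<open>V\<close>, but these form a countable set, which the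
  invariant law does not charge; so one step of smoothing upgrades weak to setwise convergence.\<close>

lemma trans_op_power_tendsto:
  assumes inv: "invariant_probability borel kern \<pi>"
    and f[measurable]: "f \<in> borel_measurable borel" and le: "\<And>y. f y \<le> 1"
  shows "(\<lambda>k. (trans_op kern ^^ k) f x) \<longlonglongrightarrow> (\<integral>\<^sup>+y. f y \<partial>\<pi>)"
proof -
  interpret \<pi>: real_distribution \<pi> by (rule real_distribution_invariant[OF inv])
  \<comment> \<open>\<open>r\<close> and the function \<open>h\<close> below are real-valued copies
    of \<open>f\<close> and of \<open>trans_op kern f\<close>; weak convergence concerns real
    integrands.\<close>
  define r where "r y = enn2real (f y)" for y
  have [measurable]: "r \<in> borel_measurable borel" unfolding r_def by measurable
  have r01: "0 \<le> r y" "\<bar>r y\<bar> \<le> 1" for y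
    using le[of y] by (auto simp: r_def enn2real_leI)
  have fr: "f y = ennreal (r y)" for y
    unfolding r_def using order_le_less_trans[OF le[of y] ennreal_one_less_top] by (simp add: ennreal_enn2real)
  define h where "h x = (\<integral>\<omega>. r (\<theta> \<omega> * V \<omega> + (1 - \<theta> \<omega>) * x) \<partial>\<Omega>)" for x
  have mh[measurable]: "h \<in> borel_measurable borel" unfolding h_def by measurable
  have ir: "integrable \<Omega> (\<lambda>\<omega>. r (\<theta> \<omega> * V \<omega> + (1 - \<theta> \<omega>) * x))" for x
    by (intro integrable_const_bound[where B = 1]) (use r01 in auto)
  have th: "trans_op kern f y = ennreal (h y)" for y
    unfolding trans_op_def kern_def h_def fr
    by (subst nn_integral_distr, simp, simp, subst nn_integral_eq_integral[OF ir]) (use r01 in auto)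
  have h01: "0 \<le> h y" "norm (h y) \<le> 1" for y
  proof -
    show 0: "0 \<le> h y" unfolding h_def by (rule integral_nonneg_AE) (use r01 in auto)
    have "h y \<le> (\<integral>\<omega>. 1 \<partial>\<Omega>)"
      unfolding h_def using r01(2) by (intro integral_mono ir) (auto intro: order_trans[OF abs_ge_self])
    then show "norm (h y) \<le> 1" using 0 prob_space by simp
  qed
  let ?N = "{x. measure (distr \<Omega> borel V) {x} \<noteq> 0}"
  have "countable ?N"
  proof -
    interpret V: prob_space "distr \<Omega> borel V" by (intro prob_space_distr) measurable
    show ?thesis by (rule V.countable_support)
  qed
  then have "emeasure \<pi> ?N = 0"
    using emeasure_invariant_singleton[OF inv] by (subst emeasure_countable_singleton) auto
  moreover have "?N \<in> sets \<pi>" using \<open>countable ?N\<close> by (auto intro: sets.countable)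
  moreover have "{x. \<not> isCont h x} \<subseteq> ?N"
    using isCont_kernel_integral[of r] r01 by (auto simp: h_def[abs_def])
  ultimately have "emeasure \<pi> {x. \<not> isCont h x} = 0" by (metis emeasure_mono le_zero_eq)
  then have lim: "(\<lambda>k. \<integral>y. h y \<partial>kern_power k x) \<longlonglongrightarrow> (\<integral>y. h y \<partial>\<pi>)"
    using weak_conv_imp_bdd_ae_continuous_conv[OF real_distribution_kern_power \<pi>.real_distribution_axioms
      weak_conv_kern_power[OF inv] _ h01(2) mh] by blast
  have nn: "(\<integral>\<^sup>+y. ennreal (h y) \<partial>\<mu>) = ennreal (\<integral>y. h y \<partial>\<mu>)" if "real_distribution \<mu>" for \<mu>
  proof -
    interpret \<mu>: real_distribution \<mu> by fact
    show ?thesis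
      by (intro nn_integral_eq_integral \<mu>.integrable_const_bound[where B = 1]) (use h01 in auto)
  qed
  \<comment> \<open>Weak convergence at time \<open>k\<close> is applied to one kernel step of
    \<open>f\<close>, which gives the expectation of \<open>f\<close> at time
    \<open>Suc k\<close>.\<close>
  have "(\<lambda>k. (trans_op kern ^^ k) (trans_op kern f) x) \<longlonglongrightarrow> (\<integral>\<^sup>+y. trans_op kern f y \<partial>\<pi>)"
    using lim nn real_distribution_kern_power \<pi>.real_distribution_axioms
    unfolding nn_integral_kern_power[OF measurable_trans_op[OF measurable_kern f], symmetric] th
    by (simp add: h01 tendsto_ennrealI)
  also have "(\<integral>\<^sup>+y. trans_op kern f y \<partial>\<pi>) = (\<integral>\<^sup>+y. f y \<partial>\<pi>)"
    by (rule nn_integral_trans_op_invariant[OF measurable_kern inv f])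
  finally have "(\<lambda>k. (trans_op kern ^^ Suc k) f x) \<longlonglongrightarrow> (\<integral>\<^sup>+y. f y \<partial>\<pi>)"
    by (simp add: funpow_swap1)
  then show ?thesis by (rule LIMSEQ_imp_Suc)
qed

theorem harris_ergodic_kern:
  assumes "invariant_probability borel kern \<pi>"
  shows "harris_ergodic borel kern"
  using assms by (intro harris_ergodic_if_convergent[OF measurable_kern] trans_op_power_tendsto) auto

end

section \<open>Gamma, Beta and Dirichlet laws\<close>

definition gamma_dens :: "real \<Rightarrow> real \<Rightarrow> real" where
  "gamma_dens b x = indicator {0<..} x * (x powr (b - 1) * exp (- x) / Gamma b)"

lemma measurable_gamma_dens[measurable]: "gamma_dens b \<in> borel_measurable borel"
  unfolding gamma_dens_def[abs_def] by measurable

lemma gamma_dens_nonneg: "0 < b \<Longrightarrow> 0 \<le> gamma_dens b x"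
  by (auto simp: gamma_dens_def Gamma_real_pos less_imp_le split: split_indicator)

lemma sets_gamma_measure[simp, measurable_cong]: "sets (gamma_measure b) = sets borel"
  by (simp add: gamma_measure_def)

lemma space_gamma_measure[simp]: "space (gamma_measure b) = UNIV"
  by (simp add: gamma_measure_def)

lemma gamma_measure_0: "gamma_measure 0 = return borel 0"
  by (simp add: gamma_measure_def)

lemma gamma_measure_pos: "0 < b \<Longrightarrow> gamma_measure b = density lborel (\<lambda>x. ennreal (gamma_dens b x))"
  by (simp add: gamma_measure_def gamma_dens_def)

lemma nn_integral_gamma_measure:
  assumes "0 < b" and [measurable]: "f \<in> borel_measurable borel"
  shows "(\<integral>\<^sup>+x. f x \<partial>gamma_measure b) = (\<integral>\<^sup>+x. ennreal (gamma_dens b x) * f x \<partial>lborel)"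
  unfolding gamma_measure_pos[OF assms(1)] by (subst nn_integral_density) auto

lemma prob_space_gamma_measure:
  assumes "0 \<le> b" shows "prob_space (gamma_measure b)"
proof (cases "b = 0")
  case True
  then show ?thesis by (simp add: gamma_measure_0 prob_space_return)
next
  case False
  then have b: "b > 0" using assms by simp
  have "emeasure (gamma_measure b) (space (gamma_measure b)) = (\<integral>\<^sup>+x. 1 \<partial>gamma_measure b)"
    by simp
  also have "\<dots> = (\<integral>\<^sup>+x. ennreal (gamma_dens b x) \<partial>lborel)"
    by (subst nn_integral_gamma_measure[OF b]) auto
  \<comment> \<open>The Gamma integral runs over \<open>{0..}\<close>, the density over
    \<open>{0<..}\<close>; they agree off the point 0.\<close>
  also have "\<dots> = (\<integral>\<^sup>+x. ennreal (1 / Gamma b) * ennreal (indicator {0..} x * (x powr (b - 1) / exp x)) \<partial>lborel)"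
    using AE_lborel_singleton[of "0::real"]
    by (intro nn_integral_cong_AE, eventually_elim)
       (auto simp: gamma_dens_def ennreal_mult[symmetric] Gamma_real_pos[OF b] less_imp_le exp_minus field_simps split: split_indicator)
  also have "\<dots> = ennreal (1 / Gamma b) * ennreal (Gamma b)"
    using nn_integral_has_integral_lebesgue[OF _ Gamma_integral_real[OF b]]
    by (subst nn_integral_cmult) auto
  also have "\<dots> = 1"
    using Gamma_real_pos[OF b] by (simp add: ennreal_mult[symmetric])
  finally show ?thesis by (rule prob_spaceI)
qed

lemma gamma_measure_AE_pos:
  assumes "0 < b" shows "AE x in gamma_measure b. 0 < x"
  unfolding gamma_measure_pos[OF assms]
  by (subst AE_density) (auto simp: gamma_dens_def split: split_indicator_asm)

lemma gamma_measure_AE_nonneg: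
  assumes "0 \<le> b" shows "AE x in gamma_measure b. 0 \<le> x"
proof (cases "b = 0")
  case True
  then show ?thesis unfolding True gamma_measure_0 by (subst AE_return) auto
next
  case False
  then show ?thesis using gamma_measure_AE_pos[of b] assms by (auto elim: eventually_mono)
qed

text \<open>The change of variable by the factor \<open>u\<close> is recorded as an exponential tilt
  of the same Gamma law. In this form it also covers the degenerate case \<open>b = 0\<close>,
  multiplies over coordinates, and contains the Laplace transform as the case
  \<open>f = 1\<close>.\<close>

lemma nn_integral_gamma_measure_scale:
  assumes b: "0 \<le> b" and u: "0 < u" and f[measurable]: "f \<in> borel_measurable borel"
  shows "(\<integral>\<^sup>+x. f x \<partial>gamma_measure b) =
    ennreal (u powr b) * (\<integral>\<^sup>+x. ennreal (exp (- ((u - 1) * x))) * f (u * x) \<partial>gamma_measure b)"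
proof (cases "b = 0")
  case True
  then show ?thesis using u by (simp add: gamma_measure_0 nn_integral_return)
next
  case False
  then have b: "b > 0" using b by simp
  have "(\<integral>\<^sup>+x. f x \<partial>gamma_measure b) = ennreal u * (\<integral>\<^sup>+x. ennreal (gamma_dens b (u * x)) * f (u * x) \<partial>lborel)"
    unfolding nn_integral_gamma_measure[OF b f]
    using u by (subst nn_integral_real_affine[where c = u and t = 0]) auto
  also have "\<dots> = (\<integral>\<^sup>+x. ennreal u * (ennreal (gamma_dens b (u * x)) * f (u * x)) \<partial>lborel)"
    by (rule nn_integral_cmult[symmetric]) measurable
  also have "\<dots> = (\<integral>\<^sup>+x. ennreal (u powr b) * (ennreal (gamma_dens b x) * (ennreal (exp (- ((u - 1) * x))) * f (u * x))) \<partial>lborel)"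
  proof (rule nn_integral_cong)
    fix x :: real
    have "u * gamma_dens b (u * x) = u powr b * (gamma_dens b x * exp (- ((u - 1) * x)))"
    proof (cases "x > 0")
      case True
      have "u * u powr (b - 1) = u powr b" using u by (simp add: powr_diff)
      moreover have "exp (- (u * x)) = exp (- x) * exp (- ((u - 1) * x))"
        by (simp add: exp_add[symmetric] algebra_simps)
      ultimately show ?thesis using True u by (simp add: gamma_dens_def powr_mult)
    next
      case False
      then show ?thesis using u by (simp add: gamma_dens_def zero_less_mult_iff)
    qed
    then have "ennreal u * ennreal (gamma_dens b (u * x)) =
      ennreal (u powr b) * (ennreal (gamma_dens b x) * ennreal (exp (- ((u - 1) * x))))"
      using u gamma_dens_nonneg[OF b] by (simp add: ennreal_mult[symmetric])
    then show "ennreal u * (ennreal (gamma_dens b (u * x)) * f (u * x)) =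
      ennreal (u powr b) * (ennreal (gamma_dens b x) * (ennreal (exp (- ((u - 1) * x))) * f (u * x)))"
      by (simp add: mult.assoc[symmetric])
  qed
  also have "\<dots> = ennreal (u powr b) * (\<integral>\<^sup>+x. ennreal (exp (- ((u - 1) * x))) * f (u * x) \<partial>gamma_measure b)"
    by (subst nn_integral_gamma_measure[OF b]) (auto intro!: nn_integral_cmult)
  finally show ?thesis .
qed

text \<open>Take \<open>u = 1 + s\<close> and \<open>f = 1\<close> in the scaling identity: the
  integral times \<open>(1 + s) powr b\<close> is the total mass 1.\<close>

lemma nn_integral_gamma_measure_Laplace:
  assumes b: "0 \<le> b" and s: "0 \<le> s"
  shows "(\<integral>\<^sup>+x. ennreal (exp (- (s * x))) \<partial>gamma_measure b) = ennreal ((1 + s) powr - b)"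
proof -
  interpret prob_space "gamma_measure b" by (rule prob_space_gamma_measure[OF b])
  let ?I = "\<integral>\<^sup>+x. ennreal (exp (- (s * x))) \<partial>gamma_measure b"
  have 1: "1 = ennreal ((1 + s) powr b) * ?I"
    using nn_integral_gamma_measure_scale[OF b, of "1 + s" "\<lambda>_. 1"] s emeasure_space_1 by simp
  have "ennreal ((1 + s) powr - b) = ennreal ((1 + s) powr - b) * (ennreal ((1 + s) powr b) * ?I)"
    using 1 by simp
  also have "\<dots> = ennreal ((1 + s) powr - b * (1 + s) powr b) * ?I"
    by (simp add: ennreal_mult mult.assoc)
  also have "(1 + s) powr - b * (1 + s) powr b = 1"
    using s by (simp add: powr_add[symmetric])
  finally show ?thesis by simp
qed

text \<open>Size biasing: \<open>x\<close> times the density with parameter \<open>b\<close> is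
  \<open>b\<close> times the density with parameter \<open>b + 1\<close>, because
  \<open>Gamma (b + 1) = b * Gamma b\<close>. For \<open>b = 0\<close> both sides are 0.\<close>

lemma nn_integral_gamma_measure_Suc:
  assumes b: "0 \<le> b" and f[measurable]: "f \<in> borel_measurable borel"
  shows "ennreal b * (\<integral>\<^sup>+x. f x \<partial>gamma_measure (b + 1)) = (\<integral>\<^sup>+x. ennreal x * f x \<partial>gamma_measure b)"
proof (cases "b = 0")
  case True
  then show ?thesis by (simp add: gamma_measure_0 nn_integral_return)
next
  case False
  then have b: "b > 0" using b by simp
  then have "b \<notin> \<int>\<^sub>\<le>\<^sub>0" using nonpos_Ints_nonpos[of b] by auto
  then have g: "Gamma (b + 1) = b * Gamma b" by (rule Gamma_plus1)
  have "ennreal b * (\<integral>\<^sup>+x. f x \<partial>gamma_measure (b + 1)) = (\<integral>\<^sup>+x. ennreal b * (ennreal (gamma_dens (b + 1) x) * f x) \<partial>lborel)"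
    using b by (subst nn_integral_gamma_measure) (auto simp: nn_integral_cmult)
  also have "\<dots> = (\<integral>\<^sup>+x. ennreal (gamma_dens b x) * (ennreal x * f x) \<partial>lborel)"
  proof (rule nn_integral_cong)
    fix x :: real
    have "b * gamma_dens (b + 1) x = gamma_dens b x * x"
      unfolding gamma_dens_def g using b powr_mult_base[of x "b - 1"]
      by (auto simp: field_simps split: split_indicator)
    then have "ennreal b * ennreal (gamma_dens (b + 1) x) = ennreal (gamma_dens b x) * ennreal x"
      using b gamma_dens_nonneg[of b x] gamma_dens_nonneg[of "b + 1" x]
      by (cases "x > 0") (auto simp: ennreal_mult[symmetric] gamma_dens_def)
    then show "ennreal b * (ennreal (gamma_dens (b + 1) x) * f x) = ennreal (gamma_dens b x) * (ennreal x * f x)"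
      by (simp add: mult.assoc[symmetric])
  qed
  also have "\<dots> = (\<integral>\<^sup>+x. ennreal x * f x \<partial>gamma_measure b)"
    by (subst nn_integral_gamma_measure[OF b]) auto
  finally show ?thesis .
qed

lemma nn_integral_gamma_measure_ident:
  assumes "0 \<le> b" shows "(\<integral>\<^sup>+x. ennreal x \<partial>gamma_measure b) = ennreal b"
  using nn_integral_gamma_measure_Suc[OF assms, of "\<lambda>_. 1"]
    prob_space.emeasure_space_1[OF prob_space_gamma_measure[of "b + 1"]] assms by simp

lemma sets_beta_measure[simp, measurable_cong]: "sets (beta_measure b c) = sets borel"
  by (simp add: beta_measure_def)

lemma space_beta_measure[simp]: "space (beta_measure b c) = UNIV"
  by (simp add: beta_measure_def)

definition beta_dens :: "real \<Rightarrow> real \<Rightarrow> real \<Rightarrow> real" where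
  "beta_dens b c x = indicator {0<..<1} x * (x powr (b - 1) * (1 - x) powr (c - 1) / Beta b c)"

lemma measurable_beta_dens[measurable]: "beta_dens b c \<in> borel_measurable borel"
  unfolding beta_dens_def[abs_def] by measurable

lemma beta_measure_eq: "beta_measure b c = density lborel (\<lambda>x. ennreal (beta_dens b c x))"
  by (simp add: beta_measure_def beta_dens_def)

lemma Beta_real_pos: "0 < b \<Longrightarrow> 0 < c \<Longrightarrow> 0 < Beta b (c :: real)"
  by (simp add: Beta_def Gamma_real_pos)

lemma beta_dens_nonneg: "0 < b \<Longrightarrow> 0 < c \<Longrightarrow> 0 \<le> beta_dens b c x"
  by (auto simp: beta_dens_def Beta_real_pos less_imp_le split: split_indicator)

lemma beta_measure_AE: "AE x in beta_measure b c. 0 < x \<and> x < 1"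
  unfolding beta_measure_eq by (subst AE_density) (auto simp: beta_dens_def split: split_indicator_asm)

text \<open>The classical independence of a Gamma total and a Beta fraction. Two one-dimensional
  substitutions with Fubini between them replace the planar change of variables.\<close>

lemma nn_integral_beta_gamma:
  assumes b: "0 < b" and c: "0 < c"
    and F: "case_prod F \<in> borel_measurable (borel \<Otimes>\<^sub>M borel)"
  shows "(\<integral>\<^sup>+s. (\<integral>\<^sup>+t. F (s * t) (s * (1 - t)) \<partial>beta_measure b c) \<partial>gamma_measure (b + c)) =
    (\<integral>\<^sup>+x. (\<integral>\<^sup>+y. F x y \<partial>gamma_measure c) \<partial>gamma_measure b)"
proof -
  have [measurable]: "(\<lambda>z. F (f z) (g z)) \<in> borel_measurable M"
    if [measurable]: "f \<in> borel_measurable M" "g \<in> borel_measurable M" for f g and M :: "'z measure"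
    using measurable_compose[OF _ F, of "\<lambda>z. (f z, g z)" M] by simp
  have [measurable]: "(\<lambda>z. F (f z) (g z)) \<in> borel_measurable M"
    if [measurable]: "f \<in> borel_measurable M" "g \<in> borel_measurable M" for f g and M :: "(real \<times> real) measure"
    using measurable_compose[OF _ F, of "\<lambda>z. (f z, g z)" M] by simp
  have [measurable]: "(\<lambda>z. F (f z) (g z)) \<in> borel_measurable M"
    if [measurable]: "f \<in> borel_measurable M" "g \<in> borel_measurable M" for f g and M :: "real measure"
    using measurable_compose[OF _ F, of "\<lambda>z. (f z, g z)" M] by simp
  have bc: "0 < b + c" using b c by simp
  define d where "d x y = gamma_dens b x * gamma_dens c y" for x y
  have d0: "0 \<le> d x y" for x y unfolding d_def using gamma_dens_nonneg b c by simp
  have [measurable]: "(\<lambda>z. d (f z) (g z)) \<in> borel_measurable M"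
    if [measurable]: "f \<in> borel_measurable M" "g \<in> borel_measurable M" for f g and M :: "(real \<times> real) measure"
    unfolding d_def by measurable
  have [measurable]: "(\<lambda>z. d (f z) (g z)) \<in> borel_measurable M"
    if [measurable]: "f \<in> borel_measurable M" "g \<in> borel_measurable M" for f g and M :: "real measure"
    unfolding d_def by measurable
  have "(\<integral>\<^sup>+s. (\<integral>\<^sup>+t. F (s * t) (s * (1 - t)) \<partial>beta_measure b c) \<partial>gamma_measure (b + c)) =
      (\<integral>\<^sup>+s. ennreal (gamma_dens (b + c) s) *
        (\<integral>\<^sup>+t. ennreal (beta_dens b c t) * F (s * t) (s * (1 - t)) \<partial>lborel) \<partial>lborel)"
    unfolding beta_measure_eq by (simp add: nn_integral_gamma_measure[OF bc] nn_integral_density)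
  \<comment> \<open>For a fixed total \<open>s > 0\<close>, put \<open>x = s * t\<close>; the other
    coordinate is then \<open>s - x\<close>. Outside \<open>0 < x < s\<close> the product density
    \<open>d\<close> vanishes, so both integrals may run over the whole line.\<close>
  also have "\<dots> = (\<integral>\<^sup>+s. (\<integral>\<^sup>+x. ennreal (d x (s - x)) * F x (s - x) \<partial>lborel) \<partial>lborel)"
  proof (rule nn_integral_cong)
    fix s :: real
    show "ennreal (gamma_dens (b + c) s) * (\<integral>\<^sup>+t. ennreal (beta_dens b c t) * F (s * t) (s * (1 - t)) \<partial>lborel) =
      (\<integral>\<^sup>+x. ennreal (d x (s - x)) * F x (s - x) \<partial>lborel)"
    proof (cases "s > 0")
      case False
      then have "d x (s - x) = 0" for x by (auto simp: d_def gamma_dens_def split: split_indicator)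
      then show ?thesis using False by (simp add: gamma_dens_def)
    next
      case s: True
      have "(\<integral>\<^sup>+x. ennreal (d x (s - x)) * F x (s - x) \<partial>lborel) =
          ennreal s * (\<integral>\<^sup>+t. ennreal (d (s * t) (s - s * t)) * F (s * t) (s - s * t) \<partial>lborel)"
        using s by (subst nn_integral_real_affine[where c = s and t = 0]) auto
      also have "\<dots> = (\<integral>\<^sup>+t. ennreal s * (ennreal (d (s * t) (s - s * t)) * F (s * t) (s - s * t)) \<partial>lborel)"
        by (rule nn_integral_cmult[symmetric]) measurable
      also have "\<dots> = (\<integral>\<^sup>+t. ennreal (gamma_dens (b + c) s) * (ennreal (beta_dens b c t) * F (s * t) (s * (1 - t))) \<partial>lborel)"
      proof (rule nn_integral_cong)
        fix t :: real
        have "s * d (s * t) (s - s * t) = gamma_dens (b + c) s * beta_dens b c t"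
        proof (cases "0 < t \<and> t < 1")
          case True
          have e: "s - s * t = s * (1 - t)" by (simp add: algebra_simps)
          have p: "s * s powr (b - 1) * s powr (c - 1) = s powr (b + c - 1)"
            using s by (simp add: powr_diff powr_add)
          have ex: "exp (- (s * t)) * exp (- (s * (1 - t))) = exp (- s)"
            by (simp add: exp_add[symmetric] algebra_simps)
          have "s * d (s * t) (s - s * t) =
              (s * s powr (b - 1) * s powr (c - 1)) * (t powr (b - 1) * (1 - t) powr (c - 1)) *
              (exp (- (s * t)) * exp (- (s * (1 - t)))) / (Gamma b * Gamma c)"
            unfolding e d_def gamma_dens_def using True s by (simp add: powr_mult ac_simps)
          also have "\<dots> = gamma_dens (b + c) s * beta_dens b c t"
            unfolding p ex gamma_dens_def beta_dens_def Beta_def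
            using True s Gamma_real_pos[OF bc] by simp
          finally show ?thesis .
        next
          case False
          have "s * t > 0 \<Longrightarrow> s - s * t > 0 \<Longrightarrow> False"
            using False s by (simp add: zero_less_mult_iff)
          then have "d (s * t) (s - s * t) = 0"
            by (auto simp: d_def gamma_dens_def split: split_indicator)
          then show ?thesis using False by (auto simp: beta_dens_def)
        qed
        then have "ennreal s * ennreal (d (s * t) (s - s * t)) = ennreal (gamma_dens (b + c) s) * ennreal (beta_dens b c t)"
          using s d0 gamma_dens_nonneg[OF bc] beta_dens_nonneg[OF b c] by (simp add: ennreal_mult[symmetric])
        moreover have "s - s * t = s * (1 - t)" by (simp add: algebra_simps)
        ultimately show "ennreal s * (ennreal (d (s * t) (s - s * t)) * F (s * t) (s - s * t)) =
            ennreal (gamma_dens (b + c) s) * (ennreal (beta_dens b c t) * F (s * t) (s * (1 - t)))"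
          by (simp add: mult.assoc[symmetric])
      qed
      also have "\<dots> = ennreal (gamma_dens (b + c) s) * (\<integral>\<^sup>+t. ennreal (beta_dens b c t) * F (s * t) (s * (1 - t)) \<partial>lborel)"
        by (rule nn_integral_cmult) measurable
      finally show ?thesis by simp
    qed
  qed
  \<comment> \<open>Fubini makes \<open>x\<close> the outer variable, after which the shift
    \<open>y = s - x\<close> separates the coordinates.\<close>
  also have "\<dots> = (\<integral>\<^sup>+x. (\<integral>\<^sup>+s. ennreal (d x (s - x)) * F x (s - x) \<partial>lborel) \<partial>lborel)"
    by (rule lborel_pair.Fubini') measurable
  also have "\<dots> = (\<integral>\<^sup>+x. (\<integral>\<^sup>+y. ennreal (d x y) * F x y \<partial>lborel) \<partial>lborel)"
  proof (rule nn_integral_cong)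
    fix x
    show "(\<integral>\<^sup>+s. ennreal (d x (s - x)) * F x (s - x) \<partial>lborel) = (\<integral>\<^sup>+y. ennreal (d x y) * F x y \<partial>lborel)"
      by (subst nn_integral_real_affine[where c = 1 and t = x]) auto
  qed
  also have "\<dots> = (\<integral>\<^sup>+x. (\<integral>\<^sup>+y. ennreal (gamma_dens b x) * (ennreal (gamma_dens c y) * F x y) \<partial>lborel) \<partial>lborel)"
    by (simp add: d_def ennreal_mult gamma_dens_nonneg b c mult.assoc)
  also have "\<dots> = (\<integral>\<^sup>+x. (\<integral>\<^sup>+y. F x y \<partial>gamma_measure c) \<partial>gamma_measure b)"
    by (simp add: nn_integral_gamma_measure b c nn_integral_cmult)
  finally show ?thesis .
qed

text \<open>The total mass is read off from \<open>nn_integral_beta_gamma\<close> with a constant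
  integrand, where the three Gamma laws are already known to be probabilities.\<close>

lemma prob_space_beta_measure:
  assumes "0 < b" "0 < c" shows "prob_space (beta_measure b c)"
proof
  interpret g: prob_space "gamma_measure (b + c)" using assms by (intro prob_space_gamma_measure) auto
  interpret b: prob_space "gamma_measure b" using assms by (intro prob_space_gamma_measure) auto
  interpret c: prob_space "gamma_measure c" using assms by (intro prob_space_gamma_measure) auto
  show "emeasure (beta_measure b c) (space (beta_measure b c)) = 1"
    using nn_integral_beta_gamma[OF assms, of "\<lambda>_ _. 1"]
      g.emeasure_space_1 b.emeasure_space_1 c.emeasure_space_1 by simp
qed

text \<open>In the Beta-Gamma identity with integrand \<open>f (x + y)\<close> the Beta variable
  drops out, as \<open>s * t + s * (1 - t) = s\<close>.\<close>

lemma nn_integral_gamma_add_exponential: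
  assumes b: "0 \<le> b" and f[measurable]: "f \<in> borel_measurable borel"
  shows "(\<integral>\<^sup>+x. (\<integral>\<^sup>+y. f (x + y) \<partial>gamma_measure 1) \<partial>gamma_measure b) = (\<integral>\<^sup>+x. f x \<partial>gamma_measure (b + 1))"
proof (cases "b = 0")
  case True
  interpret g: prob_space "gamma_measure 1" by (simp add: prob_space_gamma_measure)
  have "(\<lambda>x. \<integral>\<^sup>+y. f (x + y) \<partial>gamma_measure 1) \<in> borel_measurable borel"
    by (rule g.borel_measurable_nn_integral) measurable
  then show ?thesis using True by (simp add: gamma_measure_0 nn_integral_return)
next
  case False
  then have b: "b > 0" using b by simp
  interpret beta: prob_space "beta_measure b 1" by (rule prob_space_beta_measure) (use b in auto)
  have e: "s * t + s * (1 - t) = s" for s t :: real by (simp add: algebra_simps)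
  show ?thesis
    using nn_integral_beta_gamma[OF b, of 1 "\<lambda>x y. f (x + y)"] beta.emeasure_space_1
    unfolding e by simp
qed

section \<open>Independent Gamma vectors and Dirichlet vectors\<close>

definition gamma_prod :: "'i set \<Rightarrow> ('i \<Rightarrow> real) \<Rightarrow> ('i \<Rightarrow> real) measure" where
  "gamma_prod I b = PiM I (\<lambda>i. gamma_measure (b i))"

lemma sets_gamma_prod[simp, measurable_cong]: "sets (gamma_prod I b) = sets (PiM I (\<lambda>_. borel))"
  unfolding gamma_prod_def by (intro sets_PiM_cong) auto

lemma space_gamma_prod[simp]: "space (gamma_prod I b) = extensional I"
  unfolding gamma_prod_def by (simp add: space_PiM PiE_def)

lemma gamma_prod_cong: "(\<And>i. i \<in> I \<Longrightarrow> b i = c i) \<Longrightarrow> gamma_prod I b = gamma_prod I c"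
  unfolding gamma_prod_def by (intro PiM_cong) auto

lemma dirichlet_measure_eq:
  "dirichlet_measure I b = distr (gamma_prod I b) (PiM I (\<lambda>_. borel)) (\<lambda>z. \<lambda>i\<in>I. z i / (\<Sum>j\<in>I. z j))"
  unfolding dirichlet_measure_def gamma_prod_def ..

lemma sets_dirichlet_measure[simp, measurable_cong]: "sets (dirichlet_measure I b) = sets (PiM I (\<lambda>_. borel))"
  by (simp add: dirichlet_measure_def)

lemma space_dirichlet_measure[simp]: "space (dirichlet_measure I b) = extensional I"
  by (simp add: dirichlet_measure_def space_PiM PiE_def)

lemma nn_integral_dirichlet_measure:
  assumes [measurable]: "F \<in> borel_measurable (PiM I (\<lambda>_. borel))"
  shows "(\<integral>\<^sup>+p. F p \<partial>dirichlet_measure I b) = (\<integral>\<^sup>+z. F (\<lambda>i\<in>I. z i / (\<Sum>j\<in>I. z j)) \<partial>gamma_prod I b)"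
  unfolding dirichlet_measure_eq by (rule nn_integral_distr) measurable

text \<open>Nonnegativity is required at every index, also off \<open>I\<close>, because
  \<open>product_prob_space\<close> asks every factor of the family to be a probability
  measure.\<close>

locale gamma_weights =
  fixes I :: "'i set" and b :: "'i \<Rightarrow> real"
  assumes finite_I: "finite I" and b_nonneg: "\<And>i. 0 \<le> b i"
begin

sublocale product_prob_space "\<lambda>i. gamma_measure (b i)"
  using b_nonneg prob_space_gamma_measure
  by (simp add: product_prob_space_def product_sigma_finite_def product_prob_space_axioms_def prob_space_imp_sigma_finite)

lemma prob_space_gamma_prod: "prob_space (gamma_prod I b)"
  unfolding gamma_prod_def by (intro prob_space_PiM prob_space_gamma_measure b_nonneg)

lemma prob_space_dirichlet: "prob_space (dirichlet_measure I b)"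
  unfolding dirichlet_measure_eq by (intro prob_space.prob_space_distr prob_space_gamma_prod) measurable

lemma AE_gamma_prod_nonneg: "AE z in gamma_prod I b. \<forall>i\<in>I. 0 \<le> z i"
  unfolding gamma_prod_def
  by (intro AE_finite_allI finite_I AE_PiM_component prob_space_gamma_measure b_nonneg gamma_measure_AE_nonneg)

lemma AE_gamma_prod_sum_pos:
  assumes "0 < (\<Sum>i\<in>I. b i)" shows "AE z in gamma_prod I b. 0 < (\<Sum>i\<in>I. z i)"
proof -
  obtain i where i: "i \<in> I" "0 < b i"
    using assms sum_nonpos[of I b] by (meson not_le)
  have "AE z in gamma_prod I b. 0 < z i"
    unfolding gamma_prod_def using i
    by (intro AE_PiM_component prob_space_gamma_measure b_nonneg gamma_measure_AE_pos)
  then show ?thesis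
    using AE_gamma_prod_nonneg
    by eventually_elim (use i finite_I in \<open>auto intro: sum_pos2\<close>)
qed

lemma nn_integral_gamma_prod_Laplace:
  assumes s: "\<And>i. i \<in> I \<Longrightarrow> 0 \<le> s i"
  shows "(\<integral>\<^sup>+z. ennreal (exp (- (\<Sum>i\<in>I. s i * z i))) \<partial>gamma_prod I b) = ennreal (exp (- (\<Sum>i\<in>I. b i * ln (1 + s i))))"
proof -
  have "(\<integral>\<^sup>+z. ennreal (exp (- (\<Sum>i\<in>I. s i * z i))) \<partial>gamma_prod I b) =
      (\<integral>\<^sup>+z. (\<Prod>i\<in>I. ennreal (exp (- (s i * z i)))) \<partial>gamma_prod I b)"
    by (simp add: exp_sum[OF finite_I] prod_ennreal flip: sum_negf)
  also have "\<dots> = (\<Prod>i\<in>I. \<integral>\<^sup>+x. ennreal (exp (- (s i * x))) \<partial>gamma_measure (b i))"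
    unfolding gamma_prod_def by (rule product_nn_integral_prod[OF finite_I]) measurable
  also have "\<dots> = (\<Prod>i\<in>I. ennreal (exp (- (b i * ln (1 + s i)))))"
  proof (rule prod.cong[OF refl])
    fix i assume "i \<in> I"
    then have "0 \<le> s i" by (rule s)
    then show "(\<integral>\<^sup>+x. ennreal (exp (- (s i * x))) \<partial>gamma_measure (b i)) = ennreal (exp (- (b i * ln (1 + s i))))"
      by (simp add: nn_integral_gamma_measure_Laplace[OF b_nonneg] powr_def)
  qed
  also have "\<dots> = ennreal (exp (- (\<Sum>i\<in>I. b i * ln (1 + s i))))"
    by (simp add: exp_sum[OF finite_I] prod_ennreal flip: sum_negf)
  finally show ?thesis .
qed

end

lemma nn_integral_gamma_prod_insert:
  assumes "finite I" "i \<notin> I" and b: "\<And>i. 0 \<le> b i"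
    and [measurable]: "f \<in> borel_measurable (PiM (insert i I) (\<lambda>_. borel))"
  shows "(\<integral>\<^sup>+x. f x \<partial>gamma_prod (insert i I) b) = (\<integral>\<^sup>+x. (\<integral>\<^sup>+y. f (x(i := y)) \<partial>gamma_measure (b i)) \<partial>gamma_prod I b)"
proof -
  interpret gamma_weights "insert i I" b by unfold_locales (use assms in auto)
  have "f \<in> borel_measurable (PiM (insert i I) (\<lambda>i. gamma_measure (b i)))"
    using assms(4) sets_gamma_prod[of "insert i I" b] unfolding gamma_prod_def
    by (simp cong: measurable_cong_sets)
  from product_nn_integral_insert[OF assms(1,2) this] show ?thesis
    unfolding gamma_prod_def .
qed

text \<open>Coordinates are rescaled one at a time. The powers of \<open>u\<close> and the tilts
  multiply, and the total tilt depends on \<open>z\<close> only through its sum, which is what makes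
  the sum a workable radial variable below.\<close>

lemma nn_integral_gamma_prod_scale:
  assumes "finite I" and b: "\<And>i. 0 \<le> b i" and u: "0 < u"
    and "F \<in> borel_measurable (PiM I (\<lambda>_. borel))"
  shows "(\<integral>\<^sup>+z. F z \<partial>gamma_prod I b) = ennreal (u powr (\<Sum>i\<in>I. b i)) *
    (\<integral>\<^sup>+z. ennreal (exp (- ((u - 1) * (\<Sum>i\<in>I. z i)))) * F (\<lambda>i\<in>I. u * z i) \<partial>gamma_prod I b)"
  using assms(1,4)
proof (induction I arbitrary: F)
  case empty
  interpret gamma_weights "{} :: 'a set" b by unfold_locales (use b in auto)
  show ?case using u using prob_space.emeasure_space_1[OF prob_space_gamma_prod] by (simp add: gamma_prod_def nn_integral_empty restrict_def)
next
  case (insert i I)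
  note [measurable] = insert.prems
  interpret g: prob_space "gamma_measure (b i)" by (rule prob_space_gamma_measure[OF b])
  let ?e = "\<lambda>y :: real. ennreal (exp (- ((u - 1) * y)))"
  have upd: "(\<lambda>j\<in>I. u * x j)(i := u * y) = (\<lambda>j\<in>insert i I. u * (x(i := y)) j)" for x :: "'a \<Rightarrow> real" and y
    using insert.hyps by (auto simp: fun_eq_iff restrict_def)
  have sm: "(\<Sum>j\<in>insert i I. (x(i := y)) j) = y + (\<Sum>j\<in>I. x j)" for x :: "'a \<Rightarrow> real" and y
    using insert.hyps by (simp, intro sum.cong) auto
  define G where "G x = (\<integral>\<^sup>+y. ?e y * F (x(i := u * y)) \<partial>gamma_measure (b i))" for x
  have G[measurable]: "G \<in> borel_measurable (PiM I (\<lambda>_. borel))"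
    unfolding G_def[abs_def] by measurable
  have "(\<integral>\<^sup>+z. F z \<partial>gamma_prod (insert i I) b) = (\<integral>\<^sup>+x. (\<integral>\<^sup>+y. F (x(i := y)) \<partial>gamma_measure (b i)) \<partial>gamma_prod I b)"
    by (rule nn_integral_gamma_prod_insert[OF insert.hyps b insert.prems])
  also have "\<dots> = (\<integral>\<^sup>+x. ennreal (u powr b i) * G x \<partial>gamma_prod I b)"
    unfolding G_def
    by (intro nn_integral_cong nn_integral_gamma_measure_scale[OF b u])
       (simp add: space_PiM PiE_def, measurable)
  also have "\<dots> = ennreal (u powr b i) * (\<integral>\<^sup>+x. G x \<partial>gamma_prod I b)"
    by (rule nn_integral_cmult) measurable
  also have "\<dots> = ennreal (u powr b i) * (ennreal (u powr (\<Sum>i\<in>I. b i)) *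
      (\<integral>\<^sup>+z. ?e (\<Sum>i\<in>I. z i) * G (\<lambda>i\<in>I. u * z i) \<partial>gamma_prod I b))"
    by (subst insert.IH[OF G]) simp
  also have "\<dots> = ennreal (u powr (\<Sum>i\<in>insert i I. b i)) *
      (\<integral>\<^sup>+z. ?e (\<Sum>i\<in>I. z i) * G (\<lambda>i\<in>I. u * z i) \<partial>gamma_prod I b)"
    using insert.hyps by (simp add: powr_add ennreal_mult mult.assoc)
  also have "(\<integral>\<^sup>+z. ?e (\<Sum>i\<in>I. z i) * G (\<lambda>i\<in>I. u * z i) \<partial>gamma_prod I b) =
      (\<integral>\<^sup>+x. (\<integral>\<^sup>+y. ?e (\<Sum>j\<in>insert i I. (x(i := y)) j) * F (\<lambda>j\<in>insert i I. u * (x(i := y)) j) \<partial>gamma_measure (b i)) \<partial>gamma_prod I b)"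
  proof (rule nn_integral_cong)
    fix x assume x: "x \<in> space (gamma_prod I b)"
    then have x'[measurable]: "x \<in> space (PiM I (\<lambda>_. borel))" by (simp add: space_PiM PiE_def)
    have "?e (\<Sum>j\<in>I. x j) * G (\<lambda>j\<in>I. u * x j) =
        (\<integral>\<^sup>+y. ?e (\<Sum>j\<in>I. x j) * (?e y * F ((\<lambda>j\<in>I. u * x j)(i := u * y))) \<partial>gamma_measure (b i))"
      unfolding G_def by (rule nn_integral_cmult[symmetric]) (simp add: space_PiM PiE_def, measurable)
    also have "\<dots> = (\<integral>\<^sup>+y. ?e (\<Sum>j\<in>insert i I. (x(i := y)) j) * F (\<lambda>j\<in>insert i I. u * (x(i := y)) j) \<partial>gamma_measure (b i))"
      unfolding sm upd
      by (intro nn_integral_cong)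
         (simp add: mult.assoc[symmetric] ennreal_mult[symmetric] exp_add[symmetric] algebra_simps del: restrict_apply)
    finally show "?e (\<Sum>j\<in>I. x j) * G (\<lambda>j\<in>I. u * x j) = \<dots>" .
  qed
  also have "\<dots> = (\<integral>\<^sup>+z. ?e (\<Sum>j\<in>insert i I. z j) * F (\<lambda>j\<in>insert i I. u * z j) \<partial>gamma_prod (insert i I) b)"
    by (rule nn_integral_gamma_prod_insert[OF insert.hyps b, symmetric]) measurable
  finally show ?case .
qed

context gamma_weights
begin

text \<open>Substituting \<open>s = u \<Sum>z\<close> and rescaling \<open>z\<close> by \<open>u\<close> decouples the integral over \<open>u\<close>, whose value
  then follows from the case \<open>F = 1\<close>.\<close>

lemma nn_integral_gamma_times_dirichlet:
  assumes a: "a = (\<Sum>i\<in>I. b i)" "0 < a"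
    and F[measurable]: "F \<in> borel_measurable (PiM I (\<lambda>_. borel))"
  shows "(\<integral>\<^sup>+s. (\<integral>\<^sup>+p. F (\<lambda>i\<in>I. s * p i) \<partial>dirichlet_measure I b) \<partial>gamma_measure a) = (\<integral>\<^sup>+z. F z \<partial>gamma_prod I b)"
proof -
  let ?S = "\<lambda>z. \<Sum>i\<in>I. z i :: real"
  \<comment> \<open>The integrand is the density of \<open>1 / s\<close> for a Gamma variable
    \<open>s\<close> with parameter \<open>a\<close>, so the value must be 1; it is obtained at the
    end by comparing total masses.\<close>
  define \<kappa> where "\<kappa> = (\<integral>\<^sup>+u. ennreal (indicator {0<..} u * (u powr (- a - 1) * exp (- (1 / u)) / Gamma a)) \<partial>lborel)"
  interpret ga: prob_space "gamma_measure a" using a by (intro prob_space_gamma_measure) auto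
  interpret gp: prob_space "gamma_prod I b" by (rule prob_space_gamma_prod)
  interpret dir: prob_space "dirichlet_measure I b" by (rule prob_space_dirichlet)
  interpret P1: pair_sigma_finite "gamma_measure a" "gamma_prod I b" by unfold_locales
  interpret P2: pair_sigma_finite lborel "gamma_prod I b" by unfold_locales
  note Spos = AE_gamma_prod_sum_pos[of, folded a(1), OF a(2)]
  have Ga: "0 < Gamma a" using a by (simp add: Gamma_real_pos)
  have main: "(\<integral>\<^sup>+s. (\<integral>\<^sup>+p. F (\<lambda>i\<in>I. s * p i) \<partial>dirichlet_measure I b) \<partial>gamma_measure a) = \<kappa> * (\<integral>\<^sup>+z. F z \<partial>gamma_prod I b)"
    if F[measurable]: "F \<in> borel_measurable (PiM I (\<lambda>_. borel))" for F
  proof -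
    have r: "(\<lambda>i\<in>I. s * (\<lambda>i\<in>I. f i) i) = (\<lambda>i\<in>I. s * f i)" for s :: real and f by (auto simp: fun_eq_iff)
    have "(\<integral>\<^sup>+s. (\<integral>\<^sup>+p. F (\<lambda>i\<in>I. s * p i) \<partial>dirichlet_measure I b) \<partial>gamma_measure a) =
        (\<integral>\<^sup>+s. (\<integral>\<^sup>+z. F (\<lambda>i\<in>I. s * (z i / ?S z)) \<partial>gamma_prod I b) \<partial>gamma_measure a)"
      by (subst nn_integral_dirichlet_measure) (simp_all add: r del: restrict_apply)
    also have "\<dots> = (\<integral>\<^sup>+z. (\<integral>\<^sup>+s. F (\<lambda>i\<in>I. s * (z i / ?S z)) \<partial>gamma_measure a) \<partial>gamma_prod I b)"
      by (rule P1.Fubini'[symmetric]) measurable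
    also have "\<dots> = (\<integral>\<^sup>+z. (\<integral>\<^sup>+u. ennreal (?S z * gamma_dens a (u * ?S z)) * F (\<lambda>i\<in>I. u * z i) \<partial>lborel) \<partial>gamma_prod I b)"
    proof (rule nn_integral_cong_AE)
      show "AE z in gamma_prod I b. (\<integral>\<^sup>+s. F (\<lambda>i\<in>I. s * (z i / ?S z)) \<partial>gamma_measure a) =
          (\<integral>\<^sup>+u. ennreal (?S z * gamma_dens a (u * ?S z)) * F (\<lambda>i\<in>I. u * z i) \<partial>lborel)"
        using Spos
      proof eventually_elim
        case (elim z)
        have "(\<integral>\<^sup>+s. F (\<lambda>i\<in>I. s * (z i / ?S z)) \<partial>gamma_measure a) =
            (\<integral>\<^sup>+s. ennreal (gamma_dens a s) * F (\<lambda>i\<in>I. s * (z i / ?S z)) \<partial>lborel)"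
          by (rule nn_integral_gamma_measure[OF a(2)]) measurable
        also have "\<dots> = ennreal (?S z) * (\<integral>\<^sup>+u. ennreal (gamma_dens a (?S z * u)) * F (\<lambda>i\<in>I. (?S z * u) * (z i / ?S z)) \<partial>lborel)"
          using elim by (subst nn_integral_real_affine[where c = "?S z" and t = 0]) auto
        also have "\<dots> = (\<integral>\<^sup>+u. ennreal (?S z) * (ennreal (gamma_dens a (?S z * u)) * F (\<lambda>i\<in>I. (?S z * u) * (z i / ?S z))) \<partial>lborel)"
          by (rule nn_integral_cmult[symmetric]) measurable
        also have "\<dots> = (\<integral>\<^sup>+u. ennreal (?S z * gamma_dens a (u * ?S z)) * F (\<lambda>i\<in>I. u * z i) \<partial>lborel)"
          using elim gamma_dens_nonneg[OF a(2)]
          by (intro nn_integral_cong) (simp add: ennreal_mult mult.assoc mult.commute[of _ "?S z"] cong: restrict_cong)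
        finally show ?case .
      qed
    qed
    also have "\<dots> = (\<integral>\<^sup>+u. (\<integral>\<^sup>+z. ennreal (?S z * gamma_dens a (u * ?S z)) * F (\<lambda>i\<in>I. u * z i) \<partial>gamma_prod I b) \<partial>lborel)"
      by (rule P2.Fubini') measurable
    \<comment> \<open>For \<open>u > 0\<close>, \<open>nn_integral_gamma_prod_scale\<close> is
      applied to the right-hand integrand: it produces the factor \<open>u powr a\<close> and the
      tilt that turn it into the left-hand one. Afterwards \<open>F\<close> is evaluated at
      \<open>z\<close>, free of \<open>u\<close>.\<close>
    also have "\<dots> = (\<integral>\<^sup>+u. (\<integral>\<^sup>+z. ennreal (indicator {0<..} u * (?S z powr a * u powr (- a - 1) * exp (- (?S z / u)) / Gamma a)) * F z \<partial>gamma_prod I b) \<partial>lborel)"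
    proof (rule nn_integral_cong)
      fix u :: real
      show "(\<integral>\<^sup>+z. ennreal (?S z * gamma_dens a (u * ?S z)) * F (\<lambda>i\<in>I. u * z i) \<partial>gamma_prod I b) =
        (\<integral>\<^sup>+z. ennreal (indicator {0<..} u * (?S z powr a * u powr (- a - 1) * exp (- (?S z / u)) / Gamma a)) * F z \<partial>gamma_prod I b)"
      proof (cases "u > 0")
        case False
        have "AE z in gamma_prod I b. ennreal (?S z * gamma_dens a (u * ?S z)) = 0"
          using Spos by eventually_elim (use False in \<open>auto simp: gamma_dens_def zero_less_mult_iff\<close>)
        then have "(\<integral>\<^sup>+z. ennreal (?S z * gamma_dens a (u * ?S z)) * F (\<lambda>i\<in>I. u * z i) \<partial>gamma_prod I b) = (\<integral>\<^sup>+z. 0 \<partial>gamma_prod I b)"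
          by (intro nn_integral_cong_AE) (auto elim: eventually_mono)
        then show ?thesis using False by simp
      next
        case u: True
        have Su: "?S (\<lambda>i\<in>I. u * z i) = u * ?S z" for z by (simp add: sum_distrib_left)
        have "(\<integral>\<^sup>+z. ennreal (?S z powr a * u powr (- a - 1) * exp (- (?S z / u)) / Gamma a) * F z \<partial>gamma_prod I b) =
          ennreal (u powr a) * (\<integral>\<^sup>+z. ennreal (exp (- ((u - 1) * ?S z))) *
            (ennreal ((u * ?S z) powr a * u powr (- a - 1) * exp (- (u * ?S z / u)) / Gamma a) * F (\<lambda>i\<in>I. u * z i)) \<partial>gamma_prod I b)"
          by (subst nn_integral_gamma_prod_scale[OF finite_I b_nonneg u]) (simp_all add: Su a(1) del: restrict_apply)
        also have "\<dots> = (\<integral>\<^sup>+z. ennreal (u powr a) * (ennreal (exp (- ((u - 1) * ?S z))) *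
            (ennreal ((u * ?S z) powr a * u powr (- a - 1) * exp (- (u * ?S z / u)) / Gamma a) * F (\<lambda>i\<in>I. u * z i))) \<partial>gamma_prod I b)"
          by (rule nn_integral_cmult[symmetric]) measurable
        also have "\<dots> = (\<integral>\<^sup>+z. ennreal (?S z * gamma_dens a (u * ?S z)) * F (\<lambda>i\<in>I. u * z i) \<partial>gamma_prod I b)"
        proof (rule nn_integral_cong_AE)
          show "AE z in gamma_prod I b. ennreal (u powr a) * (ennreal (exp (- ((u - 1) * ?S z))) *
              (ennreal ((u * ?S z) powr a * u powr (- a - 1) * exp (- (u * ?S z / u)) / Gamma a) * F (\<lambda>i\<in>I. u * z i))) =
              ennreal (?S z * gamma_dens a (u * ?S z)) * F (\<lambda>i\<in>I. u * z i)"
            using Spos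
          proof eventually_elim
            case (elim z)
            define S where "S = ?S z"
            have S: "S > 0" using elim by (simp add: S_def)
            have 1: "u powr a * u powr (- a - 1) = 1 / u"
              using u by (simp add: powr_add[symmetric] powr_minus_divide)
            have 2: "exp (- ((u - 1) * S)) * exp (- (u * S / u)) = exp (- (u * S))"
              using u by (simp add: exp_add[symmetric] algebra_simps)
            have 3: "(u * S) powr a = (u * S) * (u * S) powr (a - 1)"
              using u S by (simp add: powr_diff)
            have "u powr a * (exp (- ((u - 1) * S)) * ((u * S) powr a * u powr (- a - 1) * exp (- (u * S / u)) / Gamma a)) =
              (u powr a * u powr (- a - 1)) * (exp (- ((u - 1) * S)) * exp (- (u * S / u))) * (u * S) powr a / Gamma a"
              by simp
            also have "\<dots> = S * gamma_dens a (u * S)"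
              unfolding 1 2 3 using u S by (simp add: gamma_dens_def)
            finally have "ennreal (u powr a) * (ennreal (exp (- ((u - 1) * S))) * ennreal ((u * S) powr a * u powr (- a - 1) * exp (- (u * S / u)) / Gamma a))
              = ennreal (S * gamma_dens a (u * S))"
              using Ga by (simp add: ennreal_mult[symmetric])
            then show ?case by (simp add: S_def mult.assoc[symmetric])
          qed
        qed
        finally show ?thesis using u by simp
      qed
    qed
    also have "\<dots> = (\<integral>\<^sup>+z. (\<integral>\<^sup>+u. ennreal (indicator {0<..} u * (?S z powr a * u powr (- a - 1) * exp (- (?S z / u)) / Gamma a)) * F z \<partial>lborel) \<partial>gamma_prod I b)"
      by (rule P2.Fubini'[symmetric]) measurable
    also have "\<dots> = (\<integral>\<^sup>+z. \<kappa> * F z \<partial>gamma_prod I b)"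
    proof (rule nn_integral_cong_AE)
      show "AE z in gamma_prod I b. (\<integral>\<^sup>+u. ennreal (indicator {0<..} u * (?S z powr a * u powr (- a - 1) * exp (- (?S z / u)) / Gamma a)) * F z \<partial>lborel) = \<kappa> * F z"
        using Spos
      proof eventually_elim
        case (elim z)
        define S where "S = ?S z"
        have S: "S > 0" using elim by (simp add: S_def)
        \<comment> \<open>Replacing \<open>u\<close> by \<open>S * u\<close> removes the sum
          \<open>S\<close> from the integral, which leaves the constant \<kappa>.\<close>
        have "(\<integral>\<^sup>+u. ennreal (indicator {0<..} u * (S powr a * u powr (- a - 1) * exp (- (S / u)) / Gamma a)) \<partial>lborel) =
          ennreal S * (\<integral>\<^sup>+u. ennreal (indicator {0<..} (S * u) * (S powr a * (S * u) powr (- a - 1) * exp (- (S / (S * u))) / Gamma a)) \<partial>lborel)"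
          using S by (subst nn_integral_real_affine[where c = S and t = 0]) auto
        also have "\<dots> = (\<integral>\<^sup>+u. ennreal S * ennreal (indicator {0<..} (S * u) * (S powr a * (S * u) powr (- a - 1) * exp (- (S / (S * u))) / Gamma a)) \<partial>lborel)"
          by (rule nn_integral_cmult[symmetric]) measurable
        also have "\<dots> = \<kappa>"
          unfolding \<kappa>_def
        proof (rule nn_integral_cong)
          fix u :: real
          have "S * S powr a * S powr (- a - 1) = 1"
            using S by (simp add: powr_diff powr_minus)
          then have "S * (S powr a * (S * u) powr (- a - 1) * exp (- (S / (S * u))) / Gamma a) =
              u powr (- a - 1) * exp (- (1 / u)) / Gamma a" if "u > 0"
            using S that by (simp add: powr_mult mult.assoc[symmetric])
          then show "ennreal S * ennreal (indicator {0<..} (S * u) * (S powr a * (S * u) powr (- a - 1) * exp (- (S / (S * u))) / Gamma a)) =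
            ennreal (indicator {0<..} u * (u powr (- a - 1) * exp (- (1 / u)) / Gamma a))"
            using S Ga by (simp add: ennreal_mult[symmetric] zero_less_mult_iff split: split_indicator)
        qed
        finally show ?case unfolding S_def by (subst nn_integral_multc) simp_all
      qed
    qed
    also have "\<dots> = \<kappa> * (\<integral>\<^sup>+z. F z \<partial>gamma_prod I b)"
      by (rule nn_integral_cmult) measurable
    finally show ?thesis .
  qed
  have "\<kappa> = 1"
    using main[of "\<lambda>_. 1"] ga.emeasure_space_1 gp.emeasure_space_1 dir.emeasure_space_1 by simp
  then show ?thesis using main[OF F] by simp
qed

end

section \<open>Raising the parameters of a Dirichlet law\<close>

lemma nn_integral_gamma_prod_split:
  assumes "finite I" "j \<in> I" and b: "\<And>i. 0 \<le> b i" and f: "f \<in> borel_measurable (PiM I (\<lambda>_. borel))"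
  shows "(\<integral>\<^sup>+x. f x \<partial>gamma_prod I b) = (\<integral>\<^sup>+x. (\<integral>\<^sup>+y. f (x(j := y)) \<partial>gamma_measure (b j)) \<partial>gamma_prod (I - {j}) b)"
  using nn_integral_gamma_prod_insert[of "I - {j}" j b f] assms by (simp add: insert_absorb)

lemma measurable_upd_coord[measurable]:
  assumes "j \<in> I"
  shows "(\<lambda>(x, y). x(j := y)) \<in> measurable (PiM (I - {j}) (\<lambda>_. borel) \<Otimes>\<^sub>M borel) (PiM I (\<lambda>_. borel))"
  using measurable_add_dim[of j "I - {j}" "\<lambda>_. borel"] assms by (simp add: insert_absorb)

context gamma_weights
begin

text \<open>Fubini isolates coordinate \<open>j\<close>, where the claim is
  \<open>nn_integral_gamma_add_exponential\<close>; the other coordinates have the same parameters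
  on both sides.\<close>

lemma nn_integral_gamma_prod_add:
  assumes j: "j \<in> I" and H[measurable]: "H \<in> borel_measurable (PiM I (\<lambda>_. borel))"
  shows "(\<integral>\<^sup>+e. (\<integral>\<^sup>+z. H (z(j := z j + e)) \<partial>gamma_prod I b) \<partial>gamma_measure 1) =
    (\<integral>\<^sup>+z. H z \<partial>gamma_prod I (b(j := b j + 1)))"
proof -
  interpret g1: prob_space "gamma_measure 1" by (rule prob_space_gamma_measure) simp
  interpret gp: prob_space "gamma_prod I b" by (rule prob_space_gamma_prod)
  interpret P: pair_sigma_finite "gamma_measure 1" "gamma_prod I b" by unfold_locales
  have gc: "gamma_prod (I - {j}) (b(j := b j + 1)) = gamma_prod (I - {j}) b"
    by (rule gamma_prod_cong) auto
  have "(\<lambda>w. H ((snd w)(j := snd w j + fst w))) \<in> borel_measurable (gamma_measure 1 \<Otimes>\<^sub>M gamma_prod I b)"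
    by (rule measurable_compose[OF measurable_fun_upd[where J = I] H]) (use j in \<open>auto simp: insert_absorb\<close>)
  then have m1: "(\<lambda>(e, z). H (z(j := z j + e))) \<in> borel_measurable (gamma_measure 1 \<Otimes>\<^sub>M gamma_prod I b)"
    by (simp add: case_prod_beta')
  have "(\<integral>\<^sup>+e. (\<integral>\<^sup>+z. H (z(j := z j + e)) \<partial>gamma_prod I b) \<partial>gamma_measure 1) =
      (\<integral>\<^sup>+z. (\<integral>\<^sup>+e. H (z(j := z j + e)) \<partial>gamma_measure 1) \<partial>gamma_prod I b)"
    by (rule P.Fubini'[symmetric]) (rule m1)
  also have "\<dots> = (\<integral>\<^sup>+x. (\<integral>\<^sup>+y. (\<integral>\<^sup>+e. H (x(j := y + e)) \<partial>gamma_measure 1) \<partial>gamma_measure (b j)) \<partial>gamma_prod (I - {j}) b)"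
  proof (subst nn_integral_gamma_prod_split[OF finite_I j b_nonneg])
    have "(\<lambda>(z, e). H (z(j := z j + e))) \<in> borel_measurable (gamma_prod I b \<Otimes>\<^sub>M gamma_measure 1)"
      using measurable_pair_swap[OF m1] by (simp add: case_prod_beta')
    then have "(\<lambda>z. \<integral>\<^sup>+e. H (z(j := z j + e)) \<partial>gamma_measure 1) \<in> borel_measurable (gamma_prod I b)"
      by (rule g1.borel_measurable_nn_integral)
    then show "(\<lambda>z. \<integral>\<^sup>+e. H (z(j := z j + e)) \<partial>gamma_measure 1) \<in> borel_measurable (PiM I (\<lambda>_. borel))"
      by (simp cong: measurable_cong_sets)
  qed simp
  also have "\<dots> = (\<integral>\<^sup>+x. (\<integral>\<^sup>+y. H (x(j := y)) \<partial>gamma_measure (b j + 1)) \<partial>gamma_prod (I - {j}) b)"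
  proof (rule nn_integral_cong)
    fix x assume "x \<in> space (gamma_prod (I - {j}) b)"
    then have x: "x \<in> space (PiM (I - {j}) (\<lambda>_. borel))" by (simp add: space_PiM PiE_def)
    have "(\<lambda>y. H (x(j := y))) \<in> borel_measurable borel"
      using measurable_compose[OF measurable_compose[OF measurable_Pair1'[OF x] measurable_upd_coord[OF j]] H] by simp
    from nn_integral_gamma_add_exponential[OF b_nonneg this]
    show "(\<integral>\<^sup>+y. (\<integral>\<^sup>+e. H (x(j := y + e)) \<partial>gamma_measure 1) \<partial>gamma_measure (b j)) =
        (\<integral>\<^sup>+y. H (x(j := y)) \<partial>gamma_measure (b j + 1))" .
  qed
  also have "\<dots> = (\<integral>\<^sup>+z. H z \<partial>gamma_prod I (b(j := b j + 1)))"
    using b_nonneg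
    by (subst nn_integral_gamma_prod_split[OF finite_I j]) (auto simp: H gc)
  finally show ?thesis .
qed

text \<open>Weighting by \<open>z j\<close> acts on coordinate \<open>j\<close> alone, where it is
  the one-dimensional size biasing. This is the change of measure behind the updating of a Dirichlet
  law.\<close>

lemma nn_integral_gamma_prod_size_bias:
  assumes j: "j \<in> I" and F[measurable]: "F \<in> borel_measurable (PiM I (\<lambda>_. borel))"
  shows "ennreal (b j) * (\<integral>\<^sup>+z. F z \<partial>gamma_prod I (b(j := b j + 1))) = (\<integral>\<^sup>+z. ennreal (z j) * F z \<partial>gamma_prod I b)"
proof -
  interpret g1: prob_space "gamma_measure (b j + 1)" by (rule prob_space_gamma_measure) (simp add: b_nonneg add_nonneg_nonneg)
  have gc: "gamma_prod (I - {j}) (b(j := b j + 1)) = gamma_prod (I - {j}) b"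
    by (rule gamma_prod_cong) auto
  have m: "(\<lambda>(x, y). F (x(j := y))) \<in> borel_measurable (PiM (I - {j}) (\<lambda>_. borel) \<Otimes>\<^sub>M borel)"
    using measurable_compose[OF measurable_upd_coord[OF j] F] by (simp add: case_prod_beta')
  have "ennreal (b j) * (\<integral>\<^sup>+z. F z \<partial>gamma_prod I (b(j := b j + 1))) =
      ennreal (b j) * (\<integral>\<^sup>+x. (\<integral>\<^sup>+y. F (x(j := y)) \<partial>gamma_measure (b j + 1)) \<partial>gamma_prod (I - {j}) b)"
    using b_nonneg
    by (subst nn_integral_gamma_prod_split[OF finite_I j]) (auto simp: F gc)
  also have "\<dots> = (\<integral>\<^sup>+x. ennreal (b j) * (\<integral>\<^sup>+y. F (x(j := y)) \<partial>gamma_measure (b j + 1)) \<partial>gamma_prod (I - {j}) b)"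
  proof (rule nn_integral_cmult[symmetric])
    have "(\<lambda>(x, y). F (x(j := y))) \<in> borel_measurable (gamma_prod (I - {j}) b \<Otimes>\<^sub>M gamma_measure (b j + 1))"
      using m by (simp cong: measurable_cong_sets sets_pair_measure_cong)
    then show "(\<lambda>x. \<integral>\<^sup>+y. F (x(j := y)) \<partial>gamma_measure (b j + 1)) \<in> borel_measurable (gamma_prod (I - {j}) b)"
      by (rule g1.borel_measurable_nn_integral)
  qed
  also have "\<dots> = (\<integral>\<^sup>+x. (\<integral>\<^sup>+y. ennreal y * F (x(j := y)) \<partial>gamma_measure (b j)) \<partial>gamma_prod (I - {j}) b)"
  proof (rule nn_integral_cong)
    fix x assume "x \<in> space (gamma_prod (I - {j}) b)"
    then have x: "x \<in> space (PiM (I - {j}) (\<lambda>_. borel))" by (simp add: space_PiM PiE_def)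
    have "(\<lambda>y. F (x(j := y))) \<in> borel_measurable borel"
      using measurable_compose[OF measurable_Pair1'[OF x] m] by simp
    from nn_integral_gamma_measure_Suc[OF b_nonneg this]
    show "ennreal (b j) * (\<integral>\<^sup>+y. F (x(j := y)) \<partial>gamma_measure (b j + 1)) =
      (\<integral>\<^sup>+y. ennreal y * F (x(j := y)) \<partial>gamma_measure (b j))" .
  qed
  also have "\<dots> = (\<integral>\<^sup>+z. ennreal (z j) * F z \<partial>gamma_prod I b)"
    using j by (subst nn_integral_gamma_prod_split[OF finite_I j b_nonneg]) auto
  finally show ?thesis .
qed

lemma AE_dirichlet_sum:
  assumes "0 < (\<Sum>i\<in>I. b i)"
  shows "AE p in dirichlet_measure I b. (\<Sum>i\<in>I. p i) = 1"
  unfolding dirichlet_measure_eq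
proof (subst AE_distr_iff)
  show "AE z in gamma_prod I b. (\<Sum>i\<in>I. (\<lambda>i\<in>I. z i / (\<Sum>j\<in>I. z j)) i) = 1"
    using AE_gamma_prod_sum_pos[OF assms]
    by eventually_elim (simp add: sum_divide_distrib[symmetric])
qed measurable

lemma AE_dirichlet_nonneg: "AE p in dirichlet_measure I b. \<forall>i\<in>I. 0 \<le> p i"
  unfolding dirichlet_measure_eq
proof (subst AE_distr_iff)
  show "AE z in gamma_prod I b. \<forall>i\<in>I. 0 \<le> (\<lambda>i\<in>I. z i / (\<Sum>j\<in>I. z j)) i"
    using AE_gamma_prod_nonneg by eventually_elim (auto intro!: divide_nonneg_nonneg sum_nonneg)
qed (use finite_I in measurable)

text \<open>In the representation of \<open>nn_integral_gamma_times_dirichlet\<close> the radial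
  variable \<open>s\<close> does not affect \<open>F\<close>, and its law has mass 1.\<close>

lemma nn_integral_dirichlet_homogeneous:
  assumes a: "a = (\<Sum>i\<in>I. b i)" "0 < a"
    and F[measurable]: "F \<in> borel_measurable (PiM I (\<lambda>_. borel))"
    and hom: "\<And>s z. 0 < s \<Longrightarrow> z \<in> extensional I \<Longrightarrow> F (\<lambda>i\<in>I. s * z i) = F z"
  shows "(\<integral>\<^sup>+p. F p \<partial>dirichlet_measure I b) = (\<integral>\<^sup>+z. F z \<partial>gamma_prod I b)"
proof -
  interpret ga: prob_space "gamma_measure a" using a by (intro prob_space_gamma_measure) auto
  have "(\<integral>\<^sup>+z. F z \<partial>gamma_prod I b) = (\<integral>\<^sup>+s. (\<integral>\<^sup>+p. F (\<lambda>i\<in>I. s * p i) \<partial>dirichlet_measure I b) \<partial>gamma_measure a)"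
    by (rule nn_integral_gamma_times_dirichlet[OF a F, symmetric])
  also have "\<dots> = (\<integral>\<^sup>+s. (\<integral>\<^sup>+p. F p \<partial>dirichlet_measure I b) \<partial>gamma_measure a)"
    by (intro nn_integral_cong_AE eventually_mono[OF gamma_measure_AE_pos[OF a(2)]] nn_integral_cong)
       (simp add: hom)
  finally show ?thesis using ga.emeasure_space_1 by simp
qed

text \<open>After division by \<open>a\<close> this says that a Dirichlet law with parameter
  \<open>b\<close> is the mixture, with weights \<open>b j / a\<close>, of those with
  \<open>b j\<close> raised by 1. Size biasing in each coordinate and summation produce the factor
  \<open>\<Sum>j\<in>I. z j\<close>, which is independent of the direction of \<open>z\<close> and
  has mean \<open>a\<close>.\<close>

lemma gamma_prod_size_bias_mixture:
  assumes a: "a = (\<Sum>i\<in>I. b i)" "0 < a"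
    and F[measurable]: "F \<in> borel_measurable (PiM I (\<lambda>_. borel))"
    and hom: "\<And>s z. 0 < s \<Longrightarrow> z \<in> extensional I \<Longrightarrow> F (\<lambda>i\<in>I. s * z i) = F z"
  shows "(\<Sum>j\<in>I. ennreal (b j) * (\<integral>\<^sup>+z. F z \<partial>gamma_prod I (b(j := b j + 1)))) = ennreal a * (\<integral>\<^sup>+z. F z \<partial>gamma_prod I b)"
proof -
  let ?C = "\<integral>\<^sup>+p. F p \<partial>dirichlet_measure I b"
  have "(\<Sum>j\<in>I. ennreal (b j) * (\<integral>\<^sup>+z. F z \<partial>gamma_prod I (b(j := b j + 1)))) =
      (\<Sum>j\<in>I. \<integral>\<^sup>+z. ennreal (z j) * F z \<partial>gamma_prod I b)"
    by (intro sum.cong nn_integral_gamma_prod_size_bias) auto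
  also have "\<dots> = (\<integral>\<^sup>+z. (\<Sum>j\<in>I. ennreal (z j) * F z) \<partial>gamma_prod I b)"
    by (rule nn_integral_sum[symmetric]) measurable
  also have "\<dots> = (\<integral>\<^sup>+z. ennreal (\<Sum>j\<in>I. z j) * F z \<partial>gamma_prod I b)"
    by (intro nn_integral_cong_AE eventually_mono[OF AE_gamma_prod_nonneg])
       (simp add: sum_distrib_right[symmetric] sum_ennreal)
  also have "\<dots> = (\<integral>\<^sup>+s. (\<integral>\<^sup>+p. ennreal (\<Sum>j\<in>I. (\<lambda>i\<in>I. s * p i) j) * F (\<lambda>i\<in>I. s * p i) \<partial>dirichlet_measure I b) \<partial>gamma_measure a)"
    by (rule nn_integral_gamma_times_dirichlet[OF a, symmetric]) measurable
  also have "\<dots> = (\<integral>\<^sup>+s. (\<integral>\<^sup>+p. ennreal s * F p \<partial>dirichlet_measure I b) \<partial>gamma_measure a)"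
  proof (intro nn_integral_cong_AE eventually_mono[OF gamma_measure_AE_pos[OF a(2)]])
    fix s :: real assume s: "0 < s"
    show "AE p in dirichlet_measure I b. ennreal (\<Sum>j\<in>I. (\<lambda>i\<in>I. s * p i) j) * F (\<lambda>i\<in>I. s * p i) = ennreal s * F p"
      using AE_dirichlet_sum[folded a(1), OF a(2)] AE_space
      by eventually_elim (use s hom in \<open>simp add: sum_distrib_left[symmetric]\<close>)
  qed
  also have "\<dots> = (\<integral>\<^sup>+s. ennreal s * ?C \<partial>gamma_measure a)"
    by (intro nn_integral_cong nn_integral_cmult) measurable
  also have "\<dots> = ennreal a * ?C"
    using a by (subst nn_integral_multc) (auto simp: nn_integral_gamma_measure_ident)
  finally show ?thesis
    using nn_integral_dirichlet_homogeneous[OF a F hom] by simp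
qed

end

text \<open>Exponential \<open>E i\<close> is credited to coordinate \<open>J i\<close>. The
  parameter \<open>b\<close> is generalised in the induction, since each new exponential is absorbed
  into it by \<open>nn_integral_gamma_prod_add\<close>.\<close>

lemma nn_integral_gamma_prod_add_exponentials:
  assumes "finite N" "finite I" and b: "\<And>i. 0 \<le> b i" and "J \<in> N \<rightarrow> I"
    and H[measurable]: "H \<in> borel_measurable (PiM I (\<lambda>_. borel))"
  shows "(\<integral>\<^sup>+E. (\<integral>\<^sup>+z. H (\<lambda>j\<in>I. z j + (\<Sum>i\<in>N. if J i = j then E i else 0)) \<partial>gamma_prod I b) \<partial>gamma_prod N (\<lambda>_. 1)) =
    (\<integral>\<^sup>+z. H z \<partial>gamma_prod I (\<lambda>j. b j + real (card {i\<in>N. J i = j})))"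
  using assms(1,4,3)
proof (induction N arbitrary: b)
  case empty
  interpret gamma_weights "{} :: 'a set" "\<lambda>_. 1" by unfold_locales auto
  interpret gp: prob_space "gamma_prod ({} :: 'a set) (\<lambda>_. 1)" by (rule prob_space_gamma_prod)
  have "(\<lambda>j\<in>I. z j + (\<Sum>i\<in>{}. if J i = j then E i else 0)) = z" if "z \<in> extensional I" for z and E :: "'a \<Rightarrow> real"
    using that by (auto simp: fun_eq_iff extensional_def)
  then have "(\<integral>\<^sup>+z. H (\<lambda>j\<in>I. z j + (\<Sum>i\<in>{}. if J i = j then E i else 0)) \<partial>gamma_prod I b) =
      (\<integral>\<^sup>+z. H z \<partial>gamma_prod I b)" for E :: "'a \<Rightarrow> real"
    by (intro nn_integral_cong) (simp only: space_gamma_prod)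
  then show ?case using gp.emeasure_space_1 by (simp only: nn_integral_const) simp
next
  case (insert k N)
  have Jk: "J k \<in> I" using insert.prems by auto
  interpret w: gamma_weights I b by unfold_locales (use insert.prems \<open>finite I\<close> in auto)
  interpret gp: prob_space "gamma_prod I b" by (rule w.prob_space_gamma_prod)
  interpret g1: prob_space "gamma_measure 1" by (rule prob_space_gamma_measure) simp
  let ?b = "b(J k := b (J k) + 1)"
  define H' where "H' E w = H (\<lambda>j\<in>I. w j + (\<Sum>i\<in>N. if J i = j then E i else 0))" for E w
  have m: "(\<lambda>(E, z). H (\<lambda>j\<in>I. z j + (\<Sum>i\<in>insert k N. if J i = j then E i else 0)))
      \<in> borel_measurable (PiM (insert k N) (\<lambda>_. borel) \<Otimes>\<^sub>M gamma_prod I b)"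
    using insert.prems by measurable
  have "(\<integral>\<^sup>+E. (\<integral>\<^sup>+z. H (\<lambda>j\<in>I. z j + (\<Sum>i\<in>insert k N. if J i = j then E i else 0)) \<partial>gamma_prod I b) \<partial>gamma_prod (insert k N) (\<lambda>_. 1)) =
    (\<integral>\<^sup>+E. (\<integral>\<^sup>+y. (\<integral>\<^sup>+z. H (\<lambda>j\<in>I. z j + (\<Sum>i\<in>insert k N. if J i = j then (E(k := y)) i else 0)) \<partial>gamma_prod I b) \<partial>gamma_measure 1) \<partial>gamma_prod N (\<lambda>_. 1))"
    by (rule nn_integral_gamma_prod_insert[OF insert.hyps]) (auto intro: gp.borel_measurable_nn_integral m)
  also have "\<dots> = (\<integral>\<^sup>+E. (\<integral>\<^sup>+y. (\<integral>\<^sup>+z. H' E (z(J k := z (J k) + y)) \<partial>gamma_prod I b) \<partial>gamma_measure 1) \<partial>gamma_prod N (\<lambda>_. 1))"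
  proof -
    have "(\<lambda>j\<in>I. z j + (\<Sum>i\<in>insert k N. if J i = j then (E(k := y)) i else 0)) =
      (\<lambda>j\<in>I. (z(J k := z (J k) + y)) j + (\<Sum>i\<in>N. if J i = j then E i else 0))" for z :: "'b \<Rightarrow> real" and E :: "'a \<Rightarrow> real" and y
    proof -
      have "(\<Sum>i\<in>N. if J i = j then (E(k := y)) i else 0) = (\<Sum>i\<in>N. if J i = j then E i else 0)" for j
        using insert.hyps by (intro sum.cong) auto
      then show ?thesis using insert.hyps by (auto simp: fun_eq_iff restrict_def)
    qed
    then show ?thesis unfolding H'_def by (simp only:)
  qed
  also have "\<dots> = (\<integral>\<^sup>+E. (\<integral>\<^sup>+z. H' E z \<partial>gamma_prod I ?b) \<partial>gamma_prod N (\<lambda>_. 1))"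
    unfolding H'_def by (intro nn_integral_cong w.nn_integral_gamma_prod_add Jk) measurable
  also have "\<dots> = (\<integral>\<^sup>+z. H z \<partial>gamma_prod I (\<lambda>j. ?b j + real (card {i\<in>N. J i = j})))"
    unfolding H'_def
    by (rule insert.IH) (use insert.prems in \<open>auto intro: add_nonneg_nonneg\<close>)
  also have "(\<lambda>j. ?b j + real (card {i\<in>N. J i = j})) = (\<lambda>j. b j + real (card {i\<in>insert k N. J i = j}))"
  proof
    fix j
    have "{i\<in>insert k N. J i = j} = (if J k = j then insert k {i\<in>N. J i = j} else {i\<in>N. J i = j})" by auto
    then show "?b j + real (card {i\<in>N. J i = j}) = b j + real (card {i\<in>insert k N. J i = j})"
      using insert.hyps by auto
  qed
  finally show ?case .
qed

text \<open>Independent Gamma variables \<open>s \<theta>\<close>, \<open>s (1 - \<theta>)\<close> turn the two Dirichlet vectors into vectors of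
  independent Gamma variables, which can be added coordinatewise.\<close>

lemma (in gamma_weights) nn_integral_dirichlet_posterior:
  assumes n: "1 \<le> n" and J: "J \<in> {1..n} \<rightarrow> I" and a: "a = (\<Sum>i\<in>I. b i)" "0 < a"
    and F[measurable]: "F \<in> borel_measurable (borel :: real measure)"
  shows "(\<integral>\<^sup>+t. (\<integral>\<^sup>+q. (\<integral>\<^sup>+p. F (t * (\<Sum>i=1..n. q i * e (J i)) + (1 - t) * (\<Sum>j\<in>I. e j * p j))
      \<partial>dirichlet_measure I b) \<partial>dirichlet_measure {1..n} (\<lambda>_. 1)) \<partial>beta_measure (real n) a) =
    (\<integral>\<^sup>+z. F ((\<Sum>j\<in>I. e j * z j) / (\<Sum>j\<in>I. z j)) \<partial>gamma_prod I (\<lambda>j. b j + real (card {i\<in>{1..n}. J i = j})))"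
proof -
  interpret N: gamma_weights "{1..n}" "\<lambda>_. 1" by unfold_locales auto
  interpret gp: prob_space "gamma_prod I b" by (rule prob_space_gamma_prod)
  interpret gN: prob_space "gamma_prod {1..n} (\<lambda>_. 1)" by (rule N.prob_space_gamma_prod)
  interpret dp: prob_space "dirichlet_measure I b" by (rule prob_space_dirichlet)
  interpret dN: prob_space "dirichlet_measure {1..n} (\<lambda>_. 1)" by (rule N.prob_space_dirichlet)
  interpret ga: prob_space "gamma_measure a" using a by (intro prob_space_gamma_measure) auto
  interpret gna: prob_space "gamma_measure (real n + a)" using a by (intro prob_space_gamma_measure) auto
  interpret P: pair_sigma_finite "gamma_measure a" "dirichlet_measure {1..n} (\<lambda>_. 1)" by unfold_locales
  have n': "0 < real n" and sn: "real n = (\<Sum>i\<in>{1..n}. 1)" using n by auto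
  \<comment> \<open>The ratio is invariant under a common scaling of \<open>E\<close> and
    \<open>z\<close>. Once both totals are expressed by \<open>s\<close> and \<open>t\<close>, the
    factor \<open>s\<close> therefore cancels and only the Beta variable remains.\<close>
  define \<Phi> where "\<Phi> E z = F (((\<Sum>i=1..n. E i * e (J i)) + (\<Sum>j\<in>I. e j * z j)) / ((\<Sum>i=1..n. E i) + (\<Sum>j\<in>I. z j)))"
    for E :: "nat \<Rightarrow> real" and z :: "'i \<Rightarrow> real"
  have [measurable]: "(\<lambda>w. \<Phi> (f w) (g w)) \<in> borel_measurable M"
    if [measurable]: "f \<in> measurable M (PiM {1..n} (\<lambda>_. borel))" "g \<in> measurable M (PiM I (\<lambda>_. borel))"
    for f g and M :: "'z measure"
    unfolding \<Phi>_def by measurable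
  have sum_J: "(\<Sum>j\<in>I. c j * (\<Sum>i=1..n. if J i = j then E i else 0)) = (\<Sum>i=1..n. E i * c (J i))"
    for c :: "'i \<Rightarrow> real" and E :: "nat \<Rightarrow> real"
  proof -
    have "(\<Sum>j\<in>I. c j * (\<Sum>i=1..n. if J i = j then E i else 0)) = (\<Sum>i=1..n. \<Sum>j\<in>I. if J i = j then E i * c j else 0)"
      unfolding sum_distrib_left by (subst sum.swap) (auto intro!: sum.cong)
    also have "\<dots> = (\<Sum>i=1..n. E i * c (J i))"
      using J finite_I by (intro sum.cong) (auto simp: sum.delta)
    finally show ?thesis .
  qed
  have \<Phi>_eq: "F ((\<Sum>j\<in>I. e j * (\<lambda>j\<in>I. z j + (\<Sum>i=1..n. if J i = j then E i else 0)) j) /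
      (\<Sum>j\<in>I. (\<lambda>j\<in>I. z j + (\<Sum>i=1..n. if J i = j then E i else 0)) j)) = \<Phi> E z" for E z
  proof -
    have "(\<Sum>j\<in>I. e j * (\<lambda>j\<in>I. z j + (\<Sum>i=1..n. if J i = j then E i else 0)) j) = (\<Sum>i=1..n. E i * e (J i)) + (\<Sum>j\<in>I. e j * z j)"
      using sum_J[of e E] by (simp add: distrib_left sum.distrib)
    moreover have "(\<Sum>j\<in>I. (\<lambda>j\<in>I. z j + (\<Sum>i=1..n. if J i = j then E i else 0)) j) = (\<Sum>i=1..n. E i) + (\<Sum>j\<in>I. z j)"
      using sum_J[of "\<lambda>_. 1" E] by (simp add: sum.distrib)
    ultimately show ?thesis by (simp only: \<Phi>_def)
  qed
  have "(\<integral>\<^sup>+z. F ((\<Sum>j\<in>I. e j * z j) / (\<Sum>j\<in>I. z j)) \<partial>gamma_prod I (\<lambda>j. b j + real (card {i\<in>{1..n}. J i = j}))) =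
      (\<integral>\<^sup>+E. (\<integral>\<^sup>+z. \<Phi> E z \<partial>gamma_prod I b) \<partial>gamma_prod {1..n} (\<lambda>_. 1))"
    using nn_integral_gamma_prod_add_exponentials[of "{1..n}" I b J "\<lambda>z. F ((\<Sum>j\<in>I. e j * z j) / (\<Sum>j\<in>I. z j))"]
      finite_I b_nonneg J unfolding \<Phi>_eq by simp
  also have "\<dots> = (\<integral>\<^sup>+E. (\<integral>\<^sup>+y. (\<integral>\<^sup>+p. \<Phi> E (\<lambda>j\<in>I. y * p j) \<partial>dirichlet_measure I b) \<partial>gamma_measure a) \<partial>gamma_prod {1..n} (\<lambda>_. 1))"
    by (intro nn_integral_cong nn_integral_gamma_times_dirichlet[OF a, symmetric]) (simp add: space_PiM PiE_def, measurable)
  also have "\<dots> = (\<integral>\<^sup>+x. (\<integral>\<^sup>+q. (\<integral>\<^sup>+y. (\<integral>\<^sup>+p. \<Phi> (\<lambda>i\<in>{1..n}. x * q i) (\<lambda>j\<in>I. y * p j)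
      \<partial>dirichlet_measure I b) \<partial>gamma_measure a) \<partial>dirichlet_measure {1..n} (\<lambda>_. 1)) \<partial>gamma_measure (real n))"
    by (rule N.nn_integral_gamma_times_dirichlet[OF sn n', symmetric]) measurable
  also have "\<dots> = (\<integral>\<^sup>+x. (\<integral>\<^sup>+y. (\<integral>\<^sup>+q. (\<integral>\<^sup>+p. \<Phi> (\<lambda>i\<in>{1..n}. x * q i) (\<lambda>j\<in>I. y * p j)
      \<partial>dirichlet_measure I b) \<partial>dirichlet_measure {1..n} (\<lambda>_. 1)) \<partial>gamma_measure a) \<partial>gamma_measure (real n))"
    by (intro nn_integral_cong P.Fubini') measurable
  also have "\<dots> = (\<integral>\<^sup>+s. (\<integral>\<^sup>+t. (\<integral>\<^sup>+q. (\<integral>\<^sup>+p. \<Phi> (\<lambda>i\<in>{1..n}. (s * t) * q i) (\<lambda>j\<in>I. (s * (1 - t)) * p j)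
      \<partial>dirichlet_measure I b) \<partial>dirichlet_measure {1..n} (\<lambda>_. 1)) \<partial>beta_measure (real n) a) \<partial>gamma_measure (real n + a))"
    by (rule nn_integral_beta_gamma[OF n' a(2), symmetric]) measurable
  \<comment> \<open>The two independent totals \<open>x\<close> and \<open>y\<close> are exactly the
    pair \<open>s * t\<close>, \<open>s * (1 - t)\<close> of the Beta-Gamma identity with parameters
    \<open>n\<close> and \<open>a\<close>.\<close>
  also have "\<dots> = (\<integral>\<^sup>+s. (\<integral>\<^sup>+t. (\<integral>\<^sup>+q. (\<integral>\<^sup>+p. F (t * (\<Sum>i=1..n. q i * e (J i)) + (1 - t) * (\<Sum>j\<in>I. e j * p j))
      \<partial>dirichlet_measure I b) \<partial>dirichlet_measure {1..n} (\<lambda>_. 1)) \<partial>beta_measure (real n) a) \<partial>gamma_measure (real n + a))"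
  proof (intro nn_integral_cong_AE eventually_mono[OF gamma_measure_AE_pos] eventually_mono[OF beta_measure_AE])
    show "0 < real n + a" using a by simp
    fix s t :: real assume s: "0 < s" and t: "0 < t \<and> t < 1"
    show "AE q in dirichlet_measure {1..n} (\<lambda>_. 1).
        (\<integral>\<^sup>+p. \<Phi> (\<lambda>i\<in>{1..n}. (s * t) * q i) (\<lambda>j\<in>I. (s * (1 - t)) * p j) \<partial>dirichlet_measure I b) =
        (\<integral>\<^sup>+p. F (t * (\<Sum>i=1..n. q i * e (J i)) + (1 - t) * (\<Sum>j\<in>I. e j * p j)) \<partial>dirichlet_measure I b)"
      using N.AE_dirichlet_sum[folded sn, OF n']
    proof eventually_elim
      case (elim q)
      show ?case
      proof (rule nn_integral_cong_AE)
        show "AE p in dirichlet_measure I b. \<Phi> (\<lambda>i\<in>{1..n}. (s * t) * q i) (\<lambda>j\<in>I. (s * (1 - t)) * p j) =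
            F (t * (\<Sum>i=1..n. q i * e (J i)) + (1 - t) * (\<Sum>j\<in>I. e j * p j))"
          using AE_dirichlet_sum[folded a(1), OF a(2)]
        proof eventually_elim
          case (elim p)
          have 1: "(\<Sum>i=1..n. (\<lambda>i\<in>{1..n}. (s * t) * q i) i * e (J i)) = s * t * (\<Sum>i=1..n. q i * e (J i))"
            and 2: "(\<Sum>j\<in>I. e j * (\<lambda>j\<in>I. (s * (1 - t)) * p j) j) = s * (1 - t) * (\<Sum>j\<in>I. e j * p j)"
            by (auto simp: sum_distrib_left ac_simps intro!: sum.cong)
          have 3: "(\<Sum>i=1..n. (\<lambda>i\<in>{1..n}. (s * t) * q i) i) = s * t"
            and 4: "(\<Sum>j\<in>I. (\<lambda>j\<in>I. (s * (1 - t)) * p j) j) = s * (1 - t)"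
            using \<open>(\<Sum>i=1..n. q i) = 1\<close> elim by (simp_all add: sum_distrib_left[symmetric])
          have "(s * t * x + s * (1 - t) * y) / (s * t + s * (1 - t)) = t * x + (1 - t) * y" for x y
            using s by (simp add: field_simps)
          then show ?case unfolding \<Phi>_def 1 2 3 4 by simp
        qed
      qed
    qed
  qed
  also have "\<dots> = (\<integral>\<^sup>+t. (\<integral>\<^sup>+q. (\<integral>\<^sup>+p. F (t * (\<Sum>i=1..n. q i * e (J i)) + (1 - t) * (\<Sum>j\<in>I. e j * p j))
      \<partial>dirichlet_measure I b) \<partial>dirichlet_measure {1..n} (\<lambda>_. 1)) \<partial>beta_measure (real n) a)"
    using gna.emeasure_space_1 by simp
  finally show ?thesis by simp
qed

section \<open>Polya sequences\<close>

lemma sum_real_card_fibers: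
  assumes "finite I" "finite N" "J \<in> N \<rightarrow> I"
  shows "(\<Sum>j\<in>I. real (card {i\<in>N. J i = j})) = real (card N)"
proof -
  have "(\<Sum>j\<in>I. real (card {i\<in>N. J i = j})) = (\<Sum>j\<in>I. \<Sum>i\<in>N. if J i = j then 1 else 0)"
    using assms(2) by (simp add: sum.If_cases Int_def)
  also have "\<dots> = (\<Sum>i\<in>N. \<Sum>j\<in>I. if J i = j then 1 else 0)" by (rule sum.swap)
  also have "\<dots> = (\<Sum>i\<in>N. 1)"
    using assms by (intro sum.cong) (auto simp: sum.delta)
  finally show ?thesis by simp
qed

text \<open>All that is needed of the sample is the class \<open>c (Z i)\<close> of each term. With
  finitely many classes the past takes finitely many values, and the \<alpha>-masses of the classes
  are the prior Dirichlet parameters.\<close>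

locale polya_partition =
  fixes W :: "'p measure" and \<alpha> :: "'x::topological_space measure" and Z :: "nat \<Rightarrow> 'p \<Rightarrow> 'x"
    and I :: "'i set" and c :: "'x \<Rightarrow> 'i"
  assumes polya: "polya_sequence W \<alpha> Z"
    and \<alpha>: "sets \<alpha> = sets borel" "finite_measure \<alpha>" "0 < measure \<alpha> UNIV"
    and finite_I: "finite I" and c_I: "\<And>x. c x \<in> I" and c_sets: "\<And>j. c -` {j} \<in> sets borel"
begin

sublocale W: prob_space W using polya by (simp add: polya_sequence_def)

lemma measurable_Z: "1 \<le> j \<Longrightarrow> Z j \<in> measurable W borel"
  using polya by (simp add: polya_sequence_def)

definition weight :: "'i \<Rightarrow> real" where "weight j = measure \<alpha> (c -` {j})"

lemma weight_nonneg: "0 \<le> weight j" by (simp add: weight_def)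

lemma sum_weight: "(\<Sum>j\<in>I. weight j) = measure \<alpha> UNIV"
proof -
  interpret finite_measure \<alpha> by (rule \<alpha>)
  have "(\<Union>j\<in>I. c -` {j}) = UNIV" using c_I by auto
  then show ?thesis
    unfolding weight_def using finite_I c_sets \<alpha>(1)
    by (subst finite_measure_finite_Union[symmetric]) (auto simp: disjoint_family_on_def)
qed

text \<open>The restriction to \<open>{1..m}\<close> puts all values in the finite set
  \<open>{1..m} \<rightarrow>\<^sub>E I\<close>, so that every real function of
  \<open>classes m\<close> is measurable, bounded and integrable.\<close>

definition classes :: "nat \<Rightarrow> 'p \<Rightarrow> nat \<Rightarrow> 'i" where
  "classes m \<omega> = (\<lambda>i\<in>{1..m}. c (Z i \<omega>))"

text \<open>The Dirichlet parameters of the posterior after the observations \<open>x 1\<close> to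
  \<open>x m\<close>; for \<open>m = 0\<close> they are the prior \<open>weight\<close>.\<close>

definition counts :: "nat \<Rightarrow> (nat \<Rightarrow> 'i) \<Rightarrow> 'i \<Rightarrow> real" where
  "counts m x j = weight j + real (card {i\<in>{1..m}. x i = j})"

abbreviation past :: "nat \<Rightarrow> 'p measure" where "past m \<equiv> generated_by W borel {1..m} Z"

lemma measurable_Z_past:
  assumes "i \<in> {1..m}" shows "Z i \<in> measurable (past m) borel"
proof -
  have "(\<lambda>\<omega>. \<lambda>i\<in>{1..m}. Z i \<omega>) \<in> measurable (past m) (PiM {1..m} (\<lambda>_. borel))"
    unfolding generated_by_def by (rule measurable_vimage_algebra1) (auto simp: space_PiM)
  from measurable_compose[OF this measurable_component_singleton[OF assms]] show ?thesis
    using assms by simp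
qed

lemma subalgebra_past: "subalgebra W (past m)"
proof -
  have "(\<lambda>\<omega>. \<lambda>i\<in>{1..m}. Z i \<omega>) \<in> measurable W (PiM {1..m} (\<lambda>_. borel))"
    by (intro measurable_restrict measurable_Z) auto
  then show ?thesis
    unfolding subalgebra_def generated_by_def by (simp add: measurable_iff_sets)
qed

lemma measurable_classes_past:
  "classes m \<in> measurable (past m) (count_space ({1..m} \<rightarrow>\<^sub>E I))"
proof (subst measurable_count_space_eq2)
  show "finite ({1..m} \<rightarrow>\<^sub>E I)" using finite_I by (intro finite_PiE) auto
  have "classes m -` {J} \<inter> space (past m) \<in> sets (past m)" if "J \<in> {1..m} \<rightarrow>\<^sub>E I" for J
  proof -
    have "classes m -` {J} \<inter> space (past m) = {\<omega> \<in> space (past m). \<forall>i\<in>{1..m}. c (Z i \<omega>) = J i}"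
      using that by (auto simp: classes_def fun_eq_iff PiE_def extensional_def restrict_def)
    also have "\<dots> \<in> sets (past m)"
    proof (rule sets.sets_Collect_finite_All)
      fix i assume i: "i \<in> {1..m}"
      have "Z i -` (c -` {J i}) \<inter> space (past m) \<in> sets (past m)"
        by (rule measurable_sets[OF measurable_Z_past[OF i] c_sets])
      then show "{\<omega> \<in> space (past m). c (Z i \<omega>) = J i} \<in> sets (past m)"
        by (simp add: vimage_def Int_def conj_commute)
    qed simp
    finally show ?thesis .
  qed
  then show "classes m \<in> space (past m) \<rightarrow> {1..m} \<rightarrow>\<^sub>E I \<and> (\<forall>a\<in>{1..m} \<rightarrow>\<^sub>E I. classes m -` {a} \<inter> space (past m) \<in> sets (past m))"
    using c_I by (auto simp: classes_def)
qed

lemma measurable_fun_classes_past: "(\<lambda>\<omega>. f (classes m \<omega>)) \<in> borel_measurable (past m)"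
  for f :: "_ \<Rightarrow> real"
  by (rule measurable_compose[OF measurable_classes_past]) simp

lemma measurable_fun_classes: "(\<lambda>\<omega>. f (classes m \<omega>)) \<in> borel_measurable W"
  for f :: "_ \<Rightarrow> real"
  using measurable_from_subalg[OF subalgebra_past measurable_fun_classes_past] .

lemma bounded_fun_classes: "\<exists>B. \<forall>\<omega>. \<bar>f (classes m \<omega>)\<bar> \<le> B" for f :: "_ \<Rightarrow> real"
proof -
  have fin: "finite ({1..m} \<rightarrow>\<^sub>E I)" using finite_I by (intro finite_PiE) auto
  have "classes m \<omega> \<in> {1..m} \<rightarrow>\<^sub>E I" for \<omega> using c_I by (auto simp: classes_def)
  then have "\<bar>f (classes m \<omega>)\<bar> \<le> Max ((\<lambda>x. \<bar>f x\<bar>) ` ({1..m} \<rightarrow>\<^sub>E I))" for \<omega>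
    using fin by (intro Max_ge) auto
  then show ?thesis by blast
qed

lemma integrable_fun_classes: "integrable W (\<lambda>\<omega>. f (classes m \<omega>))" for f :: "_ \<Rightarrow> real"
proof -
  obtain B where "\<bar>f (classes m \<omega>)\<bar> \<le> B" for \<omega> using bounded_fun_classes[of f m] by blast
  then show ?thesis by (intro W.integrable_const_bound[where B = B] measurable_fun_classes) auto
qed

text \<open>The predictive rule in integrated form, tested against a function of the past; later
  arguments then avoid conditional expectations. The case \<open>m = 0\<close> is separate since
  \<open>polya_sequence\<close> gives the law of the first term unconditionally.\<close>

lemma integral_next_class:
  fixes f :: "_ \<Rightarrow> real"
  shows "(\<integral>\<omega>. f (classes m \<omega>) * indicator {\<omega> \<in> space W. c (Z (Suc m) \<omega>) = j} \<omega> \<partial>W) =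
    (\<integral>\<omega>. f (classes m \<omega>) * counts m (classes m \<omega>) j \<partial>W) / (measure \<alpha> UNIV + real m)"
proof -
  let ?A = "c -` {j}"
  have A: "{\<omega> \<in> space W. c (Z (Suc m) \<omega>) = j} = Z (Suc m) -` ?A \<inter> space W" by auto
  have As: "Z (Suc m) -` ?A \<inter> space W \<in> sets W"
    by (rule measurable_sets[OF measurable_Z c_sets]) simp
  show ?thesis
  proof (cases "m = 0")
    case True
    have cl: "classes m \<omega> = (\<lambda>_. undefined)" for \<omega> by (simp add: classes_def True fun_eq_iff)
    have "measure W (Z (Suc m) -` ?A \<inter> space W) = measure \<alpha> ?A / measure \<alpha> UNIV"
      using polya c_sets True by (simp add: polya_sequence_def)
    then show ?thesis
      unfolding cl A using As True by (simp add: counts_def weight_def W.prob_space)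
  next
    case False
    then have m: "m \<ge> 1" by simp
    interpret S: finite_measure_subalgebra W "past m"
      by unfold_locales (rule subalgebra_past)
    have ce: "AE \<omega> in W. real_cond_exp W (past m) (indicator (Z (Suc m) -` ?A \<inter> space W)) \<omega> =
        counts m (classes m \<omega>) j / (measure \<alpha> UNIV + real m)"
    proof -
      have "AE \<omega> in W. real_cond_exp W (past m) (indicator (Z (Suc m) -` ?A \<inter> space W)) \<omega> =
        1 / (measure \<alpha> UNIV + real m) * measure \<alpha> ?A +
        1 / (measure \<alpha> UNIV + real m) * (\<Sum>i=1..m. measure (return borel (Z i \<omega>)) ?A)"
        using polya m c_sets unfolding polya_sequence_def by blast
      moreover have "(\<Sum>i=1..m. measure (return borel (Z i \<omega>)) ?A) = real (card {i\<in>{1..m}. classes m \<omega> i = j})" for \<omega>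
      proof -
        have "(\<Sum>i=1..m. measure (return borel (Z i \<omega>)) ?A) = (\<Sum>i=1..m. if classes m \<omega> i = j then 1 else 0)"
          using c_sets by (intro sum.cong) (auto simp: measure_return classes_def split: split_indicator)
        then show ?thesis by (simp add: sum.If_cases Int_def)
      qed
      ultimately show ?thesis
        by (simp add: counts_def weight_def add_divide_distrib)
    qed
    have i: "integrable W (\<lambda>\<omega>. f (classes m \<omega>) * indicator (Z (Suc m) -` ?A \<inter> space W) \<omega>)"
      using As integrable_fun_classes[of f m] by (rule integrable_real_mult_indicator)
    have "(\<integral>\<omega>. f (classes m \<omega>) * indicator (Z (Suc m) -` ?A \<inter> space W) \<omega> \<partial>W) =
        (\<integral>\<omega>. f (classes m \<omega>) * real_cond_exp W (past m) (indicator (Z (Suc m) -` ?A \<inter> space W)) \<omega> \<partial>W)"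
      using As by (intro S.real_cond_exp_intg(2)[symmetric] i measurable_fun_classes_past) auto
    also have "\<dots> = (\<integral>\<omega>. f (classes m \<omega>) * (counts m (classes m \<omega>) j / (measure \<alpha> UNIV + real m)) \<partial>W)"
    proof (rule integral_cong_AE)
      show "AE \<omega> in W. f (classes m \<omega>) * real_cond_exp W (past m) (indicator (Z (Suc m) -` ?A \<inter> space W)) \<omega> =
        f (classes m \<omega>) * (counts m (classes m \<omega>) j / (measure \<alpha> UNIV + real m))"
        using ce by eventually_elim simp
      show "(\<lambda>\<omega>. f (classes m \<omega>) * (counts m (classes m \<omega>) j / (measure \<alpha> UNIV + real m))) \<in> borel_measurable W"
        by (rule measurable_fun_classes[of "\<lambda>x. f x * (counts m x j / (measure \<alpha> UNIV + real m))"])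
    qed (use measurable_fun_classes[of f m] in measurable)
    finally show ?thesis unfolding A by simp
  qed
qed

lemma counts_nonneg: "0 \<le> counts m x j"
  by (simp add: counts_def weight_nonneg)

lemma sum_counts: "(\<Sum>j\<in>I. counts m (classes m \<omega>) j) = measure \<alpha> UNIV + real m"
proof -
  have "(\<Sum>j\<in>I. real (card {i\<in>{1..m}. classes m \<omega> i = j})) = real (card {1..m})"
    by (rule sum_real_card_fibers) (use finite_I c_I in \<open>auto simp: classes_def\<close>)
  then show ?thesis by (simp add: counts_def sum.distrib sum_weight)
qed

text \<open>A martingale argument: given the past, the next class is \<open>j\<close> with
  probability proportional to \<open>counts m x j\<close>, and by
  \<open>gamma_prod_size_bias_mixture\<close> this average over updated parameters reproduces the
  current value. The expectation is thus the same for every sample size, and at size 0 it is the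
  prior one. Homogeneity makes \<open>H\<close> a function of the Dirichlet vector.\<close>

theorem nn_integral_gamma_prod_polya:
  assumes H[measurable]: "H \<in> borel_measurable (PiM I (\<lambda>_. borel))" and H1: "\<And>z. H z \<le> 1"
    and hom: "\<And>s z. 0 < s \<Longrightarrow> z \<in> extensional I \<Longrightarrow> H (\<lambda>i\<in>I. s * z i) = H z"
  shows "(\<integral>\<^sup>+\<omega>. (\<integral>\<^sup>+z. H z \<partial>gamma_prod I (\<lambda>j. weight j + real (card {i\<in>{1..m}. c (Z i \<omega>) = j}))) \<partial>W) =
    (\<integral>\<^sup>+z. H z \<partial>gamma_prod I weight)"
proof -
  \<comment> \<open>Real values are needed for \<open>integral_next_class\<close>; the bound
    \<open>H z \<le> 1\<close> makes the passage from \<open>ennreal\<close> lossless.\<close>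
  define r where "r \<beta> = enn2real (\<integral>\<^sup>+z. H z \<partial>gamma_prod I \<beta>)" for \<beta> :: "'i \<Rightarrow> real"
  have R: "(\<integral>\<^sup>+z. H z \<partial>gamma_prod I \<beta>) = ennreal (r \<beta>)" if "\<And>i. 0 \<le> \<beta> i" for \<beta>
  proof -
    interpret gamma_weights I \<beta> by unfold_locales (use finite_I that in auto)
    interpret g: prob_space "gamma_prod I \<beta>" by (rule prob_space_gamma_prod)
    have "(\<integral>\<^sup>+z. H z \<partial>gamma_prod I \<beta>) \<le> (\<integral>\<^sup>+z. 1 \<partial>gamma_prod I \<beta>)" by (intro nn_integral_mono H1)
    then have "(\<integral>\<^sup>+z. H z \<partial>gamma_prod I \<beta>) \<le> 1" using g.emeasure_space_1 by simp
    then show ?thesis unfolding r_def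
      using order_le_less_trans[OF _ ennreal_one_less_top] by (simp add: ennreal_enn2real)
  qed
  have r0: "0 \<le> r \<beta>" for \<beta> by (simp add: r_def)
  have mix: "(\<Sum>j\<in>I. counts m (classes m \<omega>) j * r ((counts m (classes m \<omega>))(j := counts m (classes m \<omega>) j + 1))) =
      (measure \<alpha> UNIV + real m) * r (counts m (classes m \<omega>))" for m \<omega>
  proof -
    let ?\<beta> = "counts m (classes m \<omega>)"
    interpret gamma_weights I ?\<beta> by unfold_locales (use finite_I counts_nonneg in auto)
    have a: "measure \<alpha> UNIV + real m = (\<Sum>j\<in>I. ?\<beta> j)" "0 < measure \<alpha> UNIV + real m"
      using sum_counts \<alpha>(3) by auto
    have "(\<Sum>j\<in>I. ennreal (?\<beta> j) * ennreal (r (?\<beta>(j := ?\<beta> j + 1)))) = ennreal (measure \<alpha> UNIV + real m) * ennreal (r ?\<beta>)"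
      using gamma_prod_size_bias_mixture[OF a H hom] by (simp add: R counts_nonneg add_nonneg_nonneg)
    then have "ennreal (\<Sum>j\<in>I. ?\<beta> j * r (?\<beta>(j := ?\<beta> j + 1))) = ennreal ((measure \<alpha> UNIV + real m) * r ?\<beta>)"
      using a by (simp add: ennreal_mult[symmetric] counts_nonneg r0 sum_ennreal)
    then show ?thesis
      using a by (subst (asm) ennreal_inj) (auto intro!: sum_nonneg mult_nonneg_nonneg simp: counts_nonneg r0)
  qed
  have step: "(\<integral>\<omega>. r (counts m (classes m \<omega>)) \<partial>W) = r weight" for m
  proof (induction m)
    case 0
    have "counts 0 x = weight" for x by (auto simp: counts_def)
    then show ?case by (simp add: W.prob_space)
  next
    case (Suc m)
    let ?a = "measure \<alpha> UNIV + real m"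
    let ?f = "\<lambda>j x. r ((counts m x)(j := counts m x j + 1))"
    let ?E = "\<lambda>j. {\<omega> \<in> space W. c (Z (Suc m) \<omega>) = j}"
    have E: "?E j \<in> sets W" for j
      using measurable_sets[OF measurable_Z c_sets, of "Suc m" j] by (simp add: vimage_def Int_def conj_commute)
    have upd: "counts (Suc m) (classes (Suc m) \<omega>) =
      (counts m (classes m \<omega>))(c (Z (Suc m) \<omega>) := counts m (classes m \<omega>) (c (Z (Suc m) \<omega>)) + 1)" for \<omega>
    proof
      fix j
      have e: "{i\<in>{1..Suc m}. classes (Suc m) \<omega> i = j} =
        {i\<in>{1..m}. classes m \<omega> i = j} \<union> (if c (Z (Suc m) \<omega>) = j then {Suc m} else {})"
        by (auto simp: classes_def le_Suc_eq)
      have "card {i\<in>{1..Suc m}. classes (Suc m) \<omega> i = j} =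
        card {i\<in>{1..m}. classes m \<omega> i = j} + (if c (Z (Suc m) \<omega>) = j then 1 else 0)"
        unfolding e by (subst card_Un_disjoint) auto
      then show "counts (Suc m) (classes (Suc m) \<omega>) j = ((counts m (classes m \<omega>))(c (Z (Suc m) \<omega>) := counts m (classes m \<omega>) (c (Z (Suc m) \<omega>)) + 1)) j"
        by (auto simp: counts_def)
    qed
    have "(\<integral>\<omega>. r (counts (Suc m) (classes (Suc m) \<omega>)) \<partial>W) =
      (\<integral>\<omega>. (\<Sum>j\<in>I. ?f j (classes m \<omega>) * indicator (?E j) \<omega>) \<partial>W)"
    proof (rule Bochner_Integration.integral_cong[OF refl])
      fix \<omega> assume \<omega>: "\<omega> \<in> space W"
      have "(\<Sum>j\<in>I. ?f j (classes m \<omega>) * indicator (?E j) \<omega>) = (\<Sum>j\<in>I. if j = c (Z (Suc m) \<omega>) then ?f j (classes m \<omega>) else 0)"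
        using \<omega> by (intro sum.cong) auto
      also have "\<dots> = ?f (c (Z (Suc m) \<omega>)) (classes m \<omega>)"
        using finite_I c_I by (simp add: sum.delta')
      finally show "r (counts (Suc m) (classes (Suc m) \<omega>)) = (\<Sum>j\<in>I. ?f j (classes m \<omega>) * indicator (?E j) \<omega>)"
        unfolding upd by simp
    qed
    also have "\<dots> = (\<Sum>j\<in>I. \<integral>\<omega>. ?f j (classes m \<omega>) * indicator (?E j) \<omega> \<partial>W)"
      by (intro Bochner_Integration.integral_sum integrable_real_mult_indicator E integrable_fun_classes[of "?f _"])
    also have "\<dots> = (\<Sum>j\<in>I. (\<integral>\<omega>. ?f j (classes m \<omega>) * counts m (classes m \<omega>) j \<partial>W) / ?a)"
      by (intro sum.cong refl integral_next_class)
    also have "\<dots> = (\<Sum>j\<in>I. (\<integral>\<omega>. ?f j (classes m \<omega>) * counts m (classes m \<omega>) j \<partial>W)) / ?a"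
      by (simp add: sum_divide_distrib)
    also have "(\<Sum>j\<in>I. (\<integral>\<omega>. ?f j (classes m \<omega>) * counts m (classes m \<omega>) j \<partial>W)) =
      (\<integral>\<omega>. (\<Sum>j\<in>I. ?f j (classes m \<omega>) * counts m (classes m \<omega>) j) \<partial>W)"
      by (rule Bochner_Integration.integral_sum[symmetric])
         (rule integrable_fun_classes[of "\<lambda>x. ?f _ x * counts m x _"])
    also have "\<dots> = (\<integral>\<omega>. ?a * r (counts m (classes m \<omega>)) \<partial>W)"
      using mix by (simp add: mult.commute)
    also have "\<dots> = ?a * r weight" using Suc by simp
    finally show ?case using \<alpha>(3) by simp
  qed
  have "(\<integral>\<^sup>+\<omega>. (\<integral>\<^sup>+z. H z \<partial>gamma_prod I (\<lambda>j. weight j + real (card {i\<in>{1..m}. c (Z i \<omega>) = j}))) \<partial>W) =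
      (\<integral>\<^sup>+\<omega>. ennreal (r (counts m (classes m \<omega>))) \<partial>W)"
  proof (rule nn_integral_cong)
    fix \<omega>
    have "{i\<in>{1..m}. c (Z i \<omega>) = j} = {i\<in>{1..m}. classes m \<omega> i = j}" for j by (auto simp: classes_def)
    then have "(\<lambda>j. weight j + real (card {i\<in>{1..m}. c (Z i \<omega>) = j})) = counts m (classes m \<omega>)"
      by (simp add: counts_def fun_eq_iff)
    then show "(\<integral>\<^sup>+z. H z \<partial>gamma_prod I (\<lambda>j. weight j + real (card {i\<in>{1..m}. c (Z i \<omega>) = j}))) = ennreal (r (counts m (classes m \<omega>)))"
      by (simp add: R counts_nonneg)
  qed
  also have "\<dots> = ennreal (\<integral>\<omega>. r (counts m (classes m \<omega>)) \<partial>W)"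
    by (rule nn_integral_eq_integral[OF integrable_fun_classes]) (simp add: r0)
  also have "\<dots> = (\<integral>\<^sup>+z. H z \<partial>gamma_prod I weight)"
    using step R[OF weight_nonneg] by simp
  finally show ?thesis .
qed

end

section \<open>Independent innovations\<close>

context prob_space
begin

text \<open>A finite intersection over the array is grouped by rows \<open>c\<close>. Each row
  intersection lies in the sigma-algebra \<open>G c\<close>, so the product formula applies first
  across the rows and then within each row.\<close>

lemma indep_sets_Times:
  assumes F: "\<And>c. c \<in> C \<Longrightarrow> indep_sets (F c) I" and G: "indep_sets G C" and "finite C"
    and sub: "\<And>c i. c \<in> C \<Longrightarrow> i \<in> I \<Longrightarrow> F c i \<subseteq> G c"
    and alg: "\<And>c. c \<in> C \<Longrightarrow> sigma_algebra (space M) (G c)"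
  shows "indep_sets (\<lambda>(c, i). F c i) (C \<times> I)"
proof (rule indep_setsI)
  show "(case x of (c, i) \<Rightarrow> F c i) \<subseteq> events" if "x \<in> C \<times> I" for x
    using F that by (auto simp: indep_sets_def)
  fix A J assume J: "J \<noteq> {}" "J \<subseteq> C \<times> I" "finite J" and A: "\<forall>j\<in>J. A j \<in> (case j of (c, i) \<Rightarrow> F c i)"
  define L where "L c = {i. (c, i) \<in> J}" for c
  have "L c \<subseteq> snd ` J" for c by (force simp: L_def)
  then have L: "finite (L c)" "L c \<subseteq> I" for c
    using J finite_subset[of "L c" "snd ` J"] by (auto simp: L_def)
  have J_eq: "J = Sigma C L" using J by (auto simp: L_def)
  \<comment> \<open>An empty row contributes the whole space, which is neutral for the intersection
    and, having probability 1, for the product.\<close>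
  define B where "B c = (if L c = {} then space M else (\<Inter>i\<in>L c. A (c, i)))" for c
  have AF: "A (c, i) \<in> F c i" if "c \<in> C" "i \<in> L c" for c i
    using A that by (auto simp: L_def)
  have AG: "A (c, i) \<in> G c" if "c \<in> C" "i \<in> L c" for c i
    using AF[OF that] sub[of c i] that L by auto
  have BG: "B c \<in> G c" if "c \<in> C" for c
  proof -
    interpret sigma_algebra "space M" "G c" by (rule alg[OF that])
    show ?thesis unfolding B_def using L AG[OF that] by (auto intro!: finite_INT)
  qed
  have sp: "A (c, i) \<subseteq> space M" if "c \<in> C" "i \<in> L c" for c i
  proof -
    have "F c i \<subseteq> events" using F[OF that(1)] that(2) L unfolding indep_sets_def by blast
    then show ?thesis using AF[OF that] sets.sets_into_space by blast
  qed
  have pB: "prob (B c) = (\<Prod>i\<in>L c. prob (A (c, i)))" if "c \<in> C" for c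
  proof (cases "L c = {}")
    case False
    then show ?thesis using indep_setsD[OF F[OF that] L(2) False L(1)] AF[OF that] by (simp add: B_def)
  qed (simp add: B_def prob_space)
  have "C \<noteq> {}" using J by auto
  have "(\<Inter>j\<in>J. A j) = (\<Inter>c\<in>C. B c)"
  proof (intro equalityI subsetI)
    fix x assume x: "x \<in> (\<Inter>j\<in>J. A j)"
    obtain c0 i0 where "(c0, i0) \<in> J" using J(1) by auto
    then have "x \<in> space M" using x sp[of c0 i0] unfolding J_eq by blast
    then show "x \<in> (\<Inter>c\<in>C. B c)" using x unfolding J_eq B_def by auto
  next
    fix x assume x: "x \<in> (\<Inter>c\<in>C. B c)"
    show "x \<in> (\<Inter>j\<in>J. A j)"
    proof
      fix j assume "j \<in> J"
      then obtain c i where j: "j = (c, i)" "c \<in> C" "i \<in> L c" unfolding J_eq by auto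
      then have "x \<in> B c" using x by blast
      then show "x \<in> A j" using j by (auto simp: B_def split: if_splits)
    qed
  qed
  also have "prob \<dots> = (\<Prod>c\<in>C. prob (B c))"
    using BG \<open>C \<noteq> {}\<close> \<open>finite C\<close> by (intro indep_setsD[OF G]) auto
  also have "\<dots> = (\<Prod>c\<in>C. \<Prod>i\<in>L c. prob (A (c, i)))" using pB by simp
  also have "\<dots> = (\<Prod>j\<in>J. prob (A j))"
    unfolding J_eq using \<open>finite C\<close> L by (subst prod.Sigma) (auto simp: case_prod_beta)
  finally show "prob (\<Inter>j\<in>J. A j) = (\<Prod>j\<in>J. prob (A j))" .
qed

text \<open>Used for \<theta> against \<open>(q, Y)\<close>, for \<open>q\<close> against
  \<open>Y\<close>, and for the past against the next innovation: in each case the two sides are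
  measurable with respect to disjoint blocks of one independent family.\<close>

lemma distr_pair_indep_sigma:
  assumes F: "indep_sets F I" and sub: "J1 \<subseteq> I" "J2 \<subseteq> I" "J1 \<inter> J2 = {}"
    and st: "\<And>i. i \<in> I \<Longrightarrow> Int_stable (F i)"
    and X: "X \<in> measurable (sigma (space M) (\<Union>i\<in>J1. F i)) S"
    and Y: "Y \<in> measurable (sigma (space M) (\<Union>i\<in>J2. F i)) T"
  shows "X \<in> measurable M S" "Y \<in> measurable M T"
    and "distr M (S \<Otimes>\<^sub>M T) (\<lambda>\<omega>. (X \<omega>, Y \<omega>)) = distr M S X \<Otimes>\<^sub>M distr M T Y"
proof -
  have ev: "F i \<subseteq> events" if "i \<in> I" for i using F that by (auto simp: indep_sets_def)
  have pow: "(\<Union>i\<in>J. F i) \<subseteq> Pow (space M)" if "J \<subseteq> I" for J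
    using ev that sets.sets_into_space by blast
  have sets_sig: "sets (sigma (space M) (\<Union>i\<in>J. F i)) = sigma_sets (space M) (\<Union>i\<in>J. F i)" if "J \<subseteq> I" for J
    by (rule sets_measure_of[OF pow[OF that]])
  have le: "sigma_sets (space M) (\<Union>i\<in>J. F i) \<subseteq> events" if "J \<subseteq> I" for J
    using ev that by (intro sets.sigma_sets_subset) auto
  have meas: "Z \<in> measurable M N" "{Z -` A \<inter> space M |A. A \<in> sets N} \<subseteq> sigma_sets (space M) (\<Union>i\<in>J. F i)"
    if J: "J \<subseteq> I" and Z: "Z \<in> measurable (sigma (space M) (\<Union>i\<in>J. F i)) N" for J and Z :: "'a \<Rightarrow> 'z" and N
  proof -
    have sp: "space (sigma (space M) (\<Union>i\<in>J. F i)) = space M"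
      using pow[OF J] by (simp add: space_measure_of)
    have *: "Z -` A \<inter> space M \<in> sigma_sets (space M) (\<Union>i\<in>J. F i)" if "A \<in> sets N" for A
      using measurable_sets[OF Z that] unfolding sets_sig[OF J] sp .
    then show "{Z -` A \<inter> space M |A. A \<in> sets N} \<subseteq> sigma_sets (space M) (\<Union>i\<in>J. F i)" by auto
    show "Z \<in> measurable M N"
      using * le[OF J] measurable_space[OF Z, unfolded sp] by (intro measurableI) auto
  qed
  have "indep_sets (\<lambda>j. sigma_sets (space M) (\<Union>i\<in>case_bool J1 J2 j. F i)) UNIV"
  proof (rule indep_sets_collect_sigma)
    show "indep_sets F (\<Union>j\<in>UNIV. case_bool J1 J2 j)"
      by (rule indep_sets_mono_index[OF _ F]) (use sub in \<open>auto simp: UNIV_bool\<close>)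
    show "disjoint_family_on (case_bool J1 J2) UNIV"
      using sub by (auto simp: disjoint_family_on_def split: bool.splits)
    show "Int_stable (F i)" if "i \<in> case_bool J1 J2 j" for i j
      using st that sub by (cases j) auto
  qed
  then have "indep_set (sigma_sets (space M) (\<Union>i\<in>J1. F i)) (sigma_sets (space M) (\<Union>i\<in>J2. F i))"
    unfolding indep_set_def by (rule indep_sets_cong[THEN iffD1, rotated -1]) (auto split: bool.splits)
  then have ind: "prob (a \<inter> b) = prob a * prob b"
    if "a \<in> sigma_sets (space M) (\<Union>i\<in>J1. F i)" "b \<in> sigma_sets (space M) (\<Union>i\<in>J2. F i)" for a b
    using that by (rule indep_setD)
  show mX[measurable]: "X \<in> measurable M S" and mY[measurable]: "Y \<in> measurable M T"
    by (rule meas(1)[OF sub(1) X], rule meas(1)[OF sub(2) Y])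
  show "distr M (S \<Otimes>\<^sub>M T) (\<lambda>\<omega>. (X \<omega>, Y \<omega>)) = distr M S X \<Otimes>\<^sub>M distr M T Y"
  proof (rule pair_measure_eqI[symmetric])
    show "sigma_finite_measure (distr M S X)" "sigma_finite_measure (distr M T Y)"
      by (intro prob_space_imp_sigma_finite prob_space_distr mX mY)+
    fix A B assume "A \<in> sets (distr M S X)" "B \<in> sets (distr M T Y)"
    then have A[measurable]: "A \<in> sets S" and B[measurable]: "B \<in> sets T" by auto
    have "(\<lambda>\<omega>. (X \<omega>, Y \<omega>)) -` (A \<times> B) \<inter> space M = (X -` A \<inter> space M) \<inter> (Y -` B \<inter> space M)" by auto
    moreover have "X -` A \<inter> space M \<in> sigma_sets (space M) (\<Union>i\<in>J1. F i)"
      "Y -` B \<inter> space M \<in> sigma_sets (space M) (\<Union>i\<in>J2. F i)"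
      using A B meas(2)[OF sub(1) X] meas(2)[OF sub(2) Y] by blast+
    ultimately show "emeasure (distr M S X) A * emeasure (distr M T Y) B =
        emeasure (distr M (S \<Otimes>\<^sub>M T) (\<lambda>\<omega>. (X \<omega>, Y \<omega>))) (A \<times> B)"
      by (simp add: emeasure_distr emeasure_eq_measure ennreal_mult[symmetric] ind)
  qed (simp cong: sets_pair_measure_cong)
qed

end

lemma Int_stable_preimages: "Int_stable {X -` A \<inter> S |A. A \<in> sets N}"
proof (rule Int_stableI)
  fix a b assume "a \<in> {X -` A \<inter> S |A. A \<in> sets N}" "b \<in> {X -` A \<inter> S |A. A \<in> sets N}"
  then obtain A B where "a = X -` A \<inter> S" "b = X -` B \<inter> S" "A \<in> sets N" "B \<in> sets N" by auto
  then have "a \<inter> b = X -` (A \<inter> B) \<inter> S" "A \<inter> B \<in> sets N" by auto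
  then show "a \<inter> b \<in> {X -` A \<inter> S |A. A \<in> sets N}" by blast
qed

lemma preimage_in_generated_by:
  assumes X: "\<And>i. i \<in> I \<Longrightarrow> X i \<in> measurable \<Omega> N" and i: "i \<in> I"
  shows "{X i -` A \<inter> space \<Omega> |A. A \<in> sets N} \<subseteq> sets (generated_by \<Omega> N I X)"
proof -
  have r: "(\<lambda>\<omega>. \<lambda>i\<in>I. X i \<omega>) \<in> measurable \<Omega> (PiM I (\<lambda>_. N))"
    by (rule measurable_restrict) (rule X)
  have "(\<lambda>\<omega>. \<lambda>i\<in>I. X i \<omega>) \<in> measurable (generated_by \<Omega> N I X) (PiM I (\<lambda>_. N))"
    unfolding generated_by_def
    by (intro measurable_vimage_algebra1 Pi_I measurable_space[OF r])
  from measurable_compose[OF this measurable_component_singleton[OF i]]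
  have "X i \<in> measurable (generated_by \<Omega> N I X) N" using i by simp
  then show ?thesis
    using measurable_sets[of "X i" "generated_by \<Omega> N I X" N] by (auto simp: generated_by_def)
qed

locale innovations =
  prob_space \<Omega> for \<Omega> :: "'w measure" +
  fixes \<theta> :: "nat \<Rightarrow> 'w \<Rightarrow> real" and q :: "nat \<Rightarrow> 'w \<Rightarrow> nat \<Rightarrow> real" and Y :: "nat \<Rightarrow> 'w \<Rightarrow> nat \<Rightarrow> 'x::topological_space"
    and n :: nat and B :: "real measure" and Q :: "(nat \<Rightarrow> real) measure" and L :: "(nat \<Rightarrow> 'x) measure"
  assumes ind_\<theta>: "indep_vars (\<lambda>_. borel) \<theta> {1..}"
    and ind_q: "indep_vars (\<lambda>_. PiM {1..n} (\<lambda>_. borel)) q {1..}"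
    and ind_Y: "indep_vars (\<lambda>_. PiM {1..n} (\<lambda>_. borel)) Y {1..}"
    and ind: "indep_sets
           ((!) [sets (generated_by \<Omega> borel {1..} \<theta>),
                 sets (generated_by \<Omega> (PiM {1..n} (\<lambda>_. borel)) {1..} q),
                 sets (generated_by \<Omega> (PiM {1..n} (\<lambda>_. borel)) {1..} Y)]) {..<3}"
    and distr_\<theta>: "\<And>m. m \<ge> 1 \<Longrightarrow> distr \<Omega> borel (\<theta> m) = B"
    and distr_q: "\<And>m. m \<ge> 1 \<Longrightarrow> distr \<Omega> (PiM {1..n} (\<lambda>_. borel)) (q m) = Q"
    and distr_Y: "\<And>m. m \<ge> 1 \<Longrightarrow> distr \<Omega> (PiM {1..n} (\<lambda>_. borel)) (Y m) = L"
begin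

abbreviation "MQ \<equiv> PiM {1..n} (\<lambda>_. borel) :: (nat \<Rightarrow> real) measure"
abbreviation "MY \<equiv> PiM {1..n} (\<lambda>_. borel) :: (nat \<Rightarrow> 'x) measure"
abbreviation "MU \<equiv> borel \<Otimes>\<^sub>M (MQ \<Otimes>\<^sub>M MY)"

definition innovation :: "nat \<Rightarrow> 'w \<Rightarrow> real \<times> (nat \<Rightarrow> real) \<times> (nat \<Rightarrow> 'x)" where
  "innovation m \<omega> = (\<theta> m \<omega>, q m \<omega>, Y m \<omega>)"

text \<open>The pair \<open>(c, m)\<close> names the source (0 for \<theta>, 1 for \<open>q\<close>,
  2 for \<open>Y\<close>) and the time. A single family over all pairs lets independence be
  regrouped by source or by time.\<close>

definition pre :: "nat \<times> nat \<Rightarrow> 'w set set" where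
  "pre = (\<lambda>(c, m). [{\<theta> m -` A \<inter> space \<Omega> |A. A \<in> sets borel}, {q m -` A \<inter> space \<Omega> |A. A \<in> sets MQ},
    {Y m -` A \<inter> space \<Omega> |A. A \<in> sets MY}] ! c)"

lemma measurable_\<theta>: "m \<ge> 1 \<Longrightarrow> \<theta> m \<in> borel_measurable \<Omega>"
  and measurable_q: "m \<ge> 1 \<Longrightarrow> q m \<in> measurable \<Omega> MQ"
  and measurable_Y: "m \<ge> 1 \<Longrightarrow> Y m \<in> measurable \<Omega> MY"
  using ind_\<theta> ind_q ind_Y by (auto simp: indep_vars_def)

lemma less_3_cases: "c < 3 \<Longrightarrow> c = 0 \<or> c = 1 \<or> c = (2::nat)" by auto

lemma pre_simps:
  "pre (0, m) = {\<theta> m -` A \<inter> space \<Omega> |A. A \<in> sets borel}"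
  "pre (1, m) = {q m -` A \<inter> space \<Omega> |A. A \<in> sets MQ}"
  "pre (2, m) = {Y m -` A \<inter> space \<Omega> |A. A \<in> sets MY}"
  by (simp_all add: pre_def)

lemma indep_sets_pre: "indep_sets pre ({..<3} \<times> {1..})"
proof -
  let ?F = "\<lambda>c m. pre (c, m)"
  have F: "indep_sets (?F c) {1..}" if "c \<in> {..<3}" for c
  proof -
    have "c = 0 \<or> c = 1 \<or> c = 2" using that less_3_cases by simp
    then show ?thesis
      by (elim disjE) (use ind_\<theta> ind_q ind_Y in \<open>simp_all only: pre_simps indep_vars_def2\<close>)
  qed
  have alg: "sigma_algebra (space \<Omega>) ([sets (generated_by \<Omega> borel {1..} \<theta>),
      sets (generated_by \<Omega> MQ {1..} q), sets (generated_by \<Omega> MY {1..} Y)] ! c)" if "c \<in> {..<3}" for c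
  proof -
    have sa': "sigma_algebra (space \<Omega>) (sets (generated_by \<Omega> borel {1..} \<theta>))"
      using sets.sigma_algebra_axioms[of "generated_by \<Omega> borel {1..} \<theta>"] by (simp add: generated_by_def)
    have sb: "sigma_algebra (space \<Omega>) (sets (generated_by \<Omega> MQ {1..} q))"
      using sets.sigma_algebra_axioms[of "generated_by \<Omega> MQ {1..} q"] by (simp add: generated_by_def)
    have sc: "sigma_algebra (space \<Omega>) (sets (generated_by \<Omega> MY {1..} Y))"
      using sets.sigma_algebra_axioms[of "generated_by \<Omega> MY {1..} Y"] by (simp add: generated_by_def)
    have "c = 0 \<or> c = 1 \<or> c = 2" using that less_3_cases by simp
    then show ?thesis by (elim disjE) (use sa' sb sc in simp_all)
  qed
  have sub: "?F c m \<subseteq> [sets (generated_by \<Omega> borel {1..} \<theta>),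
      sets (generated_by \<Omega> MQ {1..} q), sets (generated_by \<Omega> MY {1..} Y)] ! c" if "c \<in> {..<3}" "m \<in> {1..}" for c m
  proof -
    have P: "pre (0, m) \<subseteq> sets (generated_by \<Omega> borel {1..} \<theta>)"
      "pre (1, m) \<subseteq> sets (generated_by \<Omega> MQ {1..} q)" "pre (2, m) \<subseteq> sets (generated_by \<Omega> MY {1..} Y)"
      unfolding pre_simps
      by (rule preimage_in_generated_by; use that measurable_\<theta> measurable_q measurable_Y in blast)+
    have "c = 0 \<or> c = 1 \<or> c = 2" using that less_3_cases by simp
    then show ?thesis by (elim disjE) (use P in simp_all)
  qed
  have "indep_sets (\<lambda>(c, m). ?F c m) ({..<3} \<times> {1..})"
    by (rule indep_sets_Times[OF F ind _ sub alg]) simp_all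
  then show ?thesis by (simp add: case_prod_beta)
qed

lemma Int_stable_pre: "x \<in> {..<3} \<times> {1..} \<Longrightarrow> Int_stable (pre x)"
  using less_3_cases[of "fst x"] by (cases x) (auto simp: pre_def Int_stable_preimages)

lemma pre_subset_Pow: "J \<subseteq> {..<3} \<times> {1..} \<Longrightarrow> (\<Union>i\<in>J. pre i) \<subseteq> Pow (space \<Omega>)"
  using less_3_cases by (fastforce simp: pre_def)

lemma measurable_sigma_pre:
  assumes J: "J \<subseteq> {..<3} \<times> {1..}" and c: "(c, m) \<in> J"
    and X: "pre (c, m) = {X -` A \<inter> space \<Omega> |A. A \<in> sets N}" "X \<in> measurable \<Omega> N"
  shows "X \<in> measurable (sigma (space \<Omega>) (\<Union>i\<in>J. pre i)) N"
proof (rule measurableI)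
  fix A assume "A \<in> sets N"
  then have "X -` A \<inter> space \<Omega> \<in> (\<Union>i\<in>J. pre i)" using X(1) c by blast
  then show "X -` A \<inter> space (sigma (space \<Omega>) (\<Union>i\<in>J. pre i)) \<in> sets (sigma (space \<Omega>) (\<Union>i\<in>J. pre i))"
    using pre_subset_Pow[OF J] by (simp add: sets_measure_of)
qed (use measurable_space[OF X(2)] pre_subset_Pow[OF J] in \<open>simp add: space_measure_of\<close>)

lemma measurable_innovation: "m \<ge> 1 \<Longrightarrow> innovation m \<in> measurable \<Omega> MU"
  unfolding innovation_def[abs_def] using measurable_\<theta> measurable_q measurable_Y by simp

lemma distr_\<theta>_qY:
  assumes m: "m \<ge> 1"
  shows "distr \<Omega> MU (\<lambda>\<omega>. (\<theta> m \<omega>, (q m \<omega>, Y m \<omega>))) =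
    distr \<Omega> borel (\<theta> m) \<Otimes>\<^sub>M distr \<Omega> (MQ \<Otimes>\<^sub>M MY) (\<lambda>\<omega>. (q m \<omega>, Y m \<omega>))"
proof (rule distr_pair_indep_sigma(3)[OF indep_sets_pre, of "{(0, m)}" "{(1, m), (2, m)}"])
  show "\<theta> m \<in> measurable (sigma (space \<Omega>) (\<Union>i\<in>{(0, m)}. pre i)) borel"
    by (rule measurable_sigma_pre[OF _ _ pre_simps(1)]) (use m measurable_\<theta> in auto)
  have "q m \<in> measurable (sigma (space \<Omega>) (\<Union>i\<in>{(1, m), (2, m)}. pre i)) MQ"
    by (rule measurable_sigma_pre[OF _ _ pre_simps(2)]) (use m measurable_q in auto)
  moreover have "Y m \<in> measurable (sigma (space \<Omega>) (\<Union>i\<in>{(1, m), (2, m)}. pre i)) MY"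
    by (rule measurable_sigma_pre[OF _ _ pre_simps(3)]) (use m measurable_Y in auto)
  ultimately show "(\<lambda>\<omega>. (q m \<omega>, Y m \<omega>)) \<in> measurable (sigma (space \<Omega>) (\<Union>i\<in>{(1, m), (2, m)}. pre i)) (MQ \<Otimes>\<^sub>M MY)"
    by (rule measurable_Pair)
qed (use m Int_stable_pre in auto)

lemma distr_q_Y:
  assumes m: "m \<ge> 1"
  shows "distr \<Omega> (MQ \<Otimes>\<^sub>M MY) (\<lambda>\<omega>. (q m \<omega>, Y m \<omega>)) = distr \<Omega> MQ (q m) \<Otimes>\<^sub>M distr \<Omega> MY (Y m)"
proof (rule distr_pair_indep_sigma(3)[OF indep_sets_pre, of "{(1, m)}" "{(2, m)}"])
  show "q m \<in> measurable (sigma (space \<Omega>) (\<Union>i\<in>{(1, m)}. pre i)) MQ"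
    by (rule measurable_sigma_pre[OF _ _ pre_simps(2)]) (use m measurable_q in auto)
  show "Y m \<in> measurable (sigma (space \<Omega>) (\<Union>i\<in>{(2, m)}. pre i)) MY"
    by (rule measurable_sigma_pre[OF _ _ pre_simps(3)]) (use m measurable_Y in auto)
qed (use m Int_stable_pre in auto)

lemma distr_innovation: "m \<ge> 1 \<Longrightarrow> distr \<Omega> MU (innovation m) = B \<Otimes>\<^sub>M (Q \<Otimes>\<^sub>M L)"
  using distr_\<theta>_qY[of m] distr_q_Y[of m]
  unfolding innovation_def[abs_def] by (simp only: distr_\<theta> distr_q distr_Y)

lemma distr_past_innovation:
  "distr \<Omega> (PiM {1..m} (\<lambda>_. MU) \<Otimes>\<^sub>M MU) (\<lambda>\<omega>. (\<lambda>i\<in>{1..m}. innovation i \<omega>, innovation (Suc m) \<omega>)) =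
    distr \<Omega> (PiM {1..m} (\<lambda>_. MU)) (\<lambda>\<omega>. \<lambda>i\<in>{1..m}. innovation i \<omega>) \<Otimes>\<^sub>M distr \<Omega> MU (innovation (Suc m))"
proof (rule distr_pair_indep_sigma(3)[OF indep_sets_pre, of "{..<3} \<times> {1..m}" "{..<3} \<times> {Suc m}"])
  have i: "innovation i \<in> measurable (sigma (space \<Omega>) (\<Union>i\<in>{..<3} \<times> J. pre i)) MU"
    if "i \<in> J" "J \<subseteq> {1..}" for i J
    unfolding innovation_def[abs_def]
  proof (intro measurable_Pair)
    have i1: "1 \<le> i" using that by auto
    show "\<theta> i \<in> measurable (sigma (space \<Omega>) (\<Union>i\<in>{..<3} \<times> J. pre i)) borel"
      by (rule measurable_sigma_pre[OF _ _ pre_simps(1)]) (use that measurable_\<theta>[OF i1] in auto)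
    show "q i \<in> measurable (sigma (space \<Omega>) (\<Union>i\<in>{..<3} \<times> J. pre i)) MQ"
      by (rule measurable_sigma_pre[OF _ _ pre_simps(2)]) (use that measurable_q[OF i1] in auto)
    show "Y i \<in> measurable (sigma (space \<Omega>) (\<Union>i\<in>{..<3} \<times> J. pre i)) MY"
      by (rule measurable_sigma_pre[OF _ _ pre_simps(3)]) (use that measurable_Y[OF i1] in auto)
  qed
  show "(\<lambda>\<omega>. \<lambda>i\<in>{1..m}. innovation i \<omega>) \<in> measurable (sigma (space \<Omega>) (\<Union>i\<in>{..<3} \<times> {1..m}. pre i)) (PiM {1..m} (\<lambda>_. MU))"
    by (intro measurable_restrict i) auto
  show "innovation (Suc m) \<in> measurable (sigma (space \<Omega>) (\<Union>i\<in>{..<3} \<times> {Suc m}. pre i)) MU"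
    by (intro i) auto
qed (use Int_stable_pre in auto)

end

section \<open>The Markov property of a recursion driven by innovations\<close>

context innovations
begin

text \<open>The state is expressed by the innovations alone, so that the chain up to time
  \<open>m\<close> factors through the vector of innovations 1 to \<open>m\<close>; the start
  \<open>g0\<close> is deterministic.\<close>

primrec unroll :: "(real \<Rightarrow> real \<times> (nat \<Rightarrow> real) \<times> (nat \<Rightarrow> 'x) \<Rightarrow> real) \<Rightarrow> real \<Rightarrow> nat \<Rightarrow>
    (nat \<Rightarrow> real \<times> (nat \<Rightarrow> real) \<times> (nat \<Rightarrow> 'x)) \<Rightarrow> real" where
  "unroll \<Phi> g0 0 u = g0"
| "unroll \<Phi> g0 (Suc k) u = \<Phi> (unroll \<Phi> g0 k u) (u (Suc k))"

lemma measurable_unroll: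
  fixes \<Phi> :: "real \<Rightarrow> real \<times> (nat \<Rightarrow> real) \<times> (nat \<Rightarrow> 'x) \<Rightarrow> real"
  assumes \<Phi>: "case_prod \<Phi> \<in> borel_measurable (borel \<Otimes>\<^sub>M MU)" and "k \<le> m"
  shows "unroll \<Phi> g0 k \<in> borel_measurable (PiM {1..m} (\<lambda>_. MU))"
  using assms(2)
proof (induction k)
  case 0
  have "unroll \<Phi> g0 0 = (\<lambda>_. g0)" by (rule ext) simp
  then show ?case by simp
next
  case (Suc k)
  have e: "unroll \<Phi> g0 (Suc k) = (\<lambda>u. \<Phi> (unroll \<Phi> g0 k u) (u (Suc k)))" by (rule ext) simp
  have "(\<lambda>u. u (Suc k)) \<in> measurable (PiM {1..m} (\<lambda>_. MU)) MU"
    by (rule measurable_component_singleton) (use Suc.prems in auto)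
  from measurable_compose[OF measurable_Pair[OF Suc.IH this] \<Phi>] show ?case
    unfolding e using Suc.prems by simp
qed

text \<open>The past of the chain is a function of innovations 1 to \<open>m\<close>, which are
  independent of innovation \<open>Suc m\<close>. Integrating the latter out first leaves the kernel
  at \<open>G m \<omega>\<close>, and this is measurable with respect to the sigma-algebra generated
  by the chain, as the characterisation of conditional expectation demands.\<close>

lemma markov_chain_innovations:
  fixes \<Phi> :: "real \<Rightarrow> real \<times> (nat \<Rightarrow> real) \<times> (nat \<Rightarrow> 'x) \<Rightarrow> real"
  assumes \<Phi>: "case_prod \<Phi> \<in> borel_measurable (borel \<Otimes>\<^sub>M MU)"
    and G_0: "\<And>\<omega>. G 0 \<omega> = g0" and G_Suc: "\<And>m \<omega>. G (Suc m) \<omega> = \<Phi> (G m \<omega>) (innovation (Suc m) \<omega>)"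
    and K: "K \<in> measurable borel (prob_algebra borel)"
    and K_eq: "\<And>x. K x = distr (B \<Otimes>\<^sub>M (Q \<Otimes>\<^sub>M L)) borel (\<Phi> x)"
  shows "markov_chain \<Omega> borel K G"
  unfolding markov_chain_def
proof (intro conjI allI ballI)
  show "K \<in> measurable borel (prob_algebra borel)" by (rule K)
  let ?U = "\<lambda>m \<omega>. \<lambda>i\<in>{1..m}. innovation i \<omega>" and ?PU = "\<lambda>m. PiM {1..m} (\<lambda>_. MU)"
  have U[measurable]: "?U m \<in> measurable \<Omega> (?PU m)" for m
    by (intro measurable_restrict measurable_innovation) auto
  have G_eq: "G k \<omega> = unroll \<Phi> g0 k (?U m \<omega>)" if "k \<le> m" for k m \<omega>
    using that by (induction k) (auto simp: G_0 G_Suc)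
  note mu = measurable_unroll[OF \<Phi>]
  show mG: "G m \<in> borel_measurable \<Omega>" for m
  proof -
    have "G m = (\<lambda>\<omega>. unroll \<Phi> g0 m (?U m \<omega>))" using G_eq by auto
    then show ?thesis using measurable_compose[OF U mu[OF order_refl]] by simp
  qed
  fix m and A :: "real set" assume A[measurable]: "A \<in> sets borel"
  let ?F = "generated_by \<Omega> borel {0..m} G"
  have vec: "(\<lambda>\<omega>. \<lambda>i\<in>{0..m}. G i \<omega>) \<in> measurable \<Omega> (PiM {0..m} (\<lambda>_. borel))"
    by (intro measurable_restrict mG)
  have vecF: "(\<lambda>\<omega>. \<lambda>i\<in>{0..m}. G i \<omega>) \<in> measurable ?F (PiM {0..m} (\<lambda>_. borel))"
    unfolding generated_by_def by (intro measurable_vimage_algebra1 Pi_I measurable_space[OF vec])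
  have "subalgebra \<Omega> ?F"
    using vec unfolding subalgebra_def generated_by_def by (simp add: measurable_iff_sets)
  then interpret S: finite_measure_subalgebra \<Omega> ?F by unfold_locales
  have GmF: "G m \<in> borel_measurable ?F"
    using measurable_compose[OF vecF measurable_component_singleton[of m]] by simp
  have emK: "(\<lambda>x. emeasure (K x) A) \<in> borel_measurable borel"
    by (rule measurable_compose[OF measurable_prob_algebraD[OF K] measurable_emeasure_subprob_algebra]) (rule A)
  then have mK[measurable]: "(\<lambda>x. measure (K x) A) \<in> borel_measurable borel"
    unfolding measure_def by measurable
  have pK: "prob_space (K x)" for x
    using measurable_space[OF K, of x] by (simp add: space_prob_algebra)
  have K1: "measure (K x) A \<le> 1" for x using pK by (rule prob_space.prob_le_1)
  note [measurable] = mG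
  have As: "G (Suc m) -` A \<inter> space \<Omega> \<in> sets \<Omega>" by measurable
  \<comment> \<open>\<open>R\<close> rebuilds \<open>G 0\<close> to \<open>G m\<close> from the
    innovations. An event \<open>E\<close> of the past of the chain, given by a set \<open>C\<close>
    of trajectories, thus becomes an event about the innovations.\<close>
  define R where "R u = (\<lambda>i\<in>{0..m}. unroll \<Phi> g0 i u)" for u
  have R: "R \<in> measurable (?PU m) (PiM {0..m} (\<lambda>_. borel))"
    unfolding R_def by (intro measurable_restrict mu) auto
  show "AE \<omega> in \<Omega>. real_cond_exp \<Omega> ?F (indicator (G (Suc m) -` A \<inter> space \<Omega>)) \<omega> = measure (K (G m \<omega>)) A"
  proof (rule S.real_cond_exp_charact)
    show "integrable \<Omega> (indicator (G (Suc m) -` A \<inter> space \<Omega>) :: 'w \<Rightarrow> real)"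
      using As by (intro integrable_real_indicator) (auto simp: emeasure_eq_measure)
    show "integrable \<Omega> (\<lambda>\<omega>. measure (K (G m \<omega>)) A)"
      by (intro integrable_const_bound[where B = 1]) (use K1 in auto)
    show "(\<lambda>\<omega>. measure (K (G m \<omega>)) A) \<in> borel_measurable ?F"
      by (rule measurable_compose[OF GmF mK])
    fix E assume E: "E \<in> sets ?F"
    then have Es[measurable]: "E \<in> sets \<Omega>" using S.subalg by (auto simp: subalgebra_def)
    from E obtain C where C: "C \<in> sets (PiM {0..m} (\<lambda>_. borel))"
      and E_eq: "E = (\<lambda>\<omega>. \<lambda>i\<in>{0..m}. G i \<omega>) -` C \<inter> space \<Omega>"
      unfolding generated_by_def using measurable_space[OF vec]
      by (subst (asm) sets_vimage_algebra2) auto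
    have vR: "(\<lambda>i\<in>{0..m}. G i \<omega>) = R (?U m \<omega>)" for \<omega>
      unfolding R_def by (intro restrict_ext G_eq) auto
    have iC[measurable]: "(\<lambda>u. indicator C (R u) :: ennreal) \<in> borel_measurable (?PU m)"
      by (rule measurable_compose[OF R]) (use C in measurable)
    have m\<Phi>: "(\<lambda>z. \<Phi> (unroll \<Phi> g0 m (fst z)) (snd z)) \<in> borel_measurable (?PU m \<Otimes>\<^sub>M MU)"
      using measurable_compose[OF measurable_Pair[OF measurable_compose[OF measurable_fst mu[OF order_refl]] measurable_snd] \<Phi>]
      by simp
    have m2: "(\<lambda>z. indicator C (R (fst z)) * indicator A (\<Phi> (unroll \<Phi> g0 m (fst z)) (snd z)) :: ennreal) \<in> borel_measurable (?PU m \<Otimes>\<^sub>M MU)"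
      using m\<Phi> by measurable
    let ?D = "distr \<Omega> (?PU m) (?U m)" and ?X = "B \<Otimes>\<^sub>M (Q \<Otimes>\<^sub>M L)"
    have X: "?X = distr \<Omega> MU (innovation (Suc m))" by (rule distr_innovation[symmetric]) simp
    interpret X: prob_space ?X unfolding X by (intro prob_space_distr measurable_innovation) simp
    have sX[measurable_cong]: "sets ?X = sets MU" unfolding X by simp
    have "(\<integral>\<^sup>+\<omega>. ennreal (indicator E \<omega> *\<^sub>R indicator (G (Suc m) -` A \<inter> space \<Omega>) \<omega>) \<partial>\<Omega>) =
      (\<integral>\<^sup>+\<omega>. indicator C (R (?U m \<omega>)) * indicator A (\<Phi> (unroll \<Phi> g0 m (?U m \<omega>)) (innovation (Suc m) \<omega>)) \<partial>\<Omega>)"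
    proof (rule nn_integral_cong)
      fix \<omega> assume "\<omega> \<in> space \<Omega>"
      moreover have "G (Suc m) \<omega> = \<Phi> (unroll \<Phi> g0 m (?U m \<omega>)) (innovation (Suc m) \<omega>)"
        unfolding G_Suc by (subst G_eq[OF order_refl]) simp
      ultimately show "ennreal (indicator E \<omega> *\<^sub>R indicator (G (Suc m) -` A \<inter> space \<Omega>) \<omega>) =
        indicator C (R (?U m \<omega>)) * indicator A (\<Phi> (unroll \<Phi> g0 m (?U m \<omega>)) (innovation (Suc m) \<omega>))"
        unfolding E_eq vR by (simp split: split_indicator)
    qed
    also have "\<dots> = (\<integral>\<^sup>+z. indicator C (R (fst z)) * indicator A (\<Phi> (unroll \<Phi> g0 m (fst z)) (snd z))
        \<partial>distr \<Omega> (?PU m \<Otimes>\<^sub>M MU) (\<lambda>\<omega>. (?U m \<omega>, innovation (Suc m) \<omega>)))"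
      by (subst nn_integral_distr[OF measurable_Pair[OF U measurable_innovation]]) (use m2 in simp_all)
    also have "\<dots> = (\<integral>\<^sup>+u. (\<integral>\<^sup>+v. indicator C (R u) * indicator A (\<Phi> (unroll \<Phi> g0 m u) v) \<partial>?X) \<partial>?D)"
      unfolding distr_past_innovation X[symmetric]
      using m2 by (subst X.nn_integral_fst[symmetric]) (simp_all cong: measurable_cong_sets sets_pair_measure_cong add: sX)
    also have "\<dots> = (\<integral>\<^sup>+u. indicator C (R u) * emeasure (K (unroll \<Phi> g0 m u)) A \<partial>?D)"
    proof (rule nn_integral_cong)
      fix u assume "u \<in> space ?D"
      then have u: "u \<in> space (?PU m)" by simp
      have m\<Phi>u[measurable]: "\<Phi> x \<in> borel_measurable ?X" for x
        using measurable_compose[OF measurable_Pair1'[of x borel MU] \<Phi>] by (simp cong: measurable_cong_sets add: sX)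
      have "(\<integral>\<^sup>+v. indicator A (\<Phi> x v) \<partial>?X) = emeasure (K x) A" for x
      proof -
        have "emeasure (K x) A = (\<integral>\<^sup>+y. indicator A y \<partial>K x)" by (simp add: K_eq)
        also have "\<dots> = (\<integral>\<^sup>+v. indicator A (\<Phi> x v) \<partial>?X)"
          unfolding K_eq by (rule nn_integral_distr) measurable
        finally show ?thesis ..
      qed
      then show "(\<integral>\<^sup>+v. indicator C (R u) * indicator A (\<Phi> (unroll \<Phi> g0 m u) v) \<partial>?X) =
        indicator C (R u) * emeasure (K (unroll \<Phi> g0 m u)) A"
        by (subst nn_integral_cmult) auto
    qed
    also have "\<dots> = (\<integral>\<^sup>+\<omega>. indicator C (R (?U m \<omega>)) * emeasure (K (unroll \<Phi> g0 m (?U m \<omega>))) A \<partial>\<Omega>)"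
      by (rule nn_integral_distr[OF U], unfold measurable_distr_eq1) (intro borel_measurable_times_ennreal iC measurable_compose[OF mu[OF order_refl] emK])
    also have "\<dots> = (\<integral>\<^sup>+\<omega>. ennreal (indicator E \<omega> *\<^sub>R measure (K (G m \<omega>)) A) \<partial>\<Omega>)"
    proof (rule nn_integral_cong)
      fix \<omega> assume "\<omega> \<in> space \<Omega>"
      moreover have "emeasure (K x) A = ennreal (measure (K x) A)" for x
        using pK[of x] finite_measure.emeasure_eq_measure prob_space_def by blast
      ultimately show "indicator C (R (?U m \<omega>)) * emeasure (K (unroll \<Phi> g0 m (?U m \<omega>))) A = ennreal (indicator E \<omega> *\<^sub>R measure (K (G m \<omega>)) A)"
        unfolding E_eq vR[symmetric] G_eq[OF order_refl, symmetric] by (simp split: split_indicator)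
    qed
    finally have eq: "(\<integral>\<^sup>+\<omega>. ennreal (indicator E \<omega> *\<^sub>R indicator (G (Suc m) -` A \<inter> space \<Omega>) \<omega>) \<partial>\<Omega>) =
      (\<integral>\<^sup>+\<omega>. ennreal (indicator E \<omega> *\<^sub>R measure (K (G m \<omega>)) A) \<partial>\<Omega>)" .
    show "(\<integral>\<omega>\<in>E. indicator (G (Suc m) -` A \<inter> space \<Omega>) \<omega> \<partial>\<Omega>) = (\<integral>\<omega>\<in>E. measure (K (G m \<omega>)) A \<partial>\<Omega>)"
      unfolding set_lebesgue_integral_def
      by (subst (1 2) integral_eq_nn_integral) (use As eq in auto)
  qed
qed

end

section \<open>Weak limits of invariant laws and tails of Dirichlet means\<close>

lemma (in affine_recursion) invariant_probability_limit:
  fixes Vk :: "nat \<Rightarrow> 'w \<Rightarrow> real"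
  assumes Vk: "\<And>k. affine_recursion \<Omega> \<theta> (Vk k)" and lim: "\<And>\<omega>. (\<lambda>k. Vk k \<omega>) \<longlonglongrightarrow> V \<omega>"
    and inv: "\<And>k. invariant_probability borel (affine_recursion.kern \<Omega> \<theta> (Vk k)) (\<pi>k k)"
    and \<pi>: "real_distribution \<pi>" and wc: "weak_conv_m \<pi>k \<pi>"
  shows "invariant_probability borel kern \<pi>"
proof -
  interpret \<pi>: real_distribution \<pi> by (rule \<pi>)
  have \<pi>k: "real_distribution (\<pi>k k)" for k
    by (rule affine_recursion.real_distribution_invariant[OF Vk inv])
  have [measurable]: "Vk k \<in> borel_measurable \<Omega>" for k using affine_recursion.V[OF Vk] .
  have "char (\<pi> \<bind> kern) = char \<pi>"
  proof
    fix t
    define f :: "real \<Rightarrow> complex" where "f y = iexp (t * y)" for y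
    have f[measurable]: "f \<in> borel_measurable borel" unfolding f_def by measurable
    have f1: "norm (f y) \<le> 1" for y by (simp add: f_def)
    have fL: "norm (f y - f z) \<le> \<bar>t\<bar> * \<bar>y - z\<bar>" for y z
      unfolding f_def by (rule norm_iexp_diff_le)
    have char_f: "char \<mu> t = (\<integral>y. f y \<partial>\<mu>)" for \<mu> by (simp add: char_def f_def)
    \<comment> \<open>Invariance of \<open>\<pi>k k\<close> says that \<open>f\<close> and
      \<open>hk k\<close> have the same integral under it. The integral of \<open>f\<close>
      converges by weak convergence; that of \<open>hk k\<close> needs \<open>hk k\<close> replaced
      by the fixed continuous function \<open>h\<close>.\<close>
    define h where "h = step_op f"
    define hk where "hk k = affine_recursion.step_op \<Omega> \<theta> (Vk k) f" for k
    have mh[measurable]: "h \<in> borel_measurable borel" unfolding h_def by (rule measurable_step_op[OF f])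
    have mhk[measurable]: "hk k \<in> borel_measurable borel" for k
      unfolding hk_def by (rule affine_recursion.measurable_step_op[OF Vk f])
    have h1: "norm (h y) \<le> 1" for y unfolding h_def by (rule norm_step_op_le[OF f f1])
    have hk1: "norm (hk k y) \<le> 1" for k y
      unfolding hk_def by (rule affine_recursion.norm_step_op_le[OF Vk f f1])
    have hL: "norm (h y - h z) \<le> (contraction_rate * \<bar>t\<bar>) * \<bar>y - z\<bar>" for y z
      unfolding h_def by (rule step_op_lipschitz[OF f f1 fL abs_ge_zero])
    have "isCont h y" for y
    proof -
      have "((\<lambda>z. (contraction_rate * \<bar>t\<bar>) * \<bar>z - y\<bar>) \<longlongrightarrow> (contraction_rate * \<bar>t\<bar>) * \<bar>y - y\<bar>) (at y)"
        by (intro tendsto_intros)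
      then have "((\<lambda>z. (contraction_rate * \<bar>t\<bar>) * \<bar>z - y\<bar>) \<longlongrightarrow> 0) (at y)" by simp
      then have "((\<lambda>z. h z - h y) \<longlongrightarrow> 0) (at y)"
        by (rule Lim_null_comparison[OF always_eventually, rotated]) (intro allI hL)
      then show ?thesis unfolding isCont_def by (rule LIM_zero_cancel)
    qed
    then have l1: "(\<lambda>k. \<integral>y. h y \<partial>\<pi>k k) \<longlonglongrightarrow> (\<integral>y. h y \<partial>\<pi>)"
      by (intro weak_conv_imp_integral_bdd_continuous_conv[OF \<pi>k \<pi> wc _ h1])
    \<comment> \<open>\<open>\<epsilon> k\<close> bounds the distance of \<open>hk k\<close> and
      \<open>h\<close> uniformly in the starting point, which cancels in the coupling; uniformity is
      needed because the measure \<open>\<pi>k k\<close> moves as well. The cap 2, from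
      \<open>norm (f y) \<le> 1\<close>, permits dominated convergence without any moment of
      \<open>V\<close>.\<close>
    define \<epsilon> where "\<epsilon> k = (\<integral>\<omega>. min 2 (\<bar>t\<bar> * \<bar>Vk k \<omega> - V \<omega>\<bar>) \<partial>\<Omega>)" for k
    have \<epsilon>: "\<epsilon> \<longlonglongrightarrow> 0"
    proof -
      have "(\<lambda>k. \<integral>\<omega>. min 2 (\<bar>t\<bar> * \<bar>Vk k \<omega> - V \<omega>\<bar>) \<partial>\<Omega>) \<longlonglongrightarrow> (\<integral>\<omega>. 0 \<partial>\<Omega>)"
      proof (rule integral_dominated_convergence[where w = "\<lambda>_. 2"])
        show "AE \<omega> in \<Omega>. (\<lambda>k. min 2 (\<bar>t\<bar> * \<bar>Vk k \<omega> - V \<omega>\<bar>)) \<longlonglongrightarrow> 0"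
        proof (rule AE_I2)
          fix \<omega>
          have "(\<lambda>k. min 2 (\<bar>t\<bar> * \<bar>Vk k \<omega> - V \<omega>\<bar>)) \<longlonglongrightarrow> min 2 (\<bar>t\<bar> * \<bar>V \<omega> - V \<omega>\<bar>)"
            by (intro tendsto_intros lim)
          then show "(\<lambda>k. min 2 (\<bar>t\<bar> * \<bar>Vk k \<omega> - V \<omega>\<bar>)) \<longlonglongrightarrow> 0" by simp
        qed
      qed auto
      then show ?thesis by (simp add: \<epsilon>_def[abs_def])
    qed
    have hkh: "norm (hk k y - h y) \<le> \<epsilon> k" for k y
    proof -
      let ?X = "\<lambda>V \<omega>. \<theta> \<omega> * V \<omega> + (1 - \<theta> \<omega>) * y"
      have i: "integrable \<Omega> (\<lambda>\<omega>. f (?X U \<omega>))" if [measurable]: "U \<in> borel_measurable \<Omega>" for U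
        by (intro integrable_const_bound[where B = 1]) (use f1 in auto)
      have e: "hk k y - h y = (\<integral>\<omega>. f (?X (Vk k) \<omega>) - f (?X V \<omega>) \<partial>\<Omega>)"
        unfolding hk_def h_def step_op_def affine_recursion.step_op_def[OF Vk]
        by (rule Bochner_Integration.integral_diff[symmetric]) (intro i affine_recursion.V[OF Vk] V)+
      have "norm (hk k y - h y) \<le> (\<integral>\<omega>. norm (f (?X (Vk k) \<omega>) - f (?X V \<omega>)) \<partial>\<Omega>)"
        unfolding e by (rule integral_norm_bound)
      also have "\<dots> \<le> \<epsilon> k"
        unfolding \<epsilon>_def
      proof (rule integral_mono_AE)
        show "integrable \<Omega> (\<lambda>\<omega>. norm (f (?X (Vk k) \<omega>) - f (?X V \<omega>)))"
          by (rule integrable_norm[OF Bochner_Integration.integrable_diff[OF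
            i[OF affine_recursion.V[OF Vk]] i[OF V]]])
        have "(\<lambda>\<omega>. min 2 (\<bar>t\<bar> * \<bar>Vk k \<omega> - V \<omega>\<bar>)) \<in> borel_measurable \<Omega>" by measurable
        then show "integrable \<Omega> (\<lambda>\<omega>. min 2 (\<bar>t\<bar> * \<bar>Vk k \<omega> - V \<omega>\<bar>))"
          by (intro integrable_const_bound[where B = 2]) auto
        show "AE \<omega> in \<Omega>. norm (f (?X (Vk k) \<omega>) - f (?X V \<omega>)) \<le> min 2 (\<bar>t\<bar> * \<bar>Vk k \<omega> - V \<omega>\<bar>)"
          using \<theta>_pos \<theta>_le_1
        proof eventually_elim
          case (elim \<omega>)
          have "norm (f (?X (Vk k) \<omega>) - f (?X V \<omega>)) \<le> \<bar>t\<bar> * \<bar>?X (Vk k) \<omega> - ?X V \<omega>\<bar>" by (rule fL)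
          also have "?X (Vk k) \<omega> - ?X V \<omega> = \<theta> \<omega> * (Vk k \<omega> - V \<omega>)" by (simp add: algebra_simps)
          also have "\<bar>t\<bar> * \<bar>\<theta> \<omega> * (Vk k \<omega> - V \<omega>)\<bar> \<le> \<bar>t\<bar> * \<bar>Vk k \<omega> - V \<omega>\<bar>"
            using elim by (intro mult_left_mono) (auto simp: abs_mult intro: mult_left_le_one_le)
          finally show ?case
            using norm_triangle_ineq4[of "f (?X (Vk k) \<omega>)" "f (?X V \<omega>)"] f1[of "?X (Vk k) \<omega>"] f1[of "?X V \<omega>"] by simp
        qed
      qed
      finally show ?thesis .
    qed
    have ik: "integrable (\<pi>k k) F" if [measurable]: "F \<in> borel_measurable borel" and "\<And>y. norm (F y) \<le> 1"
      for F :: "real \<Rightarrow> complex" and k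
    proof -
      interpret \<pi>k: real_distribution "\<pi>k k" by (rule \<pi>k)
      show ?thesis by (intro \<pi>k.integrable_const_bound[where B = 1]) (use that in auto)
    qed
    have chk: "char (\<pi>k k) t = (\<integral>y. hk k y \<partial>\<pi>k k)" for k
    proof -
      have "\<pi>k k \<bind> affine_recursion.kern \<Omega> \<theta> (Vk k) = \<pi>k k"
        using inv[of k] by (simp add: invariant_probability_def)
      then show ?thesis
        using affine_recursion.integral_bind_kern[OF Vk \<pi>k f f1, of k k]
        unfolding char_f hk_def by (simp only:)
    qed
    have "(\<lambda>k. (\<integral>y. hk k y \<partial>\<pi>k k) - (\<integral>y. h y \<partial>\<pi>k k)) \<longlonglongrightarrow> 0"
    proof (rule Lim_null_comparison[OF always_eventually \<epsilon>], intro allI)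
      fix k
      interpret \<pi>k: real_distribution "\<pi>k k" by (rule \<pi>k)
      have "norm ((\<integral>y. hk k y \<partial>\<pi>k k) - (\<integral>y. h y \<partial>\<pi>k k)) = norm (\<integral>y. hk k y - h y \<partial>\<pi>k k)"
        by (subst Bochner_Integration.integral_diff) (intro ik mhk mh hk1 h1 refl)+
      also have "\<dots> \<le> (\<integral>y. norm (hk k y - h y) \<partial>\<pi>k k)" by (rule integral_norm_bound)
      also have "\<dots> \<le> (\<integral>y. \<epsilon> k \<partial>\<pi>k k)"
        by (intro integral_mono hkh integrable_norm Bochner_Integration.integrable_diff ik mhk mh hk1 h1 \<pi>k.integrable_const)
      finally show "norm ((\<integral>y. hk k y \<partial>\<pi>k k) - (\<integral>y. h y \<partial>\<pi>k k)) \<le> \<epsilon> k"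
        using \<pi>k.prob_space by simp
    qed
    from tendsto_add[OF this l1] have "(\<lambda>k. char (\<pi>k k) t) \<longlonglongrightarrow> (\<integral>y. h y \<partial>\<pi>)"
      by (simp add: chk)
    moreover have "(\<lambda>k. char (\<pi>k k) t) \<longlonglongrightarrow> char \<pi> t"
      by (rule levy_continuity1[OF \<pi>k \<pi> wc])
    ultimately have "char \<pi> t = (\<integral>y. h y \<partial>\<pi>)" by (rule LIMSEQ_unique[rotated])
    then have "(\<integral>y. f y \<partial>\<pi>) = (\<integral>y. h y \<partial>\<pi>)" unfolding char_f .
    also have "\<dots> = (\<integral>y. f y \<partial>(\<pi> \<bind> kern))"
      unfolding h_def by (rule integral_bind_kern[OF \<pi> f f1, symmetric])
    finally show "char (\<pi> \<bind> kern) t = char \<pi> t" unfolding char_f by (rule sym)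
  qed
  then have "\<pi> \<bind> kern = \<pi>"
    by (intro Levy_uniqueness real_distribution_bind_kern \<pi>)
  then show ?thesis
    unfolding invariant_probability_def using \<pi>.prob_space_axioms by simp
qed

text \<open>In Gamma variables the mean is a ratio \<open>H / S\<close>. If it exceeds
  \<open>c / d\<close>, then \<open>H \<ge> c\<close> or \<open>S < d\<close>. The indicator of the
  first event is at most \<open>(1 - exp (- H / c)) / (1 - exp (- 1))\<close>, that of the second at
  most \<open>exp 1 * exp (- S / d)\<close>, and both expectations are given by Laplace
  transforms.\<close>

lemma (in gamma_weights) dirichlet_tail_le:
  assumes a: "a = (\<Sum>i\<in>I. b i)" "0 < a" and e: "\<And>i. i \<in> I \<Longrightarrow> 0 \<le> e i" and c: "0 < c" and d: "0 < d"
  shows "measure (dirichlet_measure I b) {p \<in> space (dirichlet_measure I b). c / d < (\<Sum>i\<in>I. e i * p i)} \<le>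
    (\<Sum>i\<in>I. b i * ln (1 + e i / c)) / (1 - exp (- 1)) + exp (1 - a * ln (1 + 1 / d))"
proof -
  interpret g: prob_space "gamma_prod I b" by (rule prob_space_gamma_prod)
  let ?S = "\<lambda>z. \<Sum>i\<in>I. z i :: real" and ?H = "\<lambda>z. \<Sum>i\<in>I. e i * z i"
  have L: "(\<integral>z. exp (- (\<Sum>i\<in>I. s i * z i)) \<partial>gamma_prod I b) = exp (- (\<Sum>i\<in>I. b i * ln (1 + s i)))"
    if "\<And>i. i \<in> I \<Longrightarrow> 0 \<le> s i" for s
    using nn_integral_gamma_prod_Laplace[OF that]
    by (subst integral_eq_nn_integral) auto
  have iL: "integrable (gamma_prod I b) (\<lambda>z. exp (- (\<Sum>i\<in>I. s i * z i)))" if "\<And>i. i \<in> I \<Longrightarrow> 0 \<le> s i" for s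
  proof (rule g.integrable_const_bound[where B = 1])
    show "AE z in gamma_prod I b. norm (exp (- (\<Sum>i\<in>I. s i * z i))) \<le> 1"
      using AE_gamma_prod_nonneg by eventually_elim (auto intro!: sum_nonneg mult_nonneg_nonneg that)
  qed measurable
  have e1: "0 < 1 - exp (- 1 :: real)" by simp
  let ?E = "{z \<in> space (gamma_prod I b). c / d < ?H z / ?S z}"
  have E[measurable]: "?E \<in> sets (gamma_prod I b)" by measurable
  have H_eq: "?H (\<lambda>i\<in>I. z i / ?S z) = ?H z / ?S z" for z by (simp add: sum_divide_distrib)
  have "measure (dirichlet_measure I b) {p \<in> space (dirichlet_measure I b). c / d < ?H p} = g.prob ?E"
  proof -
    have "{p \<in> space (gamma_prod I b). c / d < ?H p} \<in> sets (gamma_prod I b)" by measurable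
    then have "{p \<in> extensional I. c / d < ?H p} \<in> sets (PiM I (\<lambda>_. borel))" by simp
    moreover have "(\<lambda>z. \<lambda>i\<in>I. z i / ?S z) -` {p \<in> extensional I. c / d < ?H p} \<inter> space (gamma_prod I b) = ?E"
      by (auto simp only: vimage_eq mem_Collect_eq Int_iff H_eq restrict_extensional space_gamma_prod)
    ultimately show ?thesis
      unfolding dirichlet_measure_eq
      by (subst measure_distr) (simp_all add: space_PiM PiE_def del: restrict_apply)
  qed
  also have "\<dots> = (\<integral>z. indicator ?E z \<partial>gamma_prod I b)"
    using E by (simp add: Int_absorb2 subset_eq)
  also have "\<dots> \<le> (\<integral>z. (1 - exp (- (\<Sum>i\<in>I. e i / c * z i))) / (1 - exp (- 1)) + exp 1 * exp (- (\<Sum>i\<in>I. 1 / d * z i)) \<partial>gamma_prod I b)"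
  proof (rule integral_mono_AE)
    show "integrable (gamma_prod I b) (indicator ?E :: _ \<Rightarrow> real)"
      by (rule integrable_real_indicator[OF E]) (simp add: g.emeasure_eq_measure)
    show "integrable (gamma_prod I b) (\<lambda>z. (1 - exp (- (\<Sum>i\<in>I. e i / c * z i))) / (1 - exp (- 1)) + exp 1 * exp (- (\<Sum>i\<in>I. 1 / d * z i)))"
      using iL[of "\<lambda>i. e i / c"] iL[of "\<lambda>_. 1 / d"] e c d by auto
    show "AE z in gamma_prod I b. indicator ?E z \<le>
        (1 - exp (- (\<Sum>i\<in>I. e i / c * z i))) / (1 - exp (- 1)) + exp 1 * exp (- (\<Sum>i\<in>I. 1 / d * z i))"
      using AE_gamma_prod_nonneg AE_gamma_prod_sum_pos[folded a(1), OF a(2)]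
    proof eventually_elim
      case (elim z)
      have Hc: "(\<Sum>i\<in>I. e i / c * z i) = ?H z / c" and Sd: "(\<Sum>i\<in>I. 1 / d * z i) = ?S z / d"
        by (simp_all add: sum_divide_distrib)
      have H0: "0 \<le> ?H z / c" using elim e c by (auto intro!: divide_nonneg_pos sum_nonneg)
      then have t0: "0 \<le> (1 - exp (- (?H z / c))) / (1 - exp (- 1))" using e1 by simp
      have s0: "0 \<le> exp 1 * exp (- (?S z / d))" by simp
      show ?case
      proof (cases "z \<in> ?E")
        case False
        then show ?thesis unfolding Hc Sd using t0 s0 by simp
      next
        case True
        show ?thesis
        proof (cases "?S z < d")
          case True
          then have "?S z / d \<le> 1" using d by simp
          then have "1 \<le> exp 1 * exp (- (?S z / d))" by (simp add: exp_add[symmetric])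
          then show ?thesis unfolding Hc Sd using t0 by (simp split: split_indicator)
        next
          case False
          have "c / d * ?S z < ?H z" using True elim by (simp add: pos_less_divide_eq)
          moreover have "c \<le> c / d * ?S z" using False c d by (simp add: field_simps)
          ultimately have "1 \<le> ?H z / c" using c by simp
          then have "1 - exp (- 1) \<le> 1 - exp (- (?H z / c))" by simp
          then have "1 \<le> (1 - exp (- (?H z / c))) / (1 - exp (- 1))" using e1 by (simp only: le_divide_eq_1_pos)
          moreover have "indicator ?E z \<le> (1 :: real)" by (rule indicator_le_1)
          ultimately show ?thesis unfolding Hc Sd using s0 by linarith
        qed
      qed
    qed
  qed
  also have "\<dots> = (1 - exp (- (\<Sum>i\<in>I. b i * ln (1 + e i / c)))) / (1 - exp (- 1)) + exp 1 * exp (- (\<Sum>i\<in>I. b i * ln (1 + 1 / d)))"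
  proof -
    have lin: "(\<integral>z. (1 - X z) / k + exp 1 * X' z \<partial>gamma_prod I b) = (1 - (\<integral>z. X z \<partial>gamma_prod I b)) / k + exp 1 * (\<integral>z. X' z \<partial>gamma_prod I b)"
      if "integrable (gamma_prod I b) X" "integrable (gamma_prod I b) X'" for X X' and k :: real
      using that g.prob_space by simp
    show ?thesis
      by (subst lin[OF iL[of "\<lambda>i. e i / c"] iL[of "\<lambda>_. 1 / d"]])
         (use e c d L[of "\<lambda>i. e i / c"] L[of "\<lambda>_. 1 / d"] in simp_all)
  qed
  also have "exp 1 * exp (- (\<Sum>i\<in>I. b i * ln (1 + 1 / d))) = exp (1 - a * ln (1 + 1 / d))"
    by (simp add: a sum_distrib_right exp_add[symmetric])
  \<comment> \<open>The inequality \<open>1 - exp (- x) \<le> x\<close> makes the bound linear in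
    the sum, so that a small \<alpha>-integral of a logarithm will give a small probability.\<close>
  also have "(1 - exp (- (\<Sum>i\<in>I. b i * ln (1 + e i / c)))) / (1 - exp (- 1)) \<le> (\<Sum>i\<in>I. b i * ln (1 + e i / c)) / (1 - exp (- 1))"
    using exp_ge_add_one_self[of "- (\<Sum>i\<in>I. b i * ln (1 + e i / c))"] e1 by (intro divide_right_mono) auto
  finally show ?thesis by simp
qed

section \<open>The functional chain\<close>

lemma integral_finite_classes:
  fixes \<phi> :: "'i \<Rightarrow> real"
  assumes "finite_measure \<mu>" "sets \<mu> = sets borel" and I: "finite I" "\<And>x. c x \<in> I" "\<And>j. c -` {j} \<in> sets borel"
  shows "integrable \<mu> (\<lambda>x. \<phi> (c x))" and "(\<integral>x. \<phi> (c x) \<partial>\<mu>) = (\<Sum>j\<in>I. \<phi> j * measure \<mu> (c -` {j}))"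
proof -
  interpret finite_measure \<mu> by fact
  have c: "c -` {j} \<in> sets \<mu>" for j using assms by simp
  have e: "\<phi> (c x) = (\<Sum>j\<in>I. \<phi> j * indicator (c -` {j}) x)" for x
  proof -
    have "(\<Sum>j\<in>I. \<phi> j * indicator (c -` {j}) x) = (\<Sum>j\<in>I. if j = c x then \<phi> j else 0)"
      by (intro sum.cong) (auto split: split_indicator)
    then show ?thesis using I by (simp add: sum.delta')
  qed
  have i: "integrable \<mu> (\<lambda>x. \<phi> j * indicator (c -` {j}) x)" for j
    using c by (intro integrable_mult_right integrable_real_indicator) (auto simp: emeasure_eq_measure)
  show "integrable \<mu> (\<lambda>x. \<phi> (c x))" unfolding e using i by auto
  have "c -` {j} \<inter> space \<mu> = c -` {j}" for j using sets.sets_into_space[OF c] by auto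
  then show "(\<integral>x. \<phi> (c x) \<partial>\<mu>) = (\<Sum>j\<in>I. \<phi> j * measure \<mu> (c -` {j}))"
    unfolding e using i c by simp
qed

lemma measurable_finite_classes:
  fixes \<phi> :: "'i \<Rightarrow> real" and c :: "'x::topological_space \<Rightarrow> 'i"
  assumes "finite I" "\<And>x. c x \<in> I" "\<And>j. c -` {j} \<in> sets borel"
  shows "(\<lambda>x. \<phi> (c x)) \<in> borel_measurable borel"
proof -
  have "c \<in> measurable borel (count_space I)"
    using assms by (subst measurable_count_space_eq2) auto
  then show ?thesis by (rule measurable_compose) simp
qed

text \<open>The labels are the numbers 1 to \<open>r\<close> because
  \<open>dirichlet_process\<close> indexes its partitions by \<open>{1..k}\<close>.\<close>

lemma simple_function_classes:
  fixes h :: "'x::topological_space \<Rightarrow> real"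
  assumes "simple_function borel h"
  shows "\<exists>r c e. (\<forall>x. c x \<in> {1..r::nat}) \<and> (\<forall>j. c -` {j} \<in> sets borel) \<and> h = (\<lambda>x. e (c x))"
proof -
  have fin: "finite (range h)" using simple_functionD(1)[OF assms] by simp
  then obtain e where e: "bij_betw e {1..card (range h)} (range h)"
    using ex_bij_betw_nat_finite_1 by blast
  define c where "c x = inv_into {1..card (range h)} e (h x)" for x
  have c_in: "c x \<in> {1..card (range h)}" for x
    unfolding c_def using e by (intro inv_into_into) (auto simp: bij_betw_def)
  have ec: "e (c x) = h x" for x
    unfolding c_def using e by (intro f_inv_into_f) (auto simp: bij_betw_def)
  have "c -` {j} \<in> sets borel" for j
  proof (cases "j \<in> {1..card (range h)}")
    case True
    have "c x = j \<longleftrightarrow> h x = e j" for x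
      using inj_onD[OF bij_betw_imp_inj_on[OF e], of "c x" j] c_in[of x] True ec[of x] by metis
    then have "c -` {j} = h -` {e j}" by auto
    then show ?thesis using simple_functionD(2)[OF assms, of "{e j}"] by simp
  next
    case False
    then have "c -` {j} = {}" using c_in by auto
    then show ?thesis by simp
  qed
  then show ?thesis using c_in ec by (intro exI[of _ "card (range h)"] exI[of _ c] exI[of _ e]) auto
qed

locale dirichlet_chain =
  innovations \<Omega> \<theta> q Y n "beta_measure (real n) a" "dirichlet_measure {1..n} (\<lambda>_. 1)"
    "distr W (PiM {1..n} (\<lambda>_. borel)) (\<lambda>\<omega>. \<lambda>i\<in>{1..n}. Z i \<omega>)"
  for \<Omega> :: "'w measure" and \<theta> :: "nat \<Rightarrow> 'w \<Rightarrow> real" and q :: "nat \<Rightarrow> 'w \<Rightarrow> nat \<Rightarrow> real"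
    and Y :: "nat \<Rightarrow> 'w \<Rightarrow> nat \<Rightarrow> 'x::topological_space" and n :: nat and a :: real
    and W :: "'p measure" and Z :: "nat \<Rightarrow> 'p \<Rightarrow> 'x" +
  fixes \<alpha> :: "'x measure"
  assumes sets_\<alpha>: "sets \<alpha> = sets borel" and finite_\<alpha>: "finite_measure \<alpha>"
    and a: "a = measure \<alpha> UNIV" "0 < a" and n: "1 \<le> n" and polya: "polya_sequence W \<alpha> Z"
begin

definition innov_mean :: "('x \<Rightarrow> real) \<Rightarrow> 'w \<Rightarrow> real" where
  "innov_mean g \<omega> = (\<Sum>i=1..n. q 1 \<omega> i * g (Y 1 \<omega> i))"

lemma measurable_q_component: "i \<in> {1..n} \<Longrightarrow> (\<lambda>\<omega>. q 1 \<omega> i) \<in> borel_measurable \<Omega>"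
  by (rule measurable_compose[OF measurable_q measurable_component_singleton]) auto

lemma measurable_Y_component: "i \<in> {1..n} \<Longrightarrow> (\<lambda>\<omega>. Y 1 \<omega> i) \<in> measurable \<Omega> borel"
  by (rule measurable_compose[OF measurable_Y measurable_component_singleton]) auto

lemma measurable_innov_mean:
  assumes g: "g \<in> borel_measurable borel" shows "innov_mean g \<in> borel_measurable \<Omega>"
  unfolding innov_mean_def[abs_def]
  by (intro borel_measurable_sum borel_measurable_times measurable_q_component
    measurable_compose[OF measurable_Y_component g])

lemma AE_\<theta>:
  assumes "m \<ge> 1" shows "AE \<omega> in \<Omega>. 0 < \<theta> m \<omega> \<and> \<theta> m \<omega> < 1"
proof -
  have "AE t in distr \<Omega> borel (\<theta> m). 0 < t \<and> t < 1"
    unfolding distr_\<theta>[OF assms] by (rule beta_measure_AE)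
  then show ?thesis by (rule AE_distrD[OF measurable_\<theta>[OF assms]])
qed

lemma gamma_weights_1: "gamma_weights {1..n} (\<lambda>_. 1)" by unfold_locales auto

lemma AE_q_nonneg:
  assumes "m \<ge> 1" shows "AE \<omega> in \<Omega>. \<forall>i\<in>{1..n}. 0 \<le> q m \<omega> i"
proof -
  have "AE p in distr \<Omega> MQ (q m). \<forall>i\<in>{1..n}. 0 \<le> p i"
    unfolding distr_q[OF assms] by (rule gamma_weights.AE_dirichlet_nonneg[OF gamma_weights_1])
  then show ?thesis by (rule AE_distrD[OF measurable_q[OF assms]])
qed

lemma AE_q_sum:
  assumes "m \<ge> 1" shows "AE \<omega> in \<Omega>. (\<Sum>i=1..n. q m \<omega> i) = 1"
proof -
  have "AE p in distr \<Omega> MQ (q m). (\<Sum>i=1..n. p i) = 1"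
    unfolding distr_q[OF assms] using n by (intro gamma_weights.AE_dirichlet_sum[OF gamma_weights_1]) simp
  then show ?thesis by (rule AE_distrD[OF measurable_q[OF assms]])
qed

lemma affine_recursion_innov_mean:
  assumes "g \<in> borel_measurable borel" shows "affine_recursion \<Omega> (\<theta> 1) (innov_mean g)"
proof
  show "AE \<omega> in \<Omega>. 0 < \<theta> 1 \<omega>" "AE \<omega> in \<Omega>. \<theta> 1 \<omega> \<le> 1"
    using AE_\<theta>[OF order_refl] by (auto elim: eventually_mono)
qed (use assms in \<open>auto intro: measurable_\<theta> measurable_innov_mean\<close>)

lemma functional_kernel_eq:
  assumes "g \<in> borel_measurable borel"
  shows "functional_kernel \<Omega> n \<theta> q Y g = affine_recursion.kern \<Omega> (\<theta> 1) (innov_mean g)"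
  by (rule ext) (simp only: functional_kernel_def affine_recursion.kern_def[OF affine_recursion_innov_mean[OF assms]] innov_mean_def)

abbreviation "law_Y \<equiv> distr W MY (\<lambda>\<omega>. \<lambda>i\<in>{1..n}. Z i \<omega>)"

lemma nn_integral_functional_kernel:
  assumes g[measurable]: "g \<in> borel_measurable borel" and f[measurable]: "f \<in> borel_measurable borel"
  shows "(\<integral>\<^sup>+y. f y \<partial>functional_kernel \<Omega> n \<theta> q Y g x) =
    (\<integral>\<^sup>+u. f (fst u * (\<Sum>i=1..n. fst (snd u) i * g (snd (snd u) i)) + (1 - fst u) * x)
      \<partial>(beta_measure (real n) a \<Otimes>\<^sub>M (dirichlet_measure {1..n} (\<lambda>_. 1) \<Otimes>\<^sub>M law_Y)))"
proof -
  have mV: "(\<lambda>\<omega>. \<theta> 1 \<omega> * (\<Sum>i=1..n. q 1 \<omega> i * g (Y 1 \<omega> i)) + (1 - \<theta> 1 \<omega>) * x) \<in> borel_measurable \<Omega>"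
    using measurable_\<theta>[OF order_refl] measurable_innov_mean[OF g] unfolding innov_mean_def[abs_def] by measurable
  have "(\<integral>\<^sup>+y. f y \<partial>functional_kernel \<Omega> n \<theta> q Y g x) =
      (\<integral>\<^sup>+\<omega>. f (\<theta> 1 \<omega> * (\<Sum>i=1..n. q 1 \<omega> i * g (Y 1 \<omega> i)) + (1 - \<theta> 1 \<omega>) * x) \<partial>\<Omega>)"
    unfolding functional_kernel_def by (rule nn_integral_distr[OF mV]) simp
  also have "\<dots> = (\<integral>\<^sup>+u. f (fst u * (\<Sum>i=1..n. fst (snd u) i * g (snd (snd u) i)) + (1 - fst u) * x) \<partial>distr \<Omega> MU (innovation 1))"
    by (subst nn_integral_distr[OF measurable_innovation]) (simp_all add: innovation_def)
  finally show ?thesis unfolding distr_innovation[OF order_refl] .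
qed

text \<open>Given the sample, the mixture of the weighted sample and an independent Dirichlet mean
  is a mean under the posterior Dirichlet law. Averaging over a Polya sample returns the prior,
  which is invariance.\<close>

lemma invariant_finite_classes:
  fixes c :: "'x \<Rightarrow> 'i" and e :: "'i \<Rightarrow> real"
  assumes I: "finite I" "\<And>x. c x \<in> I" "\<And>j. c -` {j} \<in> sets borel"
  shows "invariant_probability borel (functional_kernel \<Omega> n \<theta> q Y (\<lambda>x. e (c x)))
    (distr (dirichlet_measure I (\<lambda>j. measure \<alpha> (c -` {j}))) borel (\<lambda>p. \<Sum>j\<in>I. e j * p j))"
proof -
  interpret pp: polya_partition W \<alpha> Z I c
    by (rule polya_partition.intro[OF polya sets_\<alpha> finite_\<alpha> _ I]) (use a in simp)
  interpret gw: gamma_weights I pp.weight by (rule gamma_weights.intro[OF I(1) pp.weight_nonneg])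
  have b: "(\<lambda>j. measure \<alpha> (c -` {j})) = pp.weight" by (simp add: pp.weight_def fun_eq_iff)
  have aw: "a = (\<Sum>j\<in>I. pp.weight j)" using a pp.sum_weight by simp
  let ?g = "\<lambda>x. e (c x)" and ?D = "dirichlet_measure I pp.weight"
  let ?B = "beta_measure (real n) a" and ?Q = "dirichlet_measure {1..n} (\<lambda>_. 1) :: (nat \<Rightarrow> real) measure"
  have g[measurable]: "?g \<in> borel_measurable borel" by (rule measurable_finite_classes[OF I])
  let ?K = "functional_kernel \<Omega> n \<theta> q Y ?g"
  let ?\<pi> = "distr ?D borel (\<lambda>p. \<Sum>j\<in>I. e j * p j)"
  interpret D: prob_space ?D by (rule gw.prob_space_dirichlet)
  interpret B: prob_space ?B using a n by (intro prob_space_beta_measure) auto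
  interpret Q: prob_space ?Q by (rule gamma_weights.prob_space_dirichlet[OF gamma_weights_1])
  have mZ: "(\<lambda>\<omega>. \<lambda>i\<in>{1..n}. Z i \<omega>) \<in> measurable W MY" by (intro measurable_restrict pp.measurable_Z) auto
  interpret L: prob_space law_Y by (rule pp.W.prob_space_distr[OF mZ])
  interpret QL: pair_prob_space ?Q law_Y ..
  interpret BQL: pair_prob_space ?B "?Q \<Otimes>\<^sub>M law_Y" ..
  interpret BL: pair_sigma_finite ?B law_Y ..
  interpret DU: pair_sigma_finite ?D "?B \<Otimes>\<^sub>M (?Q \<Otimes>\<^sub>M law_Y)" ..
  have [measurable]: "?g \<in> borel_measurable borel" by (rule g)
  have K: "?K \<in> measurable borel (prob_algebra borel)"
    unfolding functional_kernel_eq[OF g] by (rule affine_recursion.measurable_kern[OF affine_recursion_innov_mean[OF g]])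
  have m\<pi>[measurable]: "(\<lambda>p. \<Sum>j\<in>I. e j * p j) \<in> borel_measurable ?D" by measurable
  have eq: "(\<integral>\<^sup>+x. (\<integral>\<^sup>+y. f y \<partial>?K x) \<partial>?\<pi>) = (\<integral>\<^sup>+x. f x \<partial>?\<pi>)"
    if f[measurable]: "f \<in> borel_measurable borel" and f1: "\<And>x. f x \<le> 1" for f
  proof -
    define H where "H z = f ((\<Sum>j\<in>I. e j * z j) / (\<Sum>j\<in>I. z j))" for z
    have H[measurable]: "H \<in> borel_measurable (PiM I (\<lambda>_. borel))" unfolding H_def[abs_def] by measurable
    have hom: "H (\<lambda>i\<in>I. s * z i) = H z" if "0 < s" for s z
      using that by (simp add: H_def sum_distrib_left[symmetric] mult.left_commute[of _ s])
    \<comment> \<open>The sample is integrated last: for a frozen \<open>y\<close> the integrals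
      over \<open>p\<close>, \<open>q\<close> and \<open>t\<close> form the left side of
      \<open>nn_integral_dirichlet_posterior\<close>.\<close>
    define \<Xi> where "\<Xi> u = (\<integral>\<^sup>+p. f (fst u * (\<Sum>i=1..n. fst (snd u) i * e (c (snd (snd u) i))) + (1 - fst u) * (\<Sum>j\<in>I. e j * p j)) \<partial>?D)" for u
    define \<Xi>' where "\<Xi>' y = (\<integral>\<^sup>+t. (\<integral>\<^sup>+v. \<Xi> (t, v, y) \<partial>?Q) \<partial>?B)" for y
    have m\<Xi>[measurable]: "\<Xi> \<in> borel_measurable (borel \<Otimes>\<^sub>M (MQ \<Otimes>\<^sub>M MY))"
      unfolding \<Xi>_def[abs_def] by measurable
    have m\<Xi>'[measurable]: "\<Xi>' \<in> borel_measurable MY"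
      unfolding \<Xi>'_def[abs_def] by measurable
    have \<Xi>'_eq: "\<Xi>' y = (\<integral>\<^sup>+z. H z \<partial>gamma_prod I (\<lambda>j. pp.weight j + real (card {i\<in>{1..n}. c (y i) = j})))" for y
      using gw.nn_integral_dirichlet_posterior[OF n _ aw a(2) f, of "\<lambda>i. c (y i)" e] I(2)
      by (simp add: \<Xi>'_def \<Xi>_def H_def)
    have "(\<integral>\<^sup>+x. (\<integral>\<^sup>+y. f y \<partial>?K x) \<partial>?\<pi>) = (\<integral>\<^sup>+p. (\<integral>\<^sup>+y. f y \<partial>?K (\<Sum>j\<in>I. e j * p j)) \<partial>?D)"
      using measurable_trans_op[OF K f] by (intro nn_integral_distr m\<pi>) (simp add: trans_op_def[abs_def])
    also have "\<dots> = (\<integral>\<^sup>+p. (\<integral>\<^sup>+u. f (fst u * (\<Sum>i=1..n. fst (snd u) i * e (c (snd (snd u) i))) + (1 - fst u) * (\<Sum>j\<in>I. e j * p j))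
        \<partial>(?B \<Otimes>\<^sub>M (?Q \<Otimes>\<^sub>M law_Y))) \<partial>?D)"
      unfolding nn_integral_functional_kernel[OF g f] ..
    also have "\<dots> = (\<integral>\<^sup>+u. \<Xi> u \<partial>(?B \<Otimes>\<^sub>M (?Q \<Otimes>\<^sub>M law_Y)))"
      unfolding \<Xi>_def by (rule DU.Fubini'[symmetric]) measurable
    also have "\<dots> = (\<integral>\<^sup>+t. (\<integral>\<^sup>+w. \<Xi> (t, w) \<partial>(?Q \<Otimes>\<^sub>M law_Y)) \<partial>?B)"
      by (rule QL.nn_integral_fst[symmetric]) measurable
    also have "\<dots> = (\<integral>\<^sup>+t. (\<integral>\<^sup>+y. (\<integral>\<^sup>+v. \<Xi> (t, v, y) \<partial>?Q) \<partial>law_Y) \<partial>?B)"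
      by (intro nn_integral_cong QL.nn_integral_snd[symmetric]) measurable
    also have "\<dots> = (\<integral>\<^sup>+y. \<Xi>' y \<partial>law_Y)"
      unfolding \<Xi>'_def by (rule BL.Fubini'[symmetric]) measurable
    also have "\<dots> = (\<integral>\<^sup>+\<omega>. \<Xi>' (\<lambda>i\<in>{1..n}. Z i \<omega>) \<partial>W)"
      by (rule nn_integral_distr[OF mZ]) (simp only: measurable_distr_eq1 m\<Xi>')
    also have "\<dots> = (\<integral>\<^sup>+\<omega>. (\<integral>\<^sup>+z. H z \<partial>gamma_prod I (\<lambda>j. pp.weight j + real (card {i\<in>{1..n}. c (Z i \<omega>) = j}))) \<partial>W)"
    proof -
      have "{i\<in>{1..n}. c ((\<lambda>i\<in>{1..n}. Z i \<omega>) i) = j} = {i\<in>{1..n}. c (Z i \<omega>) = j}" for \<omega> j by auto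
      then show ?thesis unfolding \<Xi>'_eq by (simp only:)
    qed
    also have "\<dots> = (\<integral>\<^sup>+z. H z \<partial>gamma_prod I pp.weight)"
      by (rule pp.nn_integral_gamma_prod_polya[OF H _ hom]) (simp_all add: H_def f1)
    also have "\<dots> = (\<integral>\<^sup>+p. f (\<Sum>j\<in>I. e j * p j) \<partial>?D)"
      by (subst nn_integral_dirichlet_measure) (simp_all add: H_def[abs_def] sum_divide_distrib)
    also have "\<dots> = (\<integral>\<^sup>+x. f x \<partial>?\<pi>)"
      by (rule nn_integral_distr[symmetric]) measurable
    finally show ?thesis .
  qed
  have "?\<pi> \<bind> ?K = ?\<pi>"
  proof (rule measure_eqI)
    have kb: "?K \<in> measurable ?\<pi> (subprob_algebra borel)"
      using measurable_prob_algebraD[OF K] by simp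
    have ne: "space ?\<pi> \<noteq> {}" by simp
    show s: "sets (?\<pi> \<bind> ?K) = sets ?\<pi>"
      using sets_bind[of ?\<pi> ?K borel] by (simp add: functional_kernel_def)
    fix A assume "A \<in> sets (?\<pi> \<bind> ?K)"
    then have A: "A \<in> sets borel" unfolding s by simp
    have "emeasure (?\<pi> \<bind> ?K) A = (\<integral>\<^sup>+x. emeasure (?K x) A \<partial>?\<pi>)"
      by (rule emeasure_bind[OF ne kb A])
    also have "\<dots> = (\<integral>\<^sup>+x. (\<integral>\<^sup>+y. indicator A y \<partial>?K x) \<partial>?\<pi>)"
      using A by (simp add: functional_kernel_def)
    also have "\<dots> = (\<integral>\<^sup>+x. indicator A x \<partial>?\<pi>)"
      using A by (intro eq) (auto split: split_indicator)
    finally show "emeasure (?\<pi> \<bind> ?K) A = emeasure ?\<pi> A" using A by simp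
  qed
  then show ?thesis
    unfolding b invariant_probability_def using D.prob_space_distr[OF m\<pi>] by simp
qed

end

section \<open>Finite-valued approximation and existence of an invariant law\<close>

context dirichlet_chain
begin

abbreviation weights :: "('x \<Rightarrow> nat) \<Rightarrow> nat \<Rightarrow> real" where
  "weights c \<equiv> \<lambda>j. measure \<alpha> (c -` {j})"

definition mean_law :: "nat \<Rightarrow> ('x \<Rightarrow> nat) \<Rightarrow> (nat \<Rightarrow> real) \<Rightarrow> real measure" where
  "mean_law r c e = distr (dirichlet_measure {1..r} (weights c)) borel (\<lambda>p. \<Sum>j\<in>{1..r}. e j * p j)"

definition classes_of :: "nat \<Rightarrow> ('x \<Rightarrow> nat) \<Rightarrow> bool" where
  "classes_of r c \<longleftrightarrow> (\<forall>x. c x \<in> {1..r}) \<and> (\<forall>j. c -` {j} \<in> sets borel)"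

lemma gamma_weights_classes: "gamma_weights {1..r} (weights c)"
  by unfold_locales auto

lemma sum_weights:
  assumes "classes_of r c" shows "(\<Sum>j\<in>{1..r}. weights c j) = a"
proof -
  have "(\<integral>x. (\<lambda>_. 1) (c x) \<partial>\<alpha>) = (\<Sum>j\<in>{1..r}. 1 * measure \<alpha> (c -` {j}))"
    by (rule integral_finite_classes[OF finite_\<alpha> sets_\<alpha>]) (use assms in \<open>auto simp: classes_of_def\<close>)
  moreover have "space \<alpha> = UNIV" using sets_eq_imp_space_eq[OF sets_\<alpha>] by simp
  ultimately show ?thesis using a by simp
qed

lemma measurable_linear: "(\<lambda>p. \<Sum>j\<in>I. e j * p j) \<in> borel_measurable (dirichlet_measure I b)"
  for e :: "nat \<Rightarrow> real"
  by measurable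

lemma real_distribution_mean_law: "real_distribution (mean_law r c e)"
proof -
  interpret D: prob_space "dirichlet_measure {1..r} (weights c)"
    by (rule gamma_weights.prob_space_dirichlet[OF gamma_weights_classes])
  show ?thesis
    unfolding mean_law_def real_distribution_def real_distribution_axioms_def
    by (intro conjI D.prob_space_distr measurable_linear) simp_all
qed

lemma invariant_mean_law:
  assumes "classes_of r c"
  shows "invariant_probability borel (functional_kernel \<Omega> n \<theta> q Y (\<lambda>x. e (c x))) (mean_law r c e)"
  unfolding mean_law_def by (rule invariant_finite_classes) (use assms in \<open>auto simp: classes_of_def\<close>)

text \<open>The point is that \<open>M\<close> does not depend on the partition. The tail bound
  involves \<open>e\<close> only through the \<alpha>-integral of
  \<open>ln (1 + \<bar>e (c x)\<bar> / C)\<close>, which is at most that of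
  \<open>ln (1 + 2 * \<bar>g x\<bar> / C)\<close> and so becomes small as \<open>C\<close>
  grows.\<close>

lemma mean_law_uniform_tail:
  assumes g[measurable]: "g \<in> borel_measurable borel" and log: "integrable \<alpha> (\<lambda>x. ln (1 + \<bar>g x\<bar>))" and \<epsilon>: "0 < \<epsilon>"
  shows "\<exists>M>0. \<forall>r c e. classes_of r c \<longrightarrow> (\<forall>x. \<bar>e (c x)\<bar> \<le> 2 * \<bar>g x\<bar>) \<longrightarrow>
    measure (dirichlet_measure {1..r} (weights c))
      {p \<in> space (dirichlet_measure {1..r} (weights c)). M < (\<Sum>j\<in>{1..r}. \<bar>e j\<bar> * p j)} < \<epsilon>"
proof -
  interpret \<alpha>: finite_measure \<alpha> by (rule finite_\<alpha>)
  note [measurable_cong] = sets_\<alpha>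
  \<comment> \<open>\<open>K\<close> is chosen such that
    \<open>exp (1 - a * K) < \<epsilon> / 2\<close>, and \<open>d\<close> solves
    \<open>ln (1 + 1 / d) = K\<close>. The lower bound 1 keeps \<open>exp K - 1\<close> positive;
    the summand 1 in the second argument makes the inequality strict.\<close>
  define K where "K = max 1 ((1 - ln (\<epsilon> / 2)) / a + 1)"
  define d where "d = 1 / (exp K - 1)"
  have K: "1 \<le> K" "(1 - ln (\<epsilon> / 2)) / a + 1 \<le> K" by (auto simp: K_def)
  have eK: "exp K - 1 > 0" using K by simp
  have d: "0 < d" using eK by (simp add: d_def)
  have "1 + 1 / d = exp K" by (simp add: d_def)
  then have lnd: "ln (1 + 1 / d) = K" by simp
  have "(1 - ln (\<epsilon> / 2)) + a \<le> a * K"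
    using K(2) a(2) by (simp add: field_simps)
  then have "1 - a * K < ln (\<epsilon> / 2)" using a(2) by linarith
  then have "exp (1 - a * ln (1 + 1 / d)) < exp (ln (\<epsilon> / 2))" unfolding lnd by simp
  then have exd: "exp (1 - a * ln (1 + 1 / d)) < \<epsilon> / 2" using \<epsilon> by simp
  define \<kappa> where "\<kappa> = 1 - exp (- 1 :: real)"
  have \<kappa>: "0 < \<kappa>" by (simp add: \<kappa>_def)
  \<comment> \<open>The offset 2 gives
    \<open>2 * \<bar>y\<bar> / real (k + 2) \<le> \<bar>y\<bar>\<close> for all \<open>k\<close>, so
    the hypothesis on \<open>ln (1 + \<bar>g x\<bar>)\<close> itself supplies the dominating
    function.\<close>
  have bound: "\<bar>ln (1 + 2 * \<bar>y\<bar> / real (k + 2))\<bar> \<le> ln (1 + \<bar>y\<bar>)" for y :: real and k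
  proof -
    have "2 * \<bar>y\<bar> / real (k + 2) \<le> \<bar>y\<bar>" by (simp add: field_simps)
    moreover have p: "0 \<le> 2 * \<bar>y\<bar> / real (k + 2)" by simp
    ultimately have "ln (1 + 2 * \<bar>y\<bar> / real (k + 2)) \<le> ln (1 + \<bar>y\<bar>)"
      by (subst ln_le_cancel_iff) linarith+
    moreover have "0 \<le> ln (1 + 2 * \<bar>y\<bar> / real (k + 2))" using p by (intro ln_ge_zero) linarith
    ultimately show ?thesis by linarith
  qed
  have "(\<lambda>k. \<integral>x. ln (1 + 2 * \<bar>g x\<bar> / real (k + 2)) \<partial>\<alpha>) \<longlonglongrightarrow> (\<integral>x. 0 \<partial>\<alpha>)"
  proof (rule integral_dominated_convergence[where w = "\<lambda>x. ln (1 + \<bar>g x\<bar>)"])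
    show "AE x in \<alpha>. (\<lambda>k. ln (1 + 2 * \<bar>g x\<bar> / real (k + 2))) \<longlonglongrightarrow> 0"
    proof (rule AE_I2)
      fix x
      have "(\<lambda>k. 2 * \<bar>g x\<bar> / real (k + 2)) \<longlonglongrightarrow> 0"
        using LIMSEQ_ignore_initial_segment[OF lim_const_over_n[of "2 * \<bar>g x\<bar>"], of 2] by simp
      then have "(\<lambda>k. ln (1 + 2 * \<bar>g x\<bar> / real (k + 2))) \<longlonglongrightarrow> ln (1 + 0)"
        by (intro tendsto_intros) auto
      then show "(\<lambda>k. ln (1 + 2 * \<bar>g x\<bar> / real (k + 2))) \<longlonglongrightarrow> 0" by simp
    qed
  qed (use log bound in auto)
  then have "(\<lambda>k. \<integral>x. ln (1 + 2 * \<bar>g x\<bar> / real (k + 2)) \<partial>\<alpha>) \<longlonglongrightarrow> 0" by simp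
  moreover have "0 < \<epsilon> / 2 * \<kappa>" using \<epsilon> \<kappa> by simp
  ultimately have "eventually (\<lambda>k. (\<integral>x. ln (1 + 2 * \<bar>g x\<bar> / real (k + 2)) \<partial>\<alpha>) < \<epsilon> / 2 * \<kappa>) sequentially"
    by (rule order_tendstoD(2))
  then obtain k where k: "(\<integral>x. ln (1 + 2 * \<bar>g x\<bar> / real (k + 2)) \<partial>\<alpha>) < \<epsilon> / 2 * \<kappa>"
    by (auto simp: eventually_sequentially)
  define C where "C = real (k + 2)"
  have C: "0 < C" by (simp add: C_def)
  show ?thesis
  proof (intro exI[of _ "C / d"] conjI allI impI)
    show "0 < C / d" using C d by simp
    fix r c and e :: "nat \<Rightarrow> real"
    assume cl: "classes_of r c" and eg: "\<forall>x. \<bar>e (c x)\<bar> \<le> 2 * \<bar>g x\<bar>"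
    interpret w: gamma_weights "{1..r}" "weights c" by (rule gamma_weights_classes)
    have "(\<Sum>j\<in>{1..r}. weights c j * ln (1 + \<bar>e j\<bar> / C)) = (\<integral>x. (\<lambda>j. ln (1 + \<bar>e j\<bar> / C)) (c x) \<partial>\<alpha>)"
      by (subst integral_finite_classes(2)[OF finite_\<alpha> sets_\<alpha>, of "{1..r}"])
         (use cl in \<open>auto simp: classes_of_def mult.commute\<close>)
    also have "\<dots> \<le> (\<integral>x. ln (1 + 2 * \<bar>g x\<bar> / C) \<partial>\<alpha>)"
    proof (rule integral_mono)
      show "integrable \<alpha> (\<lambda>x. ln (1 + \<bar>e (c x)\<bar> / C))"
        by (rule integral_finite_classes(1)[OF finite_\<alpha> sets_\<alpha>, of "{1..r}" c "\<lambda>j. ln (1 + \<bar>e j\<bar> / C)"])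
          (use cl in \<open>auto simp: classes_of_def\<close>)
      show "integrable \<alpha> (\<lambda>x. ln (1 + 2 * \<bar>g x\<bar> / C))"
        by (rule Bochner_Integration.integrable_bound[OF log]) (use bound[of _ k] in \<open>auto simp: C_def\<close>)
      show "ln (1 + \<bar>e (c x)\<bar> / C) \<le> ln (1 + 2 * \<bar>g x\<bar> / C)" for x
      proof -
        have "\<bar>e (c x)\<bar> / C \<le> 2 * \<bar>g x\<bar> / C" using eg C by (intro divide_right_mono) auto
        moreover have "0 \<le> \<bar>e (c x)\<bar> / C" using C by simp
        ultimately show ?thesis by (subst ln_le_cancel_iff) linarith+
      qed
    qed
    also have "\<dots> < \<epsilon> / 2 * \<kappa>" using k by (simp add: C_def)
    finally have "(\<Sum>j\<in>{1..r}. weights c j * ln (1 + \<bar>e j\<bar> / C)) / \<kappa> < \<epsilon> / 2"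
      using \<kappa> by (simp add: pos_divide_less_eq)
    moreover have "measure (dirichlet_measure {1..r} (weights c))
      {p \<in> space (dirichlet_measure {1..r} (weights c)). C / d < (\<Sum>j\<in>{1..r}. \<bar>e j\<bar> * p j)} \<le>
      (\<Sum>j\<in>{1..r}. weights c j * ln (1 + \<bar>e j\<bar> / C)) / \<kappa> + exp (1 - a * ln (1 + 1 / d))"
      unfolding \<kappa>_def by (rule w.dirichlet_tail_le[OF sum_weights[OF cl, symmetric] a(2) _ C d]) simp
    ultimately show "measure (dirichlet_measure {1..r} (weights c))
      {p \<in> space (dirichlet_measure {1..r} (weights c)). C / d < (\<Sum>j\<in>{1..r}. \<bar>e j\<bar> * p j)} < \<epsilon>"
      using exd by linarith
  qed
qed

text \<open>The factor 2 comes from the approximation of measurable functions by simple ones in a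
  metric space, taken relative to the point 0. Domination by a multiple of \<bar>g\<bar> serves both
  the uniform tail bound and dominated convergence.\<close>

lemma simple_approximation:
  fixes g :: "'x \<Rightarrow> real"
  assumes "g \<in> borel_measurable borel"
  obtains r c e where "\<And>k. classes_of (r k) (c k)" "\<And>x. (\<lambda>k. e k (c k x)) \<longlonglongrightarrow> g x"
    "\<And>k x. \<bar>e k (c k x)\<bar> \<le> 2 * \<bar>g x\<bar>"
proof -
  obtain F where F: "\<And>i. simple_function borel (F i)" "\<And>x. (\<lambda>i. F i x) \<longlonglongrightarrow> g x"
    "\<And>i x. dist (F i x) 0 \<le> 2 * dist (g x) 0"
    using borel_measurable_implies_sequence_metric[OF assms, of 0] by auto
  have "\<forall>k. \<exists>r c e. classes_of r c \<and> F k = (\<lambda>x. e (c x))"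
    using simple_function_classes[OF F(1)] unfolding classes_of_def by blast
  then obtain r c e where "\<And>k. classes_of (r k) (c k)" and Fe: "\<And>k. F k = (\<lambda>x. e k (c k x))" by metis
  then show ?thesis using F(2,3) by (intro that[of r c e]) (simp_all only: Fe dist_norm diff_0_right real_norm_def)
qed

lemma innov_mean_tendsto:
  assumes "\<And>x. (\<lambda>k. h k x) \<longlonglongrightarrow> g x"
  shows "(\<lambda>k. innov_mean (h k) \<omega>) \<longlonglongrightarrow> innov_mean g \<omega>"
  unfolding innov_mean_def by (intro tendsto_intros assms)

lemma measurable_classes_of: "classes_of r c \<Longrightarrow> (\<lambda>x. e (c x)) \<in> borel_measurable borel" for e :: "nat \<Rightarrow> real"
  by (rule measurable_finite_classes[of "{1..r}"]) (auto simp: classes_of_def)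

lemma invariant_weak_limit:
  assumes g: "g \<in> borel_measurable borel" and cl: "\<And>k. classes_of (r k) (c k)"
    and lim: "\<And>x. (\<lambda>k. e k (c k x)) \<longlonglongrightarrow> g x"
    and \<pi>: "real_distribution \<pi>" and wc: "weak_conv_m (\<lambda>k. mean_law (r k) (c k) (e k)) \<pi>"
  shows "invariant_probability borel (functional_kernel \<Omega> n \<theta> q Y g) \<pi>"
  unfolding functional_kernel_eq[OF g]
proof (rule affine_recursion.invariant_probability_limit[OF affine_recursion_innov_mean[OF g]
    affine_recursion_innov_mean[OF measurable_classes_of[OF cl]] innov_mean_tendsto[OF lim] _ \<pi> wc])
  show "invariant_probability borel (affine_recursion.kern \<Omega> (\<theta> 1) (innov_mean (\<lambda>x. e k (c k x)))) (mean_law (r k) (c k) (e k))" for k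
    unfolding functional_kernel_eq[OF measurable_classes_of[OF cl], symmetric] by (rule invariant_mean_law[OF cl])
qed

text \<open>The uniform tail bound makes the invariant laws for the finite-valued approximations
  tight. A weakly convergent subsequence then has a limit that is invariant for \<open>g\<close> by
  \<open>invariant_weak_limit\<close>.\<close>

theorem invariant_probability_exists:
  assumes g: "g \<in> borel_measurable borel" and log: "integrable \<alpha> (\<lambda>x. ln (1 + \<bar>g x\<bar>))"
  shows "\<exists>\<pi>. invariant_probability borel (functional_kernel \<Omega> n \<theta> q Y g) \<pi>"
proof -
  obtain r c e where cl: "\<And>k. classes_of (r k) (c k)" and lim: "\<And>x. (\<lambda>k. e k (c k x)) \<longlonglongrightarrow> g x"
    and le: "\<And>k x. \<bar>e k (c k x)\<bar> \<le> 2 * \<bar>g x\<bar>"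
    using simple_approximation[OF g] by metis
  let ?\<mu> = "\<lambda>k. mean_law (r k) (c k) (e k)"
  have "tight ?\<mu>"
    unfolding tight_def
  proof (intro conjI allI impI real_distribution_mean_law)
    fix \<epsilon> :: real assume "0 < \<epsilon>"
    then obtain M where M: "0 < M" and tail: "\<And>r c e. classes_of r c \<Longrightarrow> (\<forall>x. \<bar>e (c x)\<bar> \<le> 2 * \<bar>g x\<bar>) \<Longrightarrow>
        measure (dirichlet_measure {1..r} (weights c))
          {p \<in> space (dirichlet_measure {1..r} (weights c)). M < (\<Sum>j\<in>{1..r}. \<bar>e j\<bar> * p j)} < \<epsilon>"
      using mean_law_uniform_tail[OF g log] by blast
    \<comment> \<open>\<open>tight\<close> speaks of half-open intervals, so the left end lies
      strictly below \<open>- M\<close> in order to include the value \<open>- M\<close>.\<close>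
    have "1 - \<epsilon> < measure (?\<mu> k) {- M - 1<..M}" for k
    proof -
      let ?D = "dirichlet_measure {1..r k} (weights (c k))"
      interpret w: gamma_weights "{1..r k}" "weights (c k)" by (rule gamma_weights_classes)
      interpret D: prob_space ?D by (rule w.prob_space_dirichlet)
      let ?A = "{p \<in> space ?D. M < (\<Sum>j\<in>{1..r k}. \<bar>e k j\<bar> * p j)}"
      have A: "?A \<in> sets ?D" by measurable
      have m: "measure (?\<mu> k) {- M - 1<..M} = D.prob ((\<lambda>p. \<Sum>j\<in>{1..r k}. e k j * p j) -` {- M - 1<..M} \<inter> space ?D)"
        unfolding mean_law_def by (rule measure_distr[OF measurable_linear]) simp
      have "1 - \<epsilon> < 1 - D.prob ?A" using tail[OF cl, of "e k" k] le by simp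
      also have "\<dots> = D.prob (space ?D - ?A)" by (rule D.prob_compl[OF A, symmetric])
      also have "\<dots> \<le> D.prob ((\<lambda>p. \<Sum>j\<in>{1..r k}. e k j * p j) -` {- M - 1<..M} \<inter> space ?D)"
      proof (rule D.finite_measure_mono_AE)
        show "AE p in ?D. p \<in> space ?D - ?A \<longrightarrow> p \<in> (\<lambda>p. \<Sum>j\<in>{1..r k}. e k j * p j) -` {- M - 1<..M} \<inter> space ?D"
          using w.AE_dirichlet_nonneg
        proof eventually_elim
          case (elim p)
          have "\<bar>\<Sum>j\<in>{1..r k}. e k j * p j\<bar> \<le> (\<Sum>j\<in>{1..r k}. \<bar>e k j * p j\<bar>)" by (rule sum_abs)
          also have "\<dots> = (\<Sum>j\<in>{1..r k}. \<bar>e k j\<bar> * p j)"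
            using elim by (intro sum.cong) (auto simp: abs_mult)
          finally show ?case by auto
        qed
        show "(\<lambda>p. \<Sum>j\<in>{1..r k}. e k j * p j) -` {- M - 1<..M} \<inter> space ?D \<in> sets ?D"
          by (rule measurable_sets[OF measurable_linear]) simp
      qed
      finally show ?thesis unfolding m .
    qed
    then show "\<exists>x y. x < y \<and> (\<forall>k. 1 - \<epsilon> < measure (?\<mu> k) {x<..y})"
      using M by (intro exI[of _ "- M - 1"] exI[of _ M]) auto
  qed
  from tight_imp_convergent_subsubsequence[OF this strict_mono_id]
  obtain s \<pi> where s: "strict_mono (s :: nat \<Rightarrow> nat)" and \<pi>: "real_distribution \<pi>" and wc: "weak_conv_m (?\<mu> \<circ> id \<circ> s) \<pi>"
    by blast
  have "(\<lambda>k. e (s k) (c (s k) x)) \<longlonglongrightarrow> g x" for x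
    using LIMSEQ_subseq_LIMSEQ[OF lim s] by (simp add: comp_def)
  then have "invariant_probability borel (functional_kernel \<Omega> n \<theta> q Y g) \<pi>"
    using wc cl by (intro invariant_weak_limit[OF g _ _ \<pi>, where r = "\<lambda>k. r (s k)" and c = "\<lambda>k. c (s k)" and e = "\<lambda>k. e (s k)"])
      (simp_all add: comp_def)
  then show ?thesis by blast
qed

end

section \<open>Means of a Dirichlet process\<close>

context dirichlet_chain
begin

context
  fixes N :: "'v measure" and D :: "'v \<Rightarrow> 'x measure"
  assumes DP: "dirichlet_process N \<alpha> D"
begin

interpretation N: prob_space N using DP by (simp add: dirichlet_process_def)

lemma measurable_D: "D \<in> measurable N (subprob_algebra borel)"
  using DP by (intro measurable_prob_algebraD) (simp add: dirichlet_process_def)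

lemma D_prob: "\<omega> \<in> space N \<Longrightarrow> prob_space (D \<omega>) \<and> sets (D \<omega>) = sets borel"
  using DP measurable_space[of D N "prob_algebra borel" \<omega>] by (simp add: dirichlet_process_def space_prob_algebra)

lemma measurable_D_integral:
  fixes f :: "'x \<Rightarrow> real"
  assumes "f \<in> borel_measurable borel" shows "(\<lambda>\<omega>. \<integral>x. f x \<partial>D \<omega>) \<in> borel_measurable N"
  by (rule measurable_compose[OF measurable_D integral_measurable_subprob_algebra[OF assms]])

lemma measurable_D_nn_integral:
  assumes "f \<in> borel_measurable borel" shows "(\<lambda>\<omega>. \<integral>\<^sup>+x. f x \<partial>D \<omega>) \<in> borel_measurable N"
  by (rule measurable_compose[OF measurable_D nn_integral_measurable_subprob_algebra[OF assms]])

text \<open>The finite-dimensional definition of the process is applied to the partition into the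
  fibres of \<open>c\<close>. A label that is never attained gives an empty fibre of weight 0, which
  \<open>dirichlet_measure\<close> admits.\<close>

lemma distr_D_classes:
  assumes cl: "classes_of r c"
  shows "distr N borel (\<lambda>\<omega>. \<integral>x. e (c x) \<partial>D \<omega>) = mean_law r c e"
proof -
  let ?P = "PiM {1..r} (\<lambda>_. borel) :: (nat \<Rightarrow> real) measure"
  have B: "c -` {i} \<in> sets borel" for i using cl by (simp add: classes_of_def)
  have c: "c x \<in> {1..r}" for x using cl by (simp add: classes_of_def)
  let ?p = "\<lambda>\<omega>. \<lambda>i\<in>{1..r}. measure (D \<omega>) (c -` {i})"
  have fd: "distr N ?P ?p = dirichlet_measure {1..r} (weights c)"
  proof -
    have "(\<forall>i\<in>{1..r}. c -` {i} \<in> sets borel) \<and> disjoint_family_on (\<lambda>i. c -` {i}) {1..r} \<and> (\<Union>i\<in>{1..r}. c -` {i}) = UNIV"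
      using B c by (auto simp: disjoint_family_on_def)
    from DP[unfolded dirichlet_process_def, THEN conjunct2, THEN conjunct2, THEN spec[of _ r],
        THEN spec[of _ "\<lambda>i. c -` {i}"], THEN mp, OF this]
    show ?thesis .
  qed
  have mp: "?p \<in> measurable N ?P"
  proof (rule measurable_restrict)
    fix i
    have "(\<lambda>\<omega>. emeasure (D \<omega>) (c -` {i})) \<in> borel_measurable N"
      by (rule measurable_compose[OF measurable_D measurable_emeasure_subprob_algebra[OF B]])
    then show "(\<lambda>\<omega>. measure (D \<omega>) (c -` {i})) \<in> borel_measurable N" unfolding measure_def by measurable
  qed
  have ml: "(\<lambda>p. \<Sum>j\<in>{1..r}. e j * p j) \<in> borel_measurable ?P" by measurable
  have "mean_law r c e = distr (distr N ?P ?p) borel (\<lambda>p. \<Sum>j\<in>{1..r}. e j * p j)"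
    unfolding mean_law_def fd ..
  also have "\<dots> = distr N borel (\<lambda>\<omega>. \<Sum>j\<in>{1..r}. e j * ?p \<omega> j)"
    by (simp only: distr_distr[OF ml mp] comp_def)
  also have "\<dots> = distr N borel (\<lambda>\<omega>. \<integral>x. e (c x) \<partial>D \<omega>)"
  proof (rule distr_cong[OF refl refl])
    fix \<omega> assume "\<omega> \<in> space N"
    then interpret D\<omega>: prob_space "D \<omega>" using D_prob by simp
    have "(\<integral>x. e (c x) \<partial>D \<omega>) = (\<Sum>j\<in>{1..r}. e j * measure (D \<omega>) (c -` {j}))"
      by (rule integral_finite_classes(2)[OF _ _ _ c B])
         (use D_prob[OF \<open>\<omega> \<in> space N\<close>] D\<omega>.finite_measure_axioms in auto)
    then show "(\<Sum>j\<in>{1..r}. e j * ?p \<omega> j) = (\<integral>x. e (c x) \<partial>D \<omega>)" by simp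
  qed
  finally show ?thesis ..
qed

text \<open>Fatou is used twice. Under \<open>D \<omega>\<close> it bounds \<open>U \<omega>\<close>
  by the lower limit of the means \<open>X k \<omega>\<close>, so
  \<open>U \<omega> = \<infinity>\<close> forces \<open>M < X k \<omega>\<close> for all large
  \<open>k\<close>; under \<open>N\<close> it then bounds the probability of an infinite
  \<open>U\<close> by the uniform tail \<epsilon>.\<close>

lemma AE_integrable_D:
  fixes g :: "'x \<Rightarrow> real"
  assumes g: "g \<in> borel_measurable borel" and log: "integrable \<alpha> (\<lambda>x. ln (1 + \<bar>g x\<bar>))"
  shows "AE \<omega> in N. integrable (D \<omega>) g"
proof -
  note [measurable] = g
  obtain r c e where cl: "\<And>k. classes_of (r k) (c k)" and lim: "\<And>x. (\<lambda>k. e k (c k x)) \<longlonglongrightarrow> g x"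
    and le: "\<And>k x. \<bar>e k (c k x)\<bar> \<le> 2 * \<bar>g x\<bar>"
    using simple_approximation[OF g] by metis
  define U where "U \<omega> = (\<integral>\<^sup>+x. ennreal \<bar>g x\<bar> \<partial>D \<omega>)" for \<omega>
  define X where "X k \<omega> = (\<integral>x. \<bar>e k (c k x)\<bar> \<partial>D \<omega>)" for k \<omega>
  have mU: "U \<in> borel_measurable N" unfolding U_def[abs_def] by (rule measurable_D_nn_integral) measurable
  have cls: "finite {1..r k}" "c k x \<in> {1..r k}" "c k -` {j} \<in> sets borel" for k x j
    using cl[of k] by (auto simp: classes_of_def)
  have me: "(\<lambda>x. \<bar>e k (c k x)\<bar>) \<in> borel_measurable borel" for k
    by (rule measurable_classes_of[OF cl, of "\<lambda>j. \<bar>e k j\<bar>"])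
  have mX: "X k \<in> borel_measurable N" for k
    unfolding X_def[abs_def] by (rule measurable_D_integral[OF me])
  have "emeasure N {\<omega> \<in> space N. U \<omega> = \<infinity>} \<le> ennreal \<epsilon>" if \<epsilon>: "0 < \<epsilon>" for \<epsilon>
  proof -
    obtain M where M: "0 < M" and tail: "\<And>r c e. classes_of r c \<Longrightarrow> (\<forall>x. \<bar>e (c x)\<bar> \<le> 2 * \<bar>g x\<bar>) \<Longrightarrow>
        measure (dirichlet_measure {1..r} (weights c))
          {p \<in> space (dirichlet_measure {1..r} (weights c)). M < (\<Sum>j\<in>{1..r}. \<bar>e j\<bar> * p j)} < \<epsilon>"
      using mean_law_uniform_tail[OF g log \<epsilon>] by blast
    have A: "{\<omega> \<in> space N. M < X k \<omega>} \<in> sets N" for k using mX[of k] by measurable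
    have A': "{\<omega> \<in> space N. U \<omega> = \<infinity>} \<in> sets N" using mU by measurable
    have pX: "emeasure N {\<omega> \<in> space N. M < X k \<omega>} \<le> ennreal \<epsilon>" for k
    proof -
      have "N.prob {\<omega> \<in> space N. M < X k \<omega>} = measure (distr N borel (X k)) {M<..}"
        by (subst measure_distr[OF mX]) (auto intro!: arg_cong[where f = N.prob])
      also have "distr N borel (X k) = mean_law (r k) (c k) (\<lambda>j. \<bar>e k j\<bar>)"
        unfolding X_def[abs_def] by (rule distr_D_classes[OF cl, of "\<lambda>j. \<bar>e k j\<bar>"])
      also have "measure \<dots> {M<..} = measure (dirichlet_measure {1..r k} (weights (c k)))
          {p \<in> space (dirichlet_measure {1..r k} (weights (c k))). M < (\<Sum>j\<in>{1..r k}. \<bar>e k j\<bar> * p j)}"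
      proof -
        have "(\<lambda>p. \<Sum>j\<in>{1..r k}. \<bar>e k j\<bar> * p j) -` {M<..} \<inter> S = {p \<in> S. M < (\<Sum>j\<in>{1..r k}. \<bar>e k j\<bar> * p j)}" for S
          by auto
        then show ?thesis
          unfolding mean_law_def by (subst measure_distr[OF measurable_linear]) simp_all
      qed
      also have "\<dots> < \<epsilon>" using tail[OF cl] le by blast
      finally show ?thesis by (simp add: N.emeasure_eq_measure ennreal_leI)
    qed
    have "emeasure N {\<omega> \<in> space N. U \<omega> = \<infinity>} = (\<integral>\<^sup>+\<omega>. indicator {\<omega> \<in> space N. U \<omega> = \<infinity>} \<omega> \<partial>N)"
      using A' by simp
    also have "\<dots> \<le> (\<integral>\<^sup>+\<omega>. liminf (\<lambda>k. indicator {\<omega> \<in> space N. M < X k \<omega>} \<omega>) \<partial>N)"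
    proof (rule nn_integral_mono)
      fix \<omega> assume \<omega>: "\<omega> \<in> space N"
      then interpret D\<omega>: prob_space "D \<omega>" using D_prob by simp
      have sD: "sets (D \<omega>) = sets borel" using D_prob[OF \<omega>] by simp
      show "indicator {\<omega> \<in> space N. U \<omega> = \<infinity>} \<omega> \<le> liminf (\<lambda>k. indicator {\<omega> \<in> space N. M < X k \<omega>} \<omega> :: ennreal)"
      proof (cases "U \<omega> = \<infinity>")
        case True
        have eX: "(\<integral>\<^sup>+x. ennreal \<bar>e k (c k x)\<bar> \<partial>D \<omega>) = ennreal (X k \<omega>)" for k
          unfolding X_def
          by (rule nn_integral_eq_integral[OF integral_finite_classes(1)[OF D\<omega>.finite_measure_axioms sD cls, of "\<lambda>j. \<bar>e k j\<bar>"]]) simp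
        have "U \<omega> = (\<integral>\<^sup>+x. liminf (\<lambda>k. ennreal \<bar>e k (c k x)\<bar>) \<partial>D \<omega>)"
          unfolding U_def
        proof (rule nn_integral_cong)
          fix x
          have "(\<lambda>k. ennreal \<bar>e k (c k x)\<bar>) \<longlonglongrightarrow> ennreal \<bar>g x\<bar>"
            by (intro tendsto_ennrealI tendsto_rabs lim)
          then show "ennreal \<bar>g x\<bar> = liminf (\<lambda>k. ennreal \<bar>e k (c k x)\<bar>)"
            by (rule lim_imp_Liminf[OF sequentially_bot, symmetric])
        qed
        also have "\<dots> \<le> liminf (\<lambda>k. \<integral>\<^sup>+x. ennreal \<bar>e k (c k x)\<bar> \<partial>D \<omega>)"
        proof (rule nn_integral_liminf)
          show "(\<lambda>x. ennreal \<bar>e k (c k x)\<bar>) \<in> borel_measurable (D \<omega>)" for k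
            by (subst measurable_cong_sets[OF sD refl]) (rule measurable_compose[OF me measurable_ennreal])
        qed
        finally have "ennreal M < liminf (\<lambda>k. ennreal (X k \<omega>))" unfolding eX True by (simp add: top_unique)
        then have "eventually (\<lambda>k. ennreal M < ennreal (X k \<omega>)) sequentially" by (rule less_LiminfD)
        then have "eventually (\<lambda>k. 1 \<le> (indicator {\<omega> \<in> space N. M < X k \<omega>} \<omega> :: ennreal)) sequentially"
          by eventually_elim (use \<omega> M in \<open>simp add: ennreal_less_iff\<close>)
        then have "1 \<le> liminf (\<lambda>k. indicator {\<omega> \<in> space N. M < X k \<omega>} \<omega> :: ennreal)"
          by (rule Liminf_bounded)
        then show ?thesis by (auto split: split_indicator)
      qed simp
    qed
    also have "\<dots> \<le> liminf (\<lambda>k. \<integral>\<^sup>+\<omega>. indicator {\<omega> \<in> space N. M < X k \<omega>} \<omega> \<partial>N)"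
      using A by (intro nn_integral_liminf) simp
    also have "\<dots> = liminf (\<lambda>k. emeasure N {\<omega> \<in> space N. M < X k \<omega>})" using A by simp
    also have "\<dots> \<le> liminf (\<lambda>k. ennreal \<epsilon>)" by (intro Liminf_mono always_eventually allI pX)
    also have "\<dots> = ennreal \<epsilon>" by (simp add: Liminf_const)
    finally show ?thesis .
  qed
  then have "emeasure N {\<omega> \<in> space N. U \<omega> = \<infinity>} \<le> 0 + ennreal \<epsilon>" if "0 < \<epsilon>" for \<epsilon>
    unfolding add_0 using that .
  then have "emeasure N {\<omega> \<in> space N. U \<omega> = \<infinity>} \<le> 0" by (rule ennreal_le_epsilon)
  then have z: "emeasure N {\<omega> \<in> space N. U \<omega> = \<infinity>} = 0" by (rule antisym) simp
  have "AE \<omega> in N. U \<omega> \<noteq> \<infinity>"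
  proof (rule AE_I[OF _ z])
    show "{\<omega> \<in> space N. U \<omega> = \<infinity>} \<in> sets N" using mU by measurable
  qed auto
  then show ?thesis using AE_space
  proof eventually_elim
    case (elim \<omega>)
    then have sD: "sets (D \<omega>) = sets borel" using D_prob by simp
    have "g \<in> borel_measurable (D \<omega>)"
      by (subst measurable_cong_sets[OF sD refl]) (rule g)
    then show ?case using elim by (simp add: integrable_iff_bounded U_def less_top)
  qed
qed

text \<open>Almost every realisation integrates \<open>g\<close>, so twice \<bar>g\<bar> dominates
  the approximations and their means converge almost surely. Hence the invariant laws of the
  approximations converge weakly to the law of the mean, and invariance passes to this
  limit.\<close>

theorem invariant_dirichlet_mean:
  fixes g :: "'x \<Rightarrow> real"
  assumes g: "g \<in> borel_measurable borel" and log: "integrable \<alpha> (\<lambda>x. ln (1 + \<bar>g x\<bar>))"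
  shows "invariant_probability borel (functional_kernel \<Omega> n \<theta> q Y g) (distr N borel (\<lambda>\<omega>. \<integral>x. g x \<partial>D \<omega>))"
proof -
  obtain r c e where cl: "\<And>k. classes_of (r k) (c k)" and lim: "\<And>x. (\<lambda>k. e k (c k x)) \<longlonglongrightarrow> g x"
    and le: "\<And>k x. \<bar>e k (c k x)\<bar> \<le> 2 * \<bar>g x\<bar>"
    using simple_approximation[OF g] by metis
  define X where "X \<omega> = (\<integral>x. g x \<partial>D \<omega>)" for \<omega>
  define Xk where "Xk k \<omega> = (\<integral>x. e k (c k x) \<partial>D \<omega>)" for k \<omega>
  have mX[measurable]: "X \<in> borel_measurable N" unfolding X_def[abs_def] by (rule measurable_D_integral[OF g])
  have mXk[measurable]: "Xk k \<in> borel_measurable N" for k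
    unfolding Xk_def[abs_def] by (rule measurable_D_integral[OF measurable_classes_of[OF cl]])
  have dXk: "distr N borel (Xk k) = mean_law (r k) (c k) (e k)" for k
    unfolding Xk_def[abs_def] by (rule distr_D_classes[OF cl])
  have rd: "real_distribution (distr N borel X)"
    by (simp add: real_distribution_def real_distribution_axioms_def N.prob_space_distr)
  have conv: "AE \<omega> in N. (\<lambda>k. Xk k \<omega>) \<longlonglongrightarrow> X \<omega>"
    using AE_integrable_D[OF g log] AE_space
  proof eventually_elim
    case (elim \<omega>)
    have sD: "sets (D \<omega>) = sets borel" using D_prob elim by simp
    show ?case unfolding Xk_def X_def
    proof (rule integral_dominated_convergence[where w = "\<lambda>x. 2 * \<bar>g x\<bar>"])
      show "g \<in> borel_measurable (D \<omega>)" using elim by simp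
      show "(\<lambda>x. e k (c k x)) \<in> borel_measurable (D \<omega>)" for k
        by (subst measurable_cong_sets[OF sD refl]) (rule measurable_classes_of[OF cl])
    qed (use elim lim le in auto)
  qed
  have "weak_conv_m (\<lambda>k. mean_law (r k) (c k) (e k)) (distr N borel X)"
  proof (rule levy_continuity[OF real_distribution_mean_law rd])
    fix t
    have ch: "char (distr N borel S) t = (\<integral>\<omega>. iexp (t * S \<omega>) \<partial>N)" if "S \<in> borel_measurable N" for S
    proof -
      have "(\<lambda>x. iexp (t * x)) \<in> borel_measurable (borel :: real measure)" by simp
      then show ?thesis unfolding char_def by (rule integral_distr[OF that])
    qed
    have "(\<lambda>k. \<integral>\<omega>. iexp (t * Xk k \<omega>) \<partial>N) \<longlonglongrightarrow> (\<integral>\<omega>. iexp (t * X \<omega>) \<partial>N)"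
    proof (rule integral_dominated_convergence[where w = "\<lambda>_. 1"])
      show "AE \<omega> in N. (\<lambda>k. iexp (t * Xk k \<omega>)) \<longlonglongrightarrow> iexp (t * X \<omega>)"
        using conv by eventually_elim (intro tendsto_intros)
      show "(\<lambda>\<omega>. iexp (t * X \<omega>)) \<in> borel_measurable N" by measurable
      show "(\<lambda>\<omega>. iexp (t * Xk k \<omega>)) \<in> borel_measurable N" for k by measurable
    qed simp_all
    then show "(\<lambda>k. char (mean_law (r k) (c k) (e k)) t) \<longlonglongrightarrow> char (distr N borel X) t"
      unfolding dXk[symmetric] ch[OF mX] ch[OF mXk] .
  qed
  then have "invariant_probability borel (functional_kernel \<Omega> n \<theta> q Y g) (distr N borel X)"
    by (rule invariant_weak_limit[OF g cl lim rd])
  then show ?thesis unfolding X_def[abs_def] .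
qed

end

text \<open>If \<open>g\<close> takes values above \<open>c\<close> on a set \<open>A\<close> of positive \<open>\<alpha>\<close>-measure, the whole Polya sample
  lies in \<open>A\<close> with positive probability.\<close>

lemma prob_polya_in:
  assumes A: "A \<in> sets borel" "0 < measure \<alpha> A"
  shows "0 < measure W {\<omega> \<in> space W. \<forall>i\<in>{1..m}. Z i \<omega> \<in> A}"
proof -
  \<comment> \<open>Two classes suffice here: membership in \<open>A\<close> and its negation,
    labelled by \<open>bool\<close>.\<close>
  interpret pp: polya_partition W \<alpha> Z UNIV "\<lambda>x. x \<in> A"
  proof (rule polya_partition.intro[OF polya sets_\<alpha> finite_\<alpha>])
    show "(\<lambda>x. x \<in> A) -` {j} \<in> sets borel" for j
    proof -
      have "(\<lambda>x. x \<in> A) -` {j} = (if j then A else - A)" by auto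
      then show ?thesis using A by (auto simp: Compl_eq_Diff_UNIV)
    qed
  qed (use a in auto)
  define f :: "nat \<Rightarrow> (nat \<Rightarrow> bool) \<Rightarrow> real" where "f m x = (if \<forall>i\<in>{1..m}. x i then 1 else 0)" for m x
  have f0: "0 \<le> f m x" for m x by (simp add: f_def)
  have wA: "pp.weight True = measure \<alpha> A"
    by (auto simp: pp.weight_def intro!: arg_cong[where f = "measure \<alpha>"])
  have pos: "0 < (\<integral>\<omega>. f m (pp.classes m \<omega>) \<partial>W)" for m
  proof (induction m)
    case 0
    then show ?case by (simp add: f_def pp.W.prob_space)
  next
    case (Suc m)
    have "(\<integral>\<omega>. f (Suc m) (pp.classes (Suc m) \<omega>) \<partial>W) =
        (\<integral>\<omega>. f m (pp.classes m \<omega>) * indicator {\<omega> \<in> space W. (Z (Suc m) \<omega> \<in> A) = True} \<omega> \<partial>W)"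
    proof (rule Bochner_Integration.integral_cong[OF refl])
      fix \<omega> assume "\<omega> \<in> space W"
      moreover have "{1..Suc m} = insert (Suc m) {1..m}" by auto
      ultimately show "f (Suc m) (pp.classes (Suc m) \<omega>) = f m (pp.classes m \<omega>) * indicator {\<omega> \<in> space W. (Z (Suc m) \<omega> \<in> A) = True} \<omega>"
        by (simp add: f_def pp.classes_def split: split_indicator)
    qed
    also have "\<dots> = (\<integral>\<omega>. f m (pp.classes m \<omega>) * pp.counts m (pp.classes m \<omega>) True \<partial>W) / (measure \<alpha> UNIV + real m)"
      by (rule pp.integral_next_class)
    \<comment> \<open>Whatever the past, the predictive probability of \<open>A\<close> is at least
      \<open>measure \<alpha> A / (measure \<alpha> UNIV + real m)\<close>, the share of the prior
      alone.\<close>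
    also have "\<dots> \<ge> (\<integral>\<omega>. f m (pp.classes m \<omega>) * measure \<alpha> A \<partial>W) / (measure \<alpha> UNIV + real m)"
    proof (intro divide_right_mono integral_mono)
      show "integrable W (\<lambda>\<omega>. f m (pp.classes m \<omega>) * measure \<alpha> A)"
        by (rule pp.integrable_fun_classes)
      show "integrable W (\<lambda>\<omega>. f m (pp.classes m \<omega>) * pp.counts m (pp.classes m \<omega>) True)"
        by (rule pp.integrable_fun_classes[of "\<lambda>x. f m x * pp.counts m x True"])
      show "f m (pp.classes m \<omega>) * measure \<alpha> A \<le> f m (pp.classes m \<omega>) * pp.counts m (pp.classes m \<omega>) True" for \<omega>
        by (intro mult_left_mono f0) (simp add: pp.counts_def wA)
    qed simp
    moreover have "0 < (\<integral>\<omega>. f m (pp.classes m \<omega>) * measure \<alpha> A \<partial>W) / (measure \<alpha> UNIV + real m)"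
      using Suc A a by simp
    ultimately show ?case by linarith
  qed
  have "{\<omega> \<in> space W. \<forall>i\<in>{1..m}. Z i \<omega> \<in> A} \<in> sets W"
  proof (rule sets.sets_Collect_finite_All)
    show "{\<omega> \<in> space W. Z i \<omega> \<in> A} \<in> sets W" if "i \<in> {1..m}" for i
      using measurable_sets[OF pp.measurable_Z A(1), of i] that by (simp add: vimage_def Int_def conj_commute)
  qed simp
  moreover have "(\<integral>\<omega>. f m (pp.classes m \<omega>) \<partial>W) = (\<integral>\<omega>. indicator {\<omega> \<in> space W. \<forall>i\<in>{1..m}. Z i \<omega> \<in> A} \<omega> \<partial>W)"
    by (rule Bochner_Integration.integral_cong[OF refl]) (auto simp: f_def pp.classes_def split: split_indicator)
  ultimately show ?thesis using pos[of m] by (simp add: Int_absorb2 subset_eq)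
qed

lemma prob_Y_in:
  assumes A: "A \<in> sets borel" "0 < measure \<alpha> A"
  shows "0 < prob {\<omega> \<in> space \<Omega>. \<forall>i\<in>{1..n}. Y 1 \<omega> i \<in> A}"
proof -
  have mZ: "(\<lambda>\<omega>. \<lambda>i\<in>{1..n}. Z i \<omega>) \<in> measurable W MY"
    using polya by (intro measurable_restrict) (auto simp: polya_sequence_def)
  let ?S = "{y \<in> space MY. \<forall>i\<in>{1..n}. y i \<in> A}"
  have S: "?S \<in> sets MY"
  proof (rule sets.sets_Collect_finite_All)
    fix i assume "i \<in> {1..n}"
    from measurable_sets[OF measurable_component_singleton[OF this, of "\<lambda>_. borel"] A(1)]
    show "{y \<in> space MY. y i \<in> A} \<in> sets MY" by (simp only: vimage_def Int_def mem_Collect_eq conj_commute)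
  qed simp
  have "Y 1 -` ?S \<inter> space \<Omega> = {\<omega> \<in> space \<Omega>. \<forall>i\<in>{1..n}. Y 1 \<omega> i \<in> A}"
    using measurable_space[OF measurable_Y[OF order_refl]] by blast
  then have "measure (distr \<Omega> MY (Y 1)) ?S = prob {\<omega> \<in> space \<Omega>. \<forall>i\<in>{1..n}. Y 1 \<omega> i \<in> A}"
    unfolding measure_distr[OF measurable_Y[OF order_refl] S] by (rule arg_cong)
  moreover have "(\<lambda>\<omega>. \<lambda>i\<in>{1..n}. Z i \<omega>) -` ?S \<inter> space W = {\<omega> \<in> space W. \<forall>i\<in>{1..n}. Z i \<omega> \<in> A}"
    using measurable_space[OF mZ] by (auto simp only: vimage_eq Int_iff mem_Collect_eq restrict_apply' split: if_splits)
  then have "measure law_Y ?S = measure W {\<omega> \<in> space W. \<forall>i\<in>{1..n}. Z i \<omega> \<in> A}"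
    unfolding measure_distr[OF mZ S] by (rule arg_cong)
  ultimately show ?thesis
    using prob_polya_in[OF A, of n] distr_Y[OF order_refl] by simp
qed

text \<open>If \<open>g\<close> exceeded \<open>c\<close> on a set of positive \<alpha>-measure, the
  whole sample would fall there with positive probability, and \<open>innov_mean g\<close>, a convex
  combination of the sampled values, would exceed \<open>c\<close> too. The sign \<open>s\<close>
  treats the sets above and below \<open>c\<close> alike; both being null, \<open>g = c\<close>
  almost everywhere.\<close>

lemma innov_mean_nondegenerate:
  assumes g: "g \<in> borel_measurable borel" and nc: "\<nexists>c. AE x in \<alpha>. g x = c"
  shows "\<not> (AE \<omega> in \<Omega>. innov_mean g \<omega> = c)"
proof
  assume V: "AE \<omega> in \<Omega>. innov_mean g \<omega> = c"
  interpret \<alpha>: finite_measure \<alpha> by (rule finite_\<alpha>)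
  note [measurable] = g and [measurable_cong] = sets_\<alpha>
  have key: "measure \<alpha> {x. 0 < s * (g x - c)} = 0" if s: "s \<noteq> 0" for s :: real
  proof (rule ccontr)
    let ?A = "{x. 0 < s * (g x - c)}"
    assume "measure \<alpha> ?A \<noteq> 0"
    then have A: "0 < measure \<alpha> ?A" by (simp add: zero_less_measure_iff)
    have "?A \<in> sets borel" by measurable
    then have p: "0 < prob {\<omega> \<in> space \<Omega>. \<forall>i\<in>{1..n}. Y 1 \<omega> i \<in> ?A}" by (rule prob_Y_in[OF _ A])
    have "AE \<omega> in \<Omega>. \<not> (\<forall>i\<in>{1..n}. Y 1 \<omega> i \<in> ?A)"
      using V AE_q_nonneg[OF order_refl] AE_q_sum[OF order_refl]
    proof eventually_elim
      case (elim \<omega>)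
      show ?case
      proof
        assume Y: "\<forall>i\<in>{1..n}. Y 1 \<omega> i \<in> ?A"
        obtain i where i: "i \<in> {1..n}" "q 1 \<omega> i \<noteq> 0"
          using elim(3) by (metis sum.neutral zero_neq_one)
        have "0 < (\<Sum>i=1..n. q 1 \<omega> i * (s * (g (Y 1 \<omega> i) - c)))"
        proof (rule sum_pos2[OF _ i(1)])
          have pos: "0 < s * (g (Y 1 \<omega> j) - c)" "0 \<le> q 1 \<omega> j" if "j \<in> {1..n}" for j
            using elim(2) Y that by blast+
          show "0 < q 1 \<omega> i * (s * (g (Y 1 \<omega> i) - c))"
            by (rule mult_pos_pos[OF _ pos(1)[OF i(1)]]) (use pos(2)[OF i(1)] i(2) in \<open>auto simp only: order_less_le\<close>)
          show "0 \<le> q 1 \<omega> j * (s * (g (Y 1 \<omega> j) - c))" if "j \<in> {1..n}" for j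
            by (rule mult_nonneg_nonneg[OF pos(2)[OF that] less_imp_le[OF pos(1)[OF that]]])
        qed simp
        also have "\<dots> = s * (innov_mean g \<omega> - c * (\<Sum>i=1..n. q 1 \<omega> i))"
          unfolding innov_mean_def right_diff_distrib sum_distrib_left sum_subtractf by (simp only: ac_simps)
        also have "\<dots> = 0" unfolding elim(1) elim(3) by simp
        finally show False by simp
      qed
    qed
    then have "prob {\<omega> \<in> space \<Omega>. \<forall>i\<in>{1..n}. Y 1 \<omega> i \<in> ?A} = 0"
      by (intro prob_eq_0_AE) auto
    then show False using p by simp
  qed
  have "emeasure \<alpha> {x. 0 < s * (g x - c)} = 0" if "s \<noteq> 0" for s :: real
    using key[OF that] by (simp add: \<alpha>.emeasure_eq_measure)
  then have "AE x in \<alpha>. \<not> 0 < s * (g x - c)" if "s \<noteq> 0" for s :: real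
    using that sets_eq_imp_space_eq[OF sets_\<alpha>]
    by (intro AE_I[of _ _ "{x. 0 < s * (g x - c)}"]) auto
  from this[of 1] this[of "-1"] have "AE x in \<alpha>. g x = c"
    by (auto elim!: eventually_elim2)
  then show False using nc by blast
qed

lemma isCont_beta_dens: "t \<notin> {0, 1} \<Longrightarrow> isCont (beta_dens b c) t"
proof -
  assume t: "t \<notin> {0, 1}"
  show ?thesis
  proof (cases "0 < t \<and> t < 1")
    case True
    have "isCont (\<lambda>x. x powr (b - 1) * (1 - x) powr (c - 1) / Beta b c) t"
      unfolding divide_inverse using True by (intro continuous_intros) auto
    moreover have "eventually (\<lambda>x. x \<in> {0<..<1}) (nhds t)"
      using True by (intro eventually_nhds_in_open) auto
    then have "eventually (\<lambda>x. x powr (b - 1) * (1 - x) powr (c - 1) / Beta b c = beta_dens b c x) (nhds t)"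
      by eventually_elim (simp add: beta_dens_def)
    ultimately show ?thesis by (subst (asm) isCont_cong)
  next
    case False
    then have "t \<in> - {0..1}" using t by auto
    then have "eventually (\<lambda>x. x \<in> - {0..1}) (nhds t)" by (intro eventually_nhds_in_open) auto
    then have "eventually (\<lambda>x. 0 = beta_dens b c x) (nhds t)"
      by eventually_elim (auto simp: beta_dens_def)
    then show ?thesis using isCont_cong[of "\<lambda>_. 0" "beta_dens b c" t] by simp
  qed
qed

theorem harris_ergodic_functional_kernel:
  assumes g: "g \<in> borel_measurable borel" and log: "integrable \<alpha> (\<lambda>x. ln (1 + \<bar>g x\<bar>))"
    and nc: "\<nexists>c. AE x in \<alpha>. g x = c"
  shows "harris_ergodic borel (functional_kernel \<Omega> n \<theta> q Y g)"
proof -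
  obtain \<pi> where \<pi>: "invariant_probability borel (functional_kernel \<Omega> n \<theta> q Y g) \<pi>"
    using invariant_probability_exists[OF g log] by blast
  let ?\<phi> = "\<lambda>z. \<Sum>i=1..n. fst z i * g (snd z i)"
  have m\<phi>: "?\<phi> \<in> borel_measurable (MQ \<Otimes>\<^sub>M MY)"
    using g by measurable
  have mqY: "(\<lambda>\<omega>. (q 1 \<omega>, Y 1 \<omega>)) \<in> measurable \<Omega> (MQ \<Otimes>\<^sub>M MY)"
    by (intro measurable_Pair measurable_q measurable_Y) auto
  have V\<phi>: "distr (distr \<Omega> (MQ \<Otimes>\<^sub>M MY) (\<lambda>\<omega>. (q 1 \<omega>, Y 1 \<omega>))) borel ?\<phi> = distr \<Omega> borel (innov_mean g)"
    by (subst distr_distr[OF m\<phi> mqY]) (simp add: comp_def innov_mean_def[abs_def])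
  have "distr \<Omega> (borel \<Otimes>\<^sub>M borel) (\<lambda>\<omega>. (\<theta> 1 \<omega>, innov_mean g \<omega>)) =
      distr (distr \<Omega> MU (\<lambda>\<omega>. (\<theta> 1 \<omega>, (q 1 \<omega>, Y 1 \<omega>)))) (borel \<Otimes>\<^sub>M borel) (\<lambda>(t, z). (t, ?\<phi> z))"
    using m\<phi> mqY measurable_\<theta>[OF order_refl]
    by (subst distr_distr) (auto simp: comp_def innov_mean_def[abs_def])
  also have "\<dots> = distr (distr \<Omega> borel (\<theta> 1) \<Otimes>\<^sub>M distr \<Omega> (MQ \<Otimes>\<^sub>M MY) (\<lambda>\<omega>. (q 1 \<omega>, Y 1 \<omega>)))
      (borel \<Otimes>\<^sub>M borel) (\<lambda>(t, z). (t, ?\<phi> z))"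
    unfolding distr_\<theta>_qY[OF order_refl] ..
  \<comment> \<open>The pair law is pushed forward coordinatewise; the identity on the first
    coordinate is there to fit the product form of \<open>pair_measure_distr\<close>.\<close>
  also have "\<dots> = distr (distr \<Omega> borel (\<theta> 1)) borel (\<lambda>t. t) \<Otimes>\<^sub>M
      distr (distr \<Omega> (MQ \<Otimes>\<^sub>M MY) (\<lambda>\<omega>. (q 1 \<omega>, Y 1 \<omega>))) borel ?\<phi>"
  proof (rule pair_measure_distr[symmetric])
    show "sigma_finite_measure (distr (distr \<Omega> (MQ \<Otimes>\<^sub>M MY) (\<lambda>\<omega>. (q 1 \<omega>, Y 1 \<omega>))) borel ?\<phi>)"
      unfolding V\<phi> by (intro prob_space_imp_sigma_finite prob_space_distr measurable_innov_mean g)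
  qed (use m\<phi> in auto)
  also have "\<dots> = density lborel (\<lambda>t. ennreal (beta_dens (real n) a t)) \<Otimes>\<^sub>M distr \<Omega> borel (innov_mean g)"
    unfolding V\<phi> distr_\<theta>[OF order_refl] by (simp add: distr_id2 beta_measure_eq)
  finally have joint: "distr \<Omega> (borel \<Otimes>\<^sub>M borel) (\<lambda>\<omega>. (\<theta> 1 \<omega>, innov_mean g \<omega>)) =
      density lborel (\<lambda>t. ennreal (beta_dens (real n) a t)) \<Otimes>\<^sub>M distr \<Omega> borel (innov_mean g)" .
  interpret R: affine_recursion_density \<Omega> "\<theta> 1" "innov_mean g" "beta_dens (real n) a" "{0, 1}"
  proof (intro affine_recursion_density.intro affine_recursion_innov_mean[OF g] affine_recursion_density_axioms.intro)
    show "0 \<le> beta_dens (real n) a t" for t using n a by (intro beta_dens_nonneg) auto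
  qed (use joint isCont_beta_dens innov_mean_nondegenerate[OF g nc] in auto)
  show ?thesis
    using R.harris_ergodic_kern[of \<pi>] \<pi> unfolding functional_kernel_eq[OF g] by simp
qed

end

section \<open>Integrals along the measure-valued chain\<close>

lemma nn_integral_weighted_points:
  fixes \<mu> \<nu> :: "'x::topological_space measure"
  assumes \<mu>: "sets \<mu> = sets borel" and \<nu>: "sets \<nu> = sets borel" and J: "finite J"
    and em: "\<And>A. A \<in> sets borel \<Longrightarrow> emeasure \<mu> A =
      ennreal s * (\<Sum>i\<in>J. ennreal (w i) * emeasure (return borel (y i)) A) + ennreal t * emeasure \<nu> A"
    and h: "h \<in> borel_measurable borel"
  shows "(\<integral>\<^sup>+x. h x \<partial>\<mu>) = ennreal s * (\<Sum>i\<in>J. ennreal (w i) * h (y i)) + ennreal t * (\<integral>\<^sup>+x. h x \<partial>\<nu>)"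
proof -
  note [measurable_cong] = \<mu> \<nu>
  show ?thesis
    using h
  proof (induction rule: borel_measurable_induct)
    case (cong f g)
    have "(\<integral>\<^sup>+x. f x \<partial>\<rho>) = (\<integral>\<^sup>+x. g x \<partial>\<rho>)" for \<rho> :: "'x measure"
      using cong(3) by (intro nn_integral_cong) simp
    then show ?case using cong by simp
  next
    case (set A)
    then show ?case using em[OF set] \<mu> \<nu> by (simp add: emeasure_return)
  next
    case (mult u c)
    note [measurable] = mult(2)
    show ?case
      using mult(4) by (simp add: nn_integral_cmult sum_distrib_left distrib_left mult.left_commute[of c])
  next
    case (add u v)
    note [measurable] = add.hyps(1,3)
    show ?case
      using add.IH by (simp add: nn_integral_add sum.distrib distrib_left ac_simps)
  next
    case (seq U)
    note [measurable] = seq.hyps(1)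
    have pt: "(\<lambda>k. U k x) \<longlonglongrightarrow> (SUP i. U i) x" for x
      unfolding SUP_apply by (rule LIMSEQ_SUP) (use seq.hyps(3) in \<open>simp add: incseq_def le_fun_def\<close>)
    have i: "(\<lambda>k. \<integral>\<^sup>+x. U k x \<partial>\<rho>) \<longlonglongrightarrow> (\<integral>\<^sup>+x. (SUP i. U i) x \<partial>\<rho>)"
      if [measurable_cong]: "sets \<rho> = sets borel" for \<rho> :: "'x measure"
      by (rule nn_integral_LIMSEQ[OF seq.hyps(3) _ pt]) measurable
    have "(\<lambda>k. ennreal s * (\<Sum>i\<in>J. ennreal (w i) * U k (y i)) + ennreal t * (\<integral>\<^sup>+x. U k x \<partial>\<nu>)) \<longlonglongrightarrow>
      ennreal s * (\<Sum>i\<in>J. ennreal (w i) * (SUP i. U i) (y i)) + ennreal t * (\<integral>\<^sup>+x. (SUP i. U i) x \<partial>\<nu>)"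
      by (intro tendsto_add ennreal_tendsto_cmult tendsto_sum pt i \<nu>) simp_all
    then show ?case
      unfolding seq.IH[symmetric] by (rule LIMSEQ_unique[OF i[OF \<mu>]])
  qed
qed

text \<open>Negative coefficients are cut off by \<open>ennreal\<close>, whence
  \<open>max 0\<close>. Keeping the cut-off leads to a recursion valid at every \<omega>, not just
  almost every one, as \<open>markov_chain_innovations\<close> demands. The signed case splits
  \<open>h\<close> into its positive and negative parts.\<close>

lemma integral_weighted_points:
  fixes \<mu> \<nu> :: "'x::topological_space measure" and h :: "'x \<Rightarrow> real"
  assumes \<mu>: "sets \<mu> = sets borel" and \<nu>: "sets \<nu> = sets borel" and J: "finite J"
    and em: "\<And>A. A \<in> sets borel \<Longrightarrow> emeasure \<mu> A =
      ennreal s * (\<Sum>i\<in>J. ennreal (w i) * emeasure (return borel (y i)) A) + ennreal t * emeasure \<nu> A"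
    and h: "h \<in> borel_measurable borel" and int: "integrable \<nu> h"
  shows "integrable \<mu> h"
    and "(\<integral>x. h x \<partial>\<mu>) = max 0 s * (\<Sum>i\<in>J. max 0 (w i) * h (y i)) + max 0 t * (\<integral>x. h x \<partial>\<nu>)"
proof -
  let ?I = "\<lambda>f. max 0 s * (\<Sum>i\<in>J. max 0 (w i) * f (y i)) + max 0 t * (\<integral>x. f x \<partial>\<nu>)"
  have e: "ennreal (max 0 x) = ennreal x" for x by (simp add: max_def ennreal_neg)
  have nonneg: "has_bochner_integral \<mu> f (?I f)"
    if f[measurable]: "f \<in> borel_measurable borel" and f0: "\<And>x. 0 \<le> f x" and fi: "integrable \<nu> f" for f
  proof (rule has_bochner_integral_nn_integral)
    show "f \<in> borel_measurable \<mu>" using f by (subst measurable_cong_sets[OF \<mu> refl])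
    show "AE x in \<mu>. 0 \<le> f x" using f0 by simp
    have i0: "0 \<le> (\<integral>x. f x \<partial>\<nu>)" using f0 by simp
    have S0: "0 \<le> (\<Sum>i\<in>J. max 0 (w i) * f (y i))" using f0 by (intro sum_nonneg mult_nonneg_nonneg) auto
    show "0 \<le> ?I f" using S0 i0 by simp
    have "(\<integral>\<^sup>+x. ennreal (f x) \<partial>\<mu>) = ennreal s * (\<Sum>i\<in>J. ennreal (w i) * ennreal (f (y i))) + ennreal t * (\<integral>\<^sup>+x. ennreal (f x) \<partial>\<nu>)"
      by (rule nn_integral_weighted_points[OF \<mu> \<nu> J em]) simp_all
    also have "(\<integral>\<^sup>+x. ennreal (f x) \<partial>\<nu>) = ennreal (\<integral>x. f x \<partial>\<nu>)"
      by (rule nn_integral_eq_integral[OF fi]) (simp add: f0)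
    also have "(\<Sum>i\<in>J. ennreal (w i) * ennreal (f (y i))) = ennreal (\<Sum>i\<in>J. max 0 (w i) * f (y i))"
    proof -
      have "ennreal (w i) * ennreal (f (y i)) = ennreal (max 0 (w i) * f (y i))" for i
        by (simp add: ennreal_mult f0 e)
      then show ?thesis using f0 by (simp add: sum_ennreal)
    qed
    also have "ennreal s * \<dots> + ennreal t * ennreal (\<integral>x. f x \<partial>\<nu>) = ennreal (?I f)"
      unfolding e[of s, symmetric] e[of t, symmetric] using S0 i0 by (simp add: ennreal_mult ennreal_plus)
    finally show "(\<integral>\<^sup>+x. ennreal (f x) \<partial>\<mu>) = ennreal (?I f)" .
  qed
  let ?p = "\<lambda>x. max 0 (h x)" and ?m = "\<lambda>x. max 0 (- h x)"
  have ip: "integrable \<nu> ?p" and im: "integrable \<nu> ?m" using int by auto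
  have "has_bochner_integral \<mu> (\<lambda>x. ?p x - ?m x) (?I ?p - ?I ?m)"
    by (intro has_bochner_integral_diff nonneg ip im) (use h in auto)
  moreover have pm: "?p x - ?m x = h x" for x by (simp add: max_def)
  moreover have "?I ?p - ?I ?m = ?I h"
  proof -
    have "(\<integral>x. ?p x \<partial>\<nu>) - (\<integral>x. ?m x \<partial>\<nu>) = (\<integral>x. h x \<partial>\<nu>)"
      using Bochner_Integration.integral_diff[OF ip im] unfolding pm by simp
    moreover have "(\<Sum>i\<in>J. max 0 (w i) * ?p (y i)) - (\<Sum>i\<in>J. max 0 (w i) * ?m (y i)) = (\<Sum>i\<in>J. max 0 (w i) * h (y i))"
      unfolding sum_subtractf[symmetric] right_diff_distrib[symmetric] pm ..
    moreover have "?I ?p - ?I ?m = max 0 s * ((\<Sum>i\<in>J. max 0 (w i) * ?p (y i)) - (\<Sum>i\<in>J. max 0 (w i) * ?m (y i))) +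
        max 0 t * ((\<integral>x. ?p x \<partial>\<nu>) - (\<integral>x. ?m x \<partial>\<nu>))"
      by (simp only: right_diff_distrib)
    ultimately show ?thesis by (simp only:)
  qed
  ultimately have "has_bochner_integral \<mu> h (?I h)" by (simp only:)
  then show "integrable \<mu> h" "(\<integral>x. h x \<partial>\<mu>) = ?I h"
    by (auto simp: has_bochner_integral_iff)
qed

text \<open>Outside a null set the weights are nonnegative; in general \<open>ennreal\<close> in the definition of
  \<open>measure_chain\<close> truncates them at 0.\<close>

lemma integral_measure_chain:
  fixes g :: "'x::topological_space \<Rightarrow> real"
  assumes P0: "sets P0 = sets borel" and g: "g \<in> borel_measurable borel" "integrable P0 g"
  shows "integrable (measure_chain n \<theta> q Y P0 m \<omega>) g"
    and "(\<integral>x. g x \<partial>measure_chain n \<theta> q Y P0 (Suc m) \<omega>) =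
      max 0 (\<theta> (Suc m) \<omega>) * (\<Sum>i=1..n. max 0 (q (Suc m) \<omega> i) * g (Y (Suc m) \<omega> i)) +
      max 0 (1 - \<theta> (Suc m) \<omega>) * (\<integral>x. g x \<partial>measure_chain n \<theta> q Y P0 m \<omega>)"
proof -
  note step = integral_weighted_points[OF sets_measure_chain[OF P0] sets_measure_chain[OF P0] finite_atLeastAtMost
      emeasure_measure_chain_Suc[OF P0] g(1)]
  show i: "integrable (measure_chain n \<theta> q Y P0 m \<omega>) g" for m
  proof (induction m)
    case 0
    then show ?case using g(2) by simp
  next
    case (Suc m)
    show ?case by (rule step(1)[OF _ Suc.IH])
  qed
  show "(\<integral>x. g x \<partial>measure_chain n \<theta> q Y P0 (Suc m) \<omega>) =
      max 0 (\<theta> (Suc m) \<omega>) * (\<Sum>i=1..n. max 0 (q (Suc m) \<omega> i) * g (Y (Suc m) \<omega> i)) +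
      max 0 (1 - \<theta> (Suc m) \<omega>) * (\<integral>x. g x \<partial>measure_chain n \<theta> q Y P0 m \<omega>)"
    by (rule step(2)[OF _ i])
qed

context dirichlet_chain
begin

text \<open>The update \<open>\<Phi>\<close> with cut-offs describes the chain at every \<omega>,
  while \<open>functional_kernel\<close> is defined by the formula without them. The resulting laws
  agree, since the weights are nonnegative almost surely.\<close>

theorem markov_chain_integral_measure_chain:
  fixes g :: "'x \<Rightarrow> real"
  assumes P0: "sets P0 = sets borel" and g: "g \<in> borel_measurable borel" "integrable P0 g"
  shows "markov_chain \<Omega> borel (functional_kernel \<Omega> n \<theta> q Y g) (\<lambda>m \<omega>. \<integral>x. g x \<partial>measure_chain n \<theta> q Y P0 m \<omega>)"
proof (rule markov_chain_innovations)
  define \<Phi> :: "real \<Rightarrow> real \<times> (nat \<Rightarrow> real) \<times> (nat \<Rightarrow> 'x) \<Rightarrow> real" where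
    "\<Phi> x u = max 0 (fst u) * (\<Sum>i=1..n. max 0 (fst (snd u) i) * g (snd (snd u) i)) + max 0 (1 - fst u) * x" for x u
  note [measurable] = g(1)
  show m\<Phi>: "case_prod \<Phi> \<in> borel_measurable (borel \<Otimes>\<^sub>M MU)"
    unfolding \<Phi>_def[abs_def] by measurable
  show "(\<integral>x. g x \<partial>measure_chain n \<theta> q Y P0 0 \<omega>) = (\<integral>x. g x \<partial>P0)" for \<omega> by simp
  show "(\<integral>x. g x \<partial>measure_chain n \<theta> q Y P0 (Suc m) \<omega>) =
      \<Phi> (\<integral>x. g x \<partial>measure_chain n \<theta> q Y P0 m \<omega>) (innovation (Suc m) \<omega>)" for m \<omega>
    unfolding integral_measure_chain(2)[OF P0 g] by (simp add: \<Phi>_def innovation_def)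
  show "functional_kernel \<Omega> n \<theta> q Y g \<in> measurable borel (prob_algebra borel)"
    unfolding functional_kernel_eq[OF g(1)]
    by (rule affine_recursion.measurable_kern[OF affine_recursion_innov_mean[OF g(1)]])
  fix x
  have m\<Phi>x: "\<Phi> x \<in> borel_measurable MU"
    using measurable_compose[OF measurable_Pair1'[of x borel MU] m\<Phi>] by simp
  have mV: "(\<lambda>\<omega>. \<theta> 1 \<omega> * innov_mean g \<omega> + (1 - \<theta> 1 \<omega>) * x) \<in> borel_measurable \<Omega>"
    using measurable_\<theta>[OF order_refl] measurable_innov_mean[OF g(1)] by measurable
  have "functional_kernel \<Omega> n \<theta> q Y g x = distr \<Omega> borel (\<lambda>\<omega>. \<theta> 1 \<omega> * innov_mean g \<omega> + (1 - \<theta> 1 \<omega>) * x)"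
    unfolding functional_kernel_def innov_mean_def ..
  also have "\<dots> = distr \<Omega> borel (\<lambda>\<omega>. \<Phi> x (innovation 1 \<omega>))"
  proof (rule distr_cong_AE[OF refl refl _ mV])
    show "(\<lambda>\<omega>. \<Phi> x (innovation 1 \<omega>)) \<in> borel_measurable \<Omega>"
      by (rule measurable_compose[OF measurable_innovation[OF order_refl] m\<Phi>x])
    show "AE \<omega> in \<Omega>. \<theta> 1 \<omega> * innov_mean g \<omega> + (1 - \<theta> 1 \<omega>) * x = \<Phi> x (innovation 1 \<omega>)"
      using AE_\<theta>[OF order_refl] AE_q_nonneg[OF order_refl]
    proof eventually_elim
      case (elim \<omega>)
      have "(\<Sum>i=1..n. max 0 (q 1 \<omega> i) * g (Y 1 \<omega> i)) = innov_mean g \<omega>"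
        unfolding innov_mean_def using elim(2) by (intro sum.cong refl) (simp add: max_absorb2)
      then show ?case using elim(1) by (simp add: \<Phi>_def innovation_def max_absorb2)
    qed
  qed
  also have "\<dots> = distr (distr \<Omega> MU (innovation 1)) borel (\<Phi> x)"
    by (simp only: distr_distr[OF m\<Phi>x measurable_innovation[OF order_refl]] comp_def)
  finally show "functional_kernel \<Omega> n \<theta> q Y g x =
      distr (beta_measure (real n) a \<Otimes>\<^sub>M (dirichlet_measure {1..n} (\<lambda>_. 1) \<Otimes>\<^sub>M law_Y)) borel (\<Phi> x)"
    unfolding distr_innovation[OF order_refl] .
qed

end

text \<open>\<open>integrable P0 g\<close> makes every \<open>G m \<omega>\<close> a genuine
  integral rather than the default value 0 of an undefined one.\<close>

theorem theorem4:
  fixes \<Omega> :: "'w measure" and W :: "'p measure" and N :: "'v measure"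
    and \<alpha> P0 :: "'x::polish_space measure"
    and a :: real and n :: nat
    and \<theta> :: "nat \<Rightarrow> 'w \<Rightarrow> real"
    and q :: "nat \<Rightarrow> 'w \<Rightarrow> nat \<Rightarrow> real"
    and Y :: "nat \<Rightarrow> 'w \<Rightarrow> nat \<Rightarrow> 'x"
    and Z :: "nat \<Rightarrow> 'p \<Rightarrow> 'x"
    and P :: "nat \<Rightarrow> 'w \<Rightarrow> 'x measure"
    and G :: "nat \<Rightarrow> 'w \<Rightarrow> real"
    and g :: "'x \<Rightarrow> real"
    and D :: "'v \<Rightarrow> 'x measure"
    and K :: "real \<Rightarrow> real measure"
  assumes "sets \<alpha> = sets borel" and "finite_measure \<alpha>"
    and "a = measure \<alpha> UNIV" and "a > 0" and "n \<ge> 1"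
    and "prob_space \<Omega>"
    and "prob_space.indep_vars \<Omega> (\<lambda>_. borel) \<theta> {1..}"
    and "\<And>m. m \<ge> 1 \<Longrightarrow> distr \<Omega> borel (\<theta> m) = beta_measure (real n) a"
    and "prob_space.indep_vars \<Omega> (\<lambda>_. PiM {1..n} (\<lambda>_. borel)) q {1..}"
    and "\<And>m. m \<ge> 1 \<Longrightarrow>
           distr \<Omega> (PiM {1..n} (\<lambda>_. borel)) (q m) = dirichlet_measure {1..n} (\<lambda>_. 1)"
    and "prob_space.indep_vars \<Omega> (\<lambda>_. PiM {1..n} (\<lambda>_. borel)) Y {1..}"
    and "polya_sequence W \<alpha> Z"
    and "\<And>m. m \<ge> 1 \<Longrightarrow>
           distr \<Omega> (PiM {1..n} (\<lambda>_. borel)) (Y m) =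
           distr W (PiM {1..n} (\<lambda>_. borel)) (\<lambda>\<omega>. \<lambda>i\<in>{1..n}. Z i \<omega>)"
    and "prob_space.indep_sets \<Omega>
           ((!) [sets (generated_by \<Omega> borel {1..} \<theta>),
                 sets (generated_by \<Omega> (PiM {1..n} (\<lambda>_. borel)) {1..} q),
                 sets (generated_by \<Omega> (PiM {1..n} (\<lambda>_. borel)) {1..} Y)]) {..<3}"
    and "prob_space P0" and "sets P0 = sets borel"
    and "P = measure_chain n \<theta> q Y P0"
    and "g \<in> borel_measurable borel" and "integrable P0 g"
    and "G = (\<lambda>m \<omega>. \<integral>x. g x \<partial>P m \<omega>)"
    and "K = functional_kernel \<Omega> n \<theta> q Y g"
    and "integrable \<alpha> (\<lambda>x. ln (1 + \<bar>g x\<bar>))"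
  shows "markov_chain \<Omega> borel K G \<and>
    ((\<nexists>c. AE x in \<alpha>. g x = c) \<longrightarrow> harris_ergodic borel K) \<and>
    (\<exists>!\<pi>. invariant_probability borel K \<pi>) \<and>
    (dirichlet_process N \<alpha> D \<longrightarrow>
       (AE \<omega> in N. integrable (D \<omega>) g) \<and>
       invariant_probability borel K (distr N borel (\<lambda>\<omega>. \<integral>x. g x \<partial>D \<omega>)))"
proof -
  interpret \<Omega>: prob_space \<Omega> by (rule assms(6))
  interpret C: dirichlet_chain \<Omega> \<theta> q Y n a W Z \<alpha>
  proof (intro dirichlet_chain.intro innovations.intro innovations_axioms.intro dirichlet_chain_axioms.intro)
    show "prob_space \<Omega>" by (rule assms(6))
    show "\<Omega>.indep_vars (\<lambda>_. borel) \<theta> {1..}" by (rule assms(7))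
    show "\<Omega>.indep_vars (\<lambda>_. PiM {1..n} (\<lambda>_. borel)) q {1..}" by (rule assms(9))
    show "\<Omega>.indep_vars (\<lambda>_. PiM {1..n} (\<lambda>_. borel)) Y {1..}" by (rule assms(11))
    show "\<Omega>.indep_sets ((!) [sets (generated_by \<Omega> borel {1..} \<theta>),
        sets (generated_by \<Omega> (PiM {1..n} (\<lambda>_. borel)) {1..} q),
        sets (generated_by \<Omega> (PiM {1..n} (\<lambda>_. borel)) {1..} Y)]) {..<3}" by (rule assms(14))
    show "sets \<alpha> = sets borel" "finite_measure \<alpha>" "a = measure \<alpha> UNIV" "0 < a" "1 \<le> n" "polya_sequence W \<alpha> Z"
      using assms(1-5,12) by auto
  qed (use assms(8,10,13) in auto)
  have g: "g \<in> borel_measurable borel" and log: "integrable \<alpha> (\<lambda>x. ln (1 + \<bar>g x\<bar>))"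
    using assms by auto
  interpret R: affine_recursion \<Omega> "\<theta> 1" "C.innov_mean g" by (rule C.affine_recursion_innov_mean[OF g])
  have K: "K = functional_kernel \<Omega> n \<theta> q Y g" by (rule assms(21))
  have "markov_chain \<Omega> borel K G"
    unfolding K assms(17,20) by (rule C.markov_chain_integral_measure_chain[OF assms(16,18,19)])
  moreover have "(\<nexists>c. AE x in \<alpha>. g x = c) \<longrightarrow> harris_ergodic borel K"
    unfolding K using C.harris_ergodic_functional_kernel[OF g log] by blast
  moreover have "\<exists>!\<pi>. invariant_probability borel K \<pi>"
    using C.invariant_probability_exists[OF g log] R.invariant_probability_unique
    unfolding K C.functional_kernel_eq[OF g] by blast
  moreover have "dirichlet_process N \<alpha> D \<longrightarrow> (AE \<omega> in N. integrable (D \<omega>) g) \<and>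
      invariant_probability borel K (distr N borel (\<lambda>\<omega>. \<integral>x. g x \<partial>D \<omega>))"
    unfolding K using C.AE_integrable_D[OF _ g log] C.invariant_dirichlet_mean[OF _ g log] by blast
  ultimately show ?thesis by blast
qed

end
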